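(* Let $F_2$ be the free group on $a,b$. Let $X\subset F_2$ be the set of positive words in $a,b$, including the identity, and let $Y\subset F_2$ be the set of elements of the form $a^nw$ with $n\in\mathbb{Z}$ and $w\in X$. Then there is a canonical isomorphism between the Cuntz extension $$0\to J_2\to E_2\to\mathcal{O}_2\to 0$$ and the extension $$0\to\mathcal{K}(\ell^2(X))\to C^*(X)\to C^*(Y)\to 0,$$ in which the quotient map $C^*(X)\to C^*(Y)$ takes the operators $a,b$ on $\ell^2(X)$ to the corresponding operators $a,b$ on $\ell^2(Y)$. That is, there are isomorphisms $\mathcal{K}(\ell^2(X))\cong J_2$, $C^*(X)\cong E_2$, $C^*(Y)\cong\mathcal{O}_2$, the latter two taking the generators $a,b$ to the canonical generating isometries, which commute with the maps in the two extensions.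
   Context: For a subset $Z\subseteq F_2$ and $g\in F_2$, the partial translation by $g$ on $Z$ is the map $z\mapsto zg$ with domain $\{z\in Z: zg\in Z\}$, regarded as the partial isometry of $\ell^2(Z)$ sending $\delta_z$ to $\delta_{zg}$ if $zg\in Z$ and to $0$ otherwise. The partial translation algebra $C^*(Z)\subset B(\ell^2(Z))$ is the $C^*$-algebra generated by these operators for all $g\in F_2$. For $Z=X$ or $Z=Y$, the symbols $a,b$ also denote the operators on $\ell^2(Z)$ given by the partial translations by the group elements $a,b$ respectively. $\mathcal{K}(\ell^2(X))$ denotes the compact operators. The Cuntz algebra $\mathcal{O}_n$ is the $C^*$-algebra generated by $n$ isometries $V_1,\dots,V_n$ with $\sum_iV_iV_i^*=1$. $E_2$ is the $C^*$-subalgebra of $\mathcal{O}_3$ generated by the first two isometries $V_1,V_2$. The Cuntz extension is the extension $0\to J_2\to E_2\to\mathcal{O}_2\to0$ in which the quotient map takes the generators $V_1,V_2$ of $E_2$ to the two generating isometries of $\mathcal{O}_2$, and $J_2$ (an ideal of $E_2$ isomorphic to the algebra of compact operators) is its kernel, namely the ideal generated by $1-V_1V_1^*-V_2V_2^*$. *)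

theory Defs
  imports "HOL-Analysis.Analysis"
begin

datatype gen = Gen_a | Gen_b

text \<open>A letter is a generator together with a sign; \<^const>\<open>True\<close> stands for exponent \<open>1\<close> and
  \<^const>\<open>False\<close> for exponent \<open>-1\<close>.\<close>

type_synonym letter = "gen \<times> bool"

definition inv_letter :: "letter \<Rightarrow> letter"
  where "inv_letter l = (fst l, \<not> snd l)"

fun reduced :: "letter list \<Rightarrow> bool" where
  "reduced (x # y # w) \<longleftrightarrow> y \<noteq> inv_letter x \<and> reduced (y # w)"
| "reduced _ \<longleftrightarrow> True"

typedef F2 = "{w. reduced w}"
  by (rule exI[of _ "[]"]) simp

setup_lifting type_definition_F2

text \<open>Left multiplication by one letter, for reduced \<open>w\<close>.\<close>

definition lmult :: "letter \<Rightarrow> letter list \<Rightarrow> letter list"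
  where "lmult x w = (case w of [] \<Rightarrow> [x] | y # v \<Rightarrow> if y = inv_letter x then v else x # w)"

lemma inv_letter_inv_letter [simp]: "inv_letter (inv_letter x) = x"
  by (simp add: inv_letter_def)

lemma reduced_ConsD: "reduced (x # w) \<Longrightarrow> reduced w"
  by (cases w) auto

lemma reduced_lmult: "reduced w \<Longrightarrow> reduced (lmult x w)"
  by (cases w) (auto simp: lmult_def dest: reduced_ConsD)

lemma reduced_foldr_lmult: "reduced w \<Longrightarrow> reduced (foldr lmult u w)"
  by (induction u) (auto intro: reduced_lmult)

lemma lmult_lmult_inv: 
  assumes "reduced w"
  shows "lmult x (lmult (inv_letter x) w) = w"
proof (cases w)
  case (Cons y v)
  with assms show ?thesis by (cases v) (auto simp: lmult_def)
qed (simp add: lmult_def)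

lemma foldr_lmult_lmult:
  "reduced u \<Longrightarrow> reduced w \<Longrightarrow> foldr lmult (lmult x u) w = lmult x (foldr lmult u w)"
proof (cases u)
  case (Cons y v)
  assume "reduced w"
  then have "lmult x (lmult (inv_letter x) (foldr lmult v w)) = foldr lmult v w"
    by (intro lmult_lmult_inv reduced_foldr_lmult)
  with Cons show ?thesis by (auto simp: lmult_def[of x "y # v"])
qed (simp add: lmult_def[of x "[]"])

lemma foldr_lmult_assoc:
  "reduced v \<Longrightarrow> reduced w \<Longrightarrow> foldr lmult (foldr lmult u v) w = foldr lmult u (foldr lmult v w)"
  by (induction u) (auto simp: foldr_lmult_lmult reduced_foldr_lmult)

lemma foldr_lmult_Nil: "reduced u \<Longrightarrow> foldr lmult u [] = u"
proof (induction u)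
  case (Cons x u)
  then show ?case by (cases u) (auto simp: lmult_def dest: reduced_ConsD)
qed simp

lemma foldr_lmult_inverse:
  "reduced w \<Longrightarrow> foldr lmult (rev (map inv_letter u)) (foldr lmult u w) = w"
proof (induction u arbitrary: w)
  case (Cons x u)
  have "lmult (inv_letter x) (lmult x (foldr lmult u w)) = foldr lmult u w"
    using lmult_lmult_inv[of _ "inv_letter x"] Cons.prems reduced_foldr_lmult by simp
  with Cons show ?case by simp
qed simp

lemma reduced_snoc:
  "reduced (w @ [x]) \<longleftrightarrow> reduced w \<and> (w \<noteq> [] \<longrightarrow> x \<noteq> inv_letter (last w))"
  by (induction w rule: reduced.induct) auto

lemma reduced_inverse: "reduced w \<Longrightarrow> reduced (rev (map inv_letter w))"
proof (induction w rule: reduced.induct)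
  case (1 x y w)
  from "1.prems" have "y \<noteq> inv_letter x" "reduced (y # w)" by auto
  moreover from this have "x \<noteq> inv_letter y" by auto
  moreover from calculation have "reduced (rev (map inv_letter (y # w)))" using "1.IH" by simp
  ultimately show ?case
    using reduced_snoc[of "rev (map inv_letter (y # w))" "inv_letter x"] by simp
qed auto

instantiation F2 :: monoid_mult
begin

lift_definition one_F2 :: F2 is "[]" by simp

lift_definition times_F2 :: "F2 \<Rightarrow> F2 \<Rightarrow> F2" is "\<lambda>u v. foldr lmult u v"
  by (simp add: reduced_foldr_lmult)

instance
  by standard (transfer; simp add: foldr_lmult_assoc foldr_lmult_Nil)+

end

instantiation F2 :: inverse
begin

lift_definition inverse_F2 :: "F2 \<Rightarrow> F2" is "\<lambda>w. rev (map inv_letter w)"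
  by (simp add: reduced_inverse)

definition divide_F2 :: "F2 \<Rightarrow> F2 \<Rightarrow> F2" where "divide_F2 x y = x * inverse y"

instance ..

end

lemma F2_left_inverse: "inverse x * x = (1::F2)"
proof transfer
  fix w assume "reduced w"
  then show "foldr lmult (rev (map inv_letter w)) w = []"
    using foldr_lmult_inverse[of "[]" w] foldr_lmult_Nil[of w] by simp
qed

lemma F2_right_inverse: "x * inverse x = (1::F2)"
proof -
  have "x * inverse x = inverse (inverse x) * inverse x * (x * inverse x)"
    by (simp add: F2_left_inverse)
  also have "\<dots> = inverse (inverse x) * (inverse x * x) * inverse x"
    by (simp only: mult.assoc)
  finally show ?thesis by (simp add: F2_left_inverse)
qed

lemma F2_right_cancel: "x * g = y * g \<longleftrightarrow> x = (y::F2)"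
  by (metis F2_right_inverse mult.assoc mult.right_neutral)

lift_definition gen_a :: F2 is "[(Gen_a, True)]" by simp
lift_definition gen_b :: F2 is "[(Gen_b, True)]" by simp

definition positive_words :: "F2 set"
  where "positive_words = {prod_list ws | ws. set ws \<subseteq> {gen_a, gen_b}}"

definition Y_set :: "F2 set"
  where "Y_set = {gen_a powi n * w | n w. w \<in> positive_words}"

class scaleC =
  fixes scaleC :: "complex \<Rightarrow> 'a \<Rightarrow> 'a"  (infixr \<open>*\<^sub>C\<close> 75)

class complex_normed_vector = real_normed_vector + scaleC +
  assumes scaleC_add_right: "c *\<^sub>C (x + y) = c *\<^sub>C x + c *\<^sub>C y"
    and scaleC_add_left: "(c + d) *\<^sub>C x = c *\<^sub>C x + d *\<^sub>C x"
    and scaleC_scaleC: "c *\<^sub>C d *\<^sub>C x = (c * d) *\<^sub>C x"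
    and scaleC_of_real: "complex_of_real r *\<^sub>C x = r *\<^sub>R x"
    and norm_scaleC: "norm (c *\<^sub>C x) = cmod c * norm x"

text \<open>As \<^class>\<open>real_normed_algebra_1\<close> demands \<open>\<parallel>1\<parallel> = 1\<close>, the zero algebra is excluded.\<close>

class unital_cstar_algebra = real_normed_algebra_1 + banach + complex_normed_vector +
  fixes star :: "'a \<Rightarrow> 'a"
  assumes mult_scaleC_left: "(c *\<^sub>C x) * y = c *\<^sub>C (x * y)"
    and mult_scaleC_right: "x * (c *\<^sub>C y) = c *\<^sub>C (x * y)"
    and star_star: "star (star x) = x"
    and star_add: "star (x + y) = star x + star y"
    and star_scaleC: "star (c *\<^sub>C x) = cnj c *\<^sub>C star x"
    and star_mult: "star (x * y) = star y * star x"
    and cstar_identity: "norm (star x * x) = (norm x)\<^sup>2"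

definition cstar_subalgebra :: "'a::unital_cstar_algebra set \<Rightarrow> bool"
  where "cstar_subalgebra A \<longleftrightarrow> 0 \<in> A \<and> (\<forall>x\<in>A. \<forall>y\<in>A. x + y \<in> A \<and> x * y \<in> A) \<and>
    (\<forall>x\<in>A. star x \<in> A \<and> (\<forall>c. c *\<^sub>C x \<in> A)) \<and> closed A"

definition cstar_generated :: "'a::unital_cstar_algebra set \<Rightarrow> 'a set"
  where "cstar_generated G = \<Inter>{A. cstar_subalgebra A \<and> G \<subseteq> A}"

definition closed_ideal :: "'a::unital_cstar_algebra set \<Rightarrow> 'a set \<Rightarrow> bool"
  where "closed_ideal J A \<longleftrightarrow> J \<subseteq> A \<and> 0 \<in> J \<and> (\<forall>x\<in>J. \<forall>y\<in>J. x + y \<in> J) \<and>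
    (\<forall>x\<in>J. \<forall>c. c *\<^sub>C x \<in> J) \<and> (\<forall>x\<in>J. \<forall>y\<in>A. x * y \<in> J \<and> y * x \<in> J) \<and> closed J"

definition ideal_generated :: "'a::unital_cstar_algebra set \<Rightarrow> 'a set \<Rightarrow> 'a set"
  where "ideal_generated A G = \<Inter>{J. closed_ideal J A \<and> G \<subseteq> J}"

definition star_hom ::
  "'a::unital_cstar_algebra set \<Rightarrow> 'b::unital_cstar_algebra set \<Rightarrow> ('a \<Rightarrow> 'b) \<Rightarrow> bool"
  where "star_hom A B f \<longleftrightarrow> (\<forall>x\<in>A. f x \<in> B) \<and>
    (\<forall>x\<in>A. \<forall>y\<in>A. f (x + y) = f x + f y \<and> f (x * y) = f x * f y) \<and>
    (\<forall>x\<in>A. f (star x) = star (f x) \<and> (\<forall>c. f (c *\<^sub>C x) = c *\<^sub>C f x))"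

definition star_iso ::
  "'a::unital_cstar_algebra set \<Rightarrow> 'b::unital_cstar_algebra set \<Rightarrow> ('a \<Rightarrow> 'b) \<Rightarrow> bool"
  where "star_iso A B f \<longleftrightarrow> star_hom A B f \<and> bij_betw f A B"

text \<open>The extension \<open>0 \<rightarrow> J \<rightarrow> E \<rightarrow> Q \<rightarrow> 0\<close> with quotient map \<open>q\<close>, where the map
  \<open>J \<rightarrow> E\<close> is the inclusion.\<close>

definition cstar_extension ::
  "'a::unital_cstar_algebra set \<Rightarrow> 'a set \<Rightarrow> 'b::unital_cstar_algebra set \<Rightarrow> ('a \<Rightarrow> 'b) \<Rightarrow> bool"
  where "cstar_extension J E Q q \<longleftrightarrow>
    cstar_subalgebra E \<and> cstar_subalgebra Q \<and> closed_ideal J E \<and>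
    star_hom E Q q \<and> q ` E = Q \<and> {x \<in> E. q x = 0} = J"

definition cuntz_isometries :: "nat \<Rightarrow> (nat \<Rightarrow> 'a::unital_cstar_algebra) \<Rightarrow> bool"
  where "cuntz_isometries n V \<longleftrightarrow>
    (\<forall>i\<in>{1..n}. star (V i) * V i = 1) \<and> (\<Sum>i=1..n. V i * star (V i)) = 1"

definition cuntz_algebra :: "nat \<Rightarrow> (nat \<Rightarrow> 'a::unital_cstar_algebra) \<Rightarrow> 'a set"
  where "cuntz_algebra n V = cstar_generated (V ` {1..n})"

text \<open>The next two are meant for \<open>V\<close> with \<open>cuntz_isometries 3 V\<close>, so that \<open>cuntz_E2 V\<close> is a
  subalgebra of \<open>cuntz_algebra 3 V\<close>.\<close>

definition cuntz_E2 :: "(nat \<Rightarrow> 'a::unital_cstar_algebra) \<Rightarrow> 'a set"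
  where "cuntz_E2 V = cstar_generated {V 1, V 2}"

definition cuntz_J2 :: "(nat \<Rightarrow> 'a::unital_cstar_algebra) \<Rightarrow> 'a set"
  where "cuntz_J2 V = ideal_generated (cuntz_E2 V) {1 - V 1 * star (V 1) - V 2 * star (V 2)}"

typedef 'i ell2 = "{f :: 'i \<Rightarrow> complex. (\<lambda>x. (cmod (f x))\<^sup>2) summable_on UNIV}"
  by (rule exI[of _ "\<lambda>_. 0"]) simp

setup_lifting type_definition_ell2

lemma ell2_summable_add:
  assumes "(\<lambda>x. (cmod (f x))\<^sup>2) summable_on A" "(\<lambda>x. (cmod (g x))\<^sup>2) summable_on A"
  shows "(\<lambda>x. (cmod (f x + g x))\<^sup>2) summable_on A"
proof (rule summable_on_comparison_test)
  show "(\<lambda>x. 2 * (cmod (f x))\<^sup>2 + 2 * (cmod (g x))\<^sup>2) summable_on A"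
    by (intro summable_on_add summable_on_cmult_right assms)
  show "(cmod (f x + g x))\<^sup>2 \<le> 2 * (cmod (f x))\<^sup>2 + 2 * (cmod (g x))\<^sup>2" for x
  proof -
    have "(cmod (f x + g x))\<^sup>2 \<le> (cmod (f x) + cmod (g x))\<^sup>2"
      by (intro power_mono norm_triangle_ineq) simp
    also have "\<dots> \<le> 2 * (cmod (f x))\<^sup>2 + 2 * (cmod (g x))\<^sup>2"
      using zero_le_power2[of "cmod (f x) - cmod (g x)"] by (simp add: power2_eq_square algebra_simps)
    finally show ?thesis .
  qed
qed simp

lemma ell2_summable_mult:
  assumes "(\<lambda>x. (cmod (f x))\<^sup>2) summable_on A" "(\<lambda>x. (cmod (g x))\<^sup>2) summable_on A"
  shows "(\<lambda>x. cnj (f x) * g x) summable_on A" "(\<lambda>x. inner (f x) (g x)) summable_on A"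
proof -
  have s: "(\<lambda>x. (cmod (f x))\<^sup>2 + (cmod (g x))\<^sup>2) summable_on A"
    by (intro summable_on_add assms)
  have *: "cmod (f x) * cmod (g x) \<le> (cmod (f x))\<^sup>2 + (cmod (g x))\<^sup>2" for x
    using sum_squares_bound[of "cmod (f x)" "cmod (g x)"]
      mult_nonneg_nonneg[OF norm_ge_zero[of "f x"] norm_ge_zero[of "g x"]] by linarith
  have "(\<lambda>x. norm (cnj (f x) * g x)) summable_on A"
    by (rule summable_on_comparison_test[OF s]) (use * in \<open>auto simp: norm_mult\<close>)
  then show "(\<lambda>x. cnj (f x) * g x) summable_on A" by (rule abs_summable_summable)
  have "(\<lambda>x. norm (inner (f x) (g x))) summable_on A"
    by (rule summable_on_comparison_test[OF s])
      (use * Cauchy_Schwarz_ineq2[of "f _" "g _"] in \<open>auto intro: order_trans\<close>)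
  then show "(\<lambda>x. inner (f x) (g x)) summable_on A" by (rule abs_summable_summable)
qed

instantiation ell2 :: (type) real_vector
begin

lift_definition zero_ell2 :: "'a ell2" is "\<lambda>_. 0" by simp
lift_definition plus_ell2 :: "'a ell2 \<Rightarrow> 'a ell2 \<Rightarrow> 'a ell2" is "\<lambda>f g x. f x + g x"
  by (rule ell2_summable_add)
lift_definition uminus_ell2 :: "'a ell2 \<Rightarrow> 'a ell2" is "\<lambda>f x. - f x" by simp
lift_definition minus_ell2 :: "'a ell2 \<Rightarrow> 'a ell2 \<Rightarrow> 'a ell2" is "\<lambda>f g x. f x - g x"
  using ell2_summable_add[of _ _ "\<lambda>x. - _ x"] by simp
lift_definition scaleR_ell2 :: "real \<Rightarrow> 'a ell2 \<Rightarrow> 'a ell2" is "\<lambda>r f x. r *\<^sub>R f x"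
  by (simp add: power_mult_distrib summable_on_cmult_right)

instance
  by standard (transfer; auto simp: algebra_simps)+

end

instantiation ell2 :: (type) real_inner
begin

lift_definition inner_ell2 :: "'a ell2 \<Rightarrow> 'a ell2 \<Rightarrow> real" is "\<lambda>f g. \<Sum>\<^sub>\<infinity>x. inner (f x) (g x)" .
lift_definition norm_ell2 :: "'a ell2 \<Rightarrow> real" is "\<lambda>f. sqrt (\<Sum>\<^sub>\<infinity>x. (cmod (f x))\<^sup>2)" .
definition dist_ell2 :: "'a ell2 \<Rightarrow> 'a ell2 \<Rightarrow> real" where "dist_ell2 f g = norm (f - g)"
definition sgn_ell2 :: "'a ell2 \<Rightarrow> 'a ell2" where "sgn_ell2 f = f /\<^sub>R norm f"
definition uniformity_ell2 :: "('a ell2 \<times> 'a ell2) filter"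
  where "uniformity_ell2 = (INF e\<in>{0<..}. principal {(f, g). dist f g < e})"
definition open_ell2 :: "'a ell2 set \<Rightarrow> bool"
  where "open_ell2 U = (\<forall>x\<in>U. eventually (\<lambda>(x', y). x' = x \<longrightarrow> y \<in> U) uniformity)"

instance
proof
  fix f g h :: "'a ell2" and r :: real
  show "inner f g = inner g f" by transfer (simp add: inner_commute)
  show "inner (f + g) h = inner f h + inner g h"
    by transfer (simp add: inner_add_left infsum_add ell2_summable_mult)
  show "inner (r *\<^sub>R f) g = r * inner f g"
    by transfer (simp add: infsum_cmult_right')
  show "0 \<le> inner f f" by transfer (simp add: infsum_nonneg)
  show "inner f f = 0 \<longleftrightarrow> f = 0"
  proof transfer
    fix f :: "'a \<Rightarrow> complex" assume f: "(\<lambda>x. (cmod (f x))\<^sup>2) summable_on UNIV"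
    have "f x = 0" if "(\<Sum>\<^sub>\<infinity>x. (cmod (f x))\<^sup>2) = 0" for x
      using nonneg_infsum_le_0D[OF _ f, of x] that by simp
    then have "(\<Sum>\<^sub>\<infinity>x. (cmod (f x))\<^sup>2) = 0 \<longleftrightarrow> f = (\<lambda>_. 0)"
      by (metis (mono_tags, lifting) ext infsum_0 norm_zero zero_eq_power2)
    then show "(\<Sum>\<^sub>\<infinity>x. inner (f x) (f x)) = 0 \<longleftrightarrow> f = (\<lambda>_. 0)"
      by (simp only: dot_square_norm)
  qed
  show "norm f = sqrt (inner f f)" by transfer (simp add: dot_square_norm)
qed (auto simp: dist_ell2_def sgn_ell2_def uniformity_ell2_def open_ell2_def)

end

instantiation ell2 :: (type) complex_normed_vector
begin

lift_definition scaleC_ell2 :: "complex \<Rightarrow> 'a ell2 \<Rightarrow> 'a ell2" is "\<lambda>c f x. c * f x"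
  by (simp add: norm_mult power_mult_distrib summable_on_cmult_right)

instance
  by standard (transfer; simp add: algebra_simps norm_mult power_mult_distrib infsum_cmult_right'
      real_sqrt_mult scaleR_conv_of_real)+

end

lift_definition cinner :: "'i ell2 \<Rightarrow> 'i ell2 \<Rightarrow> complex" is "\<lambda>f g. \<Sum>\<^sub>\<infinity>x. cnj (f x) * g x" .

text \<open>\<open>ket x\<close> is the basis vector \<open>\<delta>\<^sub>x\<close>.\<close>

lift_definition ket :: "'i \<Rightarrow> 'i ell2" is "\<lambda>x y. if y = x then 1 else 0"
proof -
  fix x :: 'i
  show "(\<lambda>y. (cmod (if y = x then 1 else 0))\<^sup>2) summable_on UNIV"
    by (subst summable_on_cong_neutral[where T = "{x}" and g = "\<lambda>_. 1"]) auto
qed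

lemma ell2_norm_power2: "(norm f)\<^sup>2 = (\<Sum>\<^sub>\<infinity>x. (cmod (Rep_ell2 f x))\<^sup>2)"
  by transfer (simp add: infsum_nonneg)

lemma ell2_summable: "(\<lambda>x. (cmod (Rep_ell2 f x))\<^sup>2) summable_on A"
  using Rep_ell2[of f] summable_on_subset_banach[of _ UNIV A] by auto

lemma ell2_sum_le: "finite A \<Longrightarrow> (\<Sum>x\<in>A. (cmod (Rep_ell2 f x))\<^sup>2) \<le> (norm f)\<^sup>2"
  unfolding ell2_norm_power2 by (rule finite_sum_le_infsum) (auto intro: ell2_summable)

lemma ell2_coord_le: "cmod (Rep_ell2 f x) \<le> norm f"
  by (rule power2_le_imp_le) (use ell2_sum_le[of "{x}" f] in simp_all)

lemma ell2_bounded_sums: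
  fixes g :: "'i \<Rightarrow> complex"
  assumes "\<And>A. finite A \<Longrightarrow> (\<Sum>x\<in>A. (cmod (g x))\<^sup>2) \<le> C\<^sup>2" "C \<ge> 0"
  shows "(\<lambda>x. (cmod (g x))\<^sup>2) summable_on UNIV" and "norm (Abs_ell2 g) \<le> C"
proof -
  show s: "(\<lambda>x. (cmod (g x))\<^sup>2) summable_on UNIV"
    using assms(1) by (intro nonneg_bdd_above_summable_on bdd_aboveI[of _ "C\<^sup>2"]) auto
  have "(norm (Abs_ell2 g))\<^sup>2 \<le> C\<^sup>2"
    unfolding ell2_norm_power2 using s assms(1)
    by (subst Abs_ell2_inverse) (auto intro!: infsum_le_finite_sums)
  then show "norm (Abs_ell2 g) \<le> C" using assms(2) by (rule power2_le_imp_le)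
qed

instance ell2 :: (type) banach
proof
  fix F :: "nat \<Rightarrow> 'a ell2" assume F: "Cauchy F"
  have "Cauchy (\<lambda>n. Rep_ell2 (F n) x)" for x
  proof (rule CauchyI)
    fix e :: real assume "e > 0"
    then obtain N where "\<forall>m\<ge>N. \<forall>n\<ge>N. norm (F m - F n) < e" using CauchyD[OF F] by blast
    moreover have "cmod (Rep_ell2 (F m) x - Rep_ell2 (F n) x) \<le> norm (F m - F n)" for m n
      using ell2_coord_le[of "F m - F n" x] by (simp add: minus_ell2.rep_eq)
    ultimately show "\<exists>M. \<forall>m\<ge>M. \<forall>n\<ge>M. norm (Rep_ell2 (F m) x - Rep_ell2 (F n) x) < e"
      by (meson le_less_trans)
  qed
  then have "\<forall>x. \<exists>l. (\<lambda>n. Rep_ell2 (F n) x) \<longlonglongrightarrow> l"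
    by (intro allI) (simp add: Cauchy_convergent convergent_def[symmetric])
  from choice[OF this] obtain g where g: "\<And>x. (\<lambda>n. Rep_ell2 (F n) x) \<longlonglongrightarrow> g x"
    by blast
  have key: "\<exists>N. \<forall>n\<ge>N. \<forall>A. finite A \<longrightarrow> (\<Sum>x\<in>A. (cmod (Rep_ell2 (F n) x - g x))\<^sup>2) \<le> e\<^sup>2"
    if e: "e > 0" for e
  proof -
    obtain N where N: "\<forall>m\<ge>N. \<forall>n\<ge>N. norm (F m - F n) < e"
      using CauchyD[OF F e] by blast
    have "(\<Sum>x\<in>A. (cmod (Rep_ell2 (F n) x - g x))\<^sup>2) \<le> e\<^sup>2" if "n \<ge> N" "finite A" for n A
    proof (rule LIMSEQ_le_const2)
      show "(\<lambda>m. \<Sum>x\<in>A. (cmod (Rep_ell2 (F n) x - Rep_ell2 (F m) x))\<^sup>2)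
          \<longlonglongrightarrow> (\<Sum>x\<in>A. (cmod (Rep_ell2 (F n) x - g x))\<^sup>2)"
        by (intro tendsto_intros g)
      have "(\<Sum>x\<in>A. (cmod (Rep_ell2 (F n) x - Rep_ell2 (F m) x))\<^sup>2) \<le> e\<^sup>2" if "m \<ge> N" for m
      proof -
        have "(\<Sum>x\<in>A. (cmod (Rep_ell2 (F n) x - Rep_ell2 (F m) x))\<^sup>2) \<le> (norm (F n - F m))\<^sup>2"
          using ell2_sum_le[OF \<open>finite A\<close>, of "F n - F m"] by (simp add: minus_ell2.rep_eq)
        also have "\<dots> \<le> e\<^sup>2"
          using N \<open>n \<ge> N\<close> \<open>m \<ge> N\<close> by (intro power_mono) (auto intro: less_imp_le)
        finally show ?thesis .
      qed
      then show "\<exists>N. \<forall>m\<ge>N. (\<Sum>x\<in>A. (cmod (Rep_ell2 (F n) x - Rep_ell2 (F m) x))\<^sup>2) \<le> e\<^sup>2"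
        by blast
    qed
    then show ?thesis by blast
  qed
  have dif: "(\<lambda>x. (cmod (g x))\<^sup>2) summable_on UNIV"
  proof -
    obtain N where N: "\<And>A. finite A \<Longrightarrow> (\<Sum>x\<in>A. (cmod (Rep_ell2 (F N) x - g x))\<^sup>2) \<le> 1\<^sup>2"
      using key[of 1] by auto
    have "(\<lambda>x. (cmod (Rep_ell2 (F N) x - g x))\<^sup>2) summable_on UNIV"
      by (rule ell2_bounded_sums(1)[of _ 1]) (use N in auto)
    then have "(\<lambda>x. (cmod (- (Rep_ell2 (F N) x - g x)))\<^sup>2) summable_on UNIV"
      by (simp add: norm_minus_commute)
    from ell2_summable_add[OF ell2_summable[of "F N"] this] show ?thesis by simp
  qed
  define G where "G = Abs_ell2 g"
  have G: "Rep_ell2 G = g" unfolding G_def using dif by (simp add: Abs_ell2_inverse)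
  have "F \<longlonglongrightarrow> G"
  proof (rule LIMSEQ_I)
    fix e :: real assume "e > 0"
    then obtain N where N: "\<And>n A. n \<ge> N \<Longrightarrow> finite A \<Longrightarrow>
        (\<Sum>x\<in>A. (cmod (Rep_ell2 (F n) x - g x))\<^sup>2) \<le> (e/2)\<^sup>2"
      using key[OF half_gt_zero[OF \<open>e > 0\<close>]] by blast
    have "norm (F n - G) < e" if "n \<ge> N" for n
    proof -
      have "F n - G = Abs_ell2 (\<lambda>x. Rep_ell2 (F n) x - g x)"
        using Rep_ell2_inverse[of "F n - G"] by (simp add: minus_ell2.rep_eq[abs_def] G)
      moreover have "norm (Abs_ell2 (\<lambda>x. Rep_ell2 (F n) x - g x)) \<le> e/2"
        using N[OF that] \<open>e > 0\<close> by (intro ell2_bounded_sums) auto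
      ultimately show ?thesis using \<open>e > 0\<close> by simp
    qed
    then show "\<exists>N. \<forall>n\<ge>N. norm (F n - G) < e" by blast
  qed
  then show "convergent F" by (auto simp: convergent_def)
qed

lemma cinner_eq: "cinner f g = Complex (inner f g) (inner (\<i> *\<^sub>C f) g)"
proof -
  have s: "(\<lambda>x. cnj (Rep_ell2 f x) * Rep_ell2 g x) summable_on UNIV"
    by (intro ell2_summable_mult ell2_summable)
  show ?thesis
    using infsumI[OF has_sum_bounded_linear[OF bounded_linear_Re has_sum_infsum[OF s]]]
      infsumI[OF has_sum_bounded_linear[OF bounded_linear_Im has_sum_infsum[OF s]]]
    by (intro complex_eqI)
      (simp_all add: cinner.rep_eq inner_ell2.rep_eq scaleC_ell2.rep_eq inner_complex_def o_def)
qed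

lemma inner_scaleC_left: "inner (c *\<^sub>C f) (g::'i ell2) = Re c * inner f g + Im c * inner (\<i> *\<^sub>C f) g"
proof -
  have "c *\<^sub>C f = Re c *\<^sub>R f + Im c *\<^sub>R (\<i> *\<^sub>C f)"
  proof -
    have "complex_of_real (Re c) + complex_of_real (Im c) * \<i> = c"
      by (simp add: complex_eq_iff)
    then have "c *\<^sub>C f = (complex_of_real (Re c) + complex_of_real (Im c) * \<i>) *\<^sub>C f"
      by (rule arg_cong[OF sym])
    also have "\<dots> = Re c *\<^sub>R f + Im c *\<^sub>R (\<i> *\<^sub>C f)"
      by (subst scaleC_add_left, subst scaleC_scaleC[symmetric], subst scaleC_of_real,
          subst scaleC_of_real) (rule refl)
    finally show ?thesis .
  qed
  from arg_cong[OF this, of "\<lambda>h. inner h g"] show ?thesis by (simp only: inner_add_left inner_scaleR_left)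
qed

lemma cinner_scaleC_left: "cinner (c *\<^sub>C f) g = cnj c * cinner f g"
  using inner_scaleC_left[of c f g] inner_scaleC_left[of "\<i> * c" f g]
  by (simp add: cinner_eq scaleC_scaleC complex_eq_iff)

lemma cinner_commute: "cinner f g = cnj (cinner g f)"
proof -
  have "inner (\<i> *\<^sub>C f) g = - inner (\<i> *\<^sub>C g) f"
    by (transfer) (simp add: inner_complex_def infsum_uminus[symmetric] algebra_simps)
  then show ?thesis by (simp add: cinner_eq complex_eq_iff inner_commute)
qed

lemma cinner_add_left: "cinner (f + g) h = cinner f h + cinner g h"
  by (simp add: cinner_eq complex_eq_iff inner_add_left scaleC_add_right)

lemma cinner_add_right: "cinner h (f + g) = cinner h f + cinner h g"
  by (simp add: cinner_eq complex_eq_iff inner_add_right)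

lemma cinner_scaleC_right: "cinner f (c *\<^sub>C g) = c * cinner f g"
  unfolding cinner_commute[of f] by (simp add: cinner_scaleC_left)

lemma cinner_self: "cinner f f = complex_of_real ((norm f)\<^sup>2)"
proof -
  have "Im (cinner f f) = - Im (cinner f f)"
    by (subst (1) cinner_commute) simp
  then show ?thesis by (simp add: cinner_eq complex_eq_iff power2_norm_eq_inner)
qed

lemma norm_cinner_le: "cmod (cinner f g) \<le> norm f * norm g"
proof -
  define z where "z = cinner f g"
  have "cinner (z *\<^sub>C f) g = complex_of_real ((cmod z)\<^sup>2)"
    by (simp only: cinner_scaleC_left z_def complex_norm_square mult.commute)
  then have "(cmod z)\<^sup>2 = inner (z *\<^sub>C f) g" by (simp add: cinner_eq complex_eq_iff)
  also have "\<dots> \<le> norm (z *\<^sub>C f) * norm g" by (rule norm_cauchy_schwarz)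
  finally have "cmod z * cmod z \<le> cmod z * (norm f * norm g)"
    by (simp add: norm_scaleC power2_eq_square mult.assoc)
  then have "z \<noteq> 0 \<Longrightarrow> cmod z \<le> norm f * norm g"
    using mult_le_cancel_left_pos[of "cmod z"] by simp
  then show ?thesis unfolding z_def[symmetric] by (cases "z = 0") simp_all
qed

lemma cinner_eqI:
  assumes "\<And>h. cinner h f = cinner h g" shows "f = g"
proof -
  have "inner h f = inner h g" for h using assms[of h] by (simp add: cinner_eq)
  then show ?thesis by (metis inner_commute vector_eq_rdot)
qed

lemma cinner_ket_left: "cinner (ket x) f = Rep_ell2 f x"
proof transfer
  fix x :: 'a and f :: "'a \<Rightarrow> complex"
  have "(\<Sum>\<^sub>\<infinity>y. cnj (if y = x then 1 else 0) * f y) = (\<Sum>\<^sub>\<infinity>y\<in>{x}. f y)"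
    by (rule infsum_cong_neutral) auto
  then show "(\<Sum>\<^sub>\<infinity>y. cnj (if y = x then 1 else 0) * f y) = f x" by simp
qed

lemma norm_ket [simp]: "norm (ket x) = 1"
proof -
  have "cinner (ket x) (ket x) = 1" by (simp add: cinner_ket_left ket.rep_eq)
  then have "(norm (ket x))\<^sup>2 = 1\<^sup>2"
    unfolding cinner_self by (simp only: of_real_eq_1_iff power_one)
  then show ?thesis by (rule power2_eq_imp_eq) simp_all
qed

lemma Rep_ell2_sum: "Rep_ell2 (sum F A) y = (\<Sum>x\<in>A. Rep_ell2 (F x) y)"
  by (induction A rule: infinite_finite_induct) (auto simp: zero_ell2.rep_eq plus_ell2.rep_eq)

lemma has_sum_ket: "((\<lambda>x. Rep_ell2 f x *\<^sub>C ket x) has_sum f) UNIV"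
proof -
  define P where "P A = (\<Sum>x\<in>A. Rep_ell2 f x *\<^sub>C ket x)" for A
  have Rep_P: "Rep_ell2 (P A) y = (if y \<in> A then Rep_ell2 f y else 0)" if "finite A" for A y
    using that by (simp add: P_def Rep_ell2_sum scaleC_ell2.rep_eq ket.rep_eq if_distrib cong: if_cong)
  have eq: "(norm (f - P A))\<^sup>2 = (norm f)\<^sup>2 - (\<Sum>x\<in>A. (cmod (Rep_ell2 f x))\<^sup>2)" if A: "finite A" for A
  proof -
    have "(norm f)\<^sup>2 = (\<Sum>\<^sub>\<infinity>x\<in>A \<union> - A. (cmod (Rep_ell2 f x))\<^sup>2)"
      by (simp add: ell2_norm_power2)
    also have "\<dots> = (\<Sum>\<^sub>\<infinity>x\<in>A. (cmod (Rep_ell2 f x))\<^sup>2) + (\<Sum>\<^sub>\<infinity>x\<in>-A. (cmod (Rep_ell2 f x))\<^sup>2)"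
      by (rule infsum_Un_disjoint) (auto intro: ell2_summable)
    also have "(\<Sum>\<^sub>\<infinity>x\<in>-A. (cmod (Rep_ell2 f x))\<^sup>2) = (norm (f - P A))\<^sup>2"
      unfolding ell2_norm_power2 
      by (rule infsum_cong_neutral) (auto simp: minus_ell2.rep_eq Rep_P[OF A])
    finally show ?thesis using A by simp
  qed
  have "((\<lambda>x. (cmod (Rep_ell2 f x))\<^sup>2) has_sum (norm f)\<^sup>2) UNIV"
    unfolding ell2_norm_power2 by (rule has_sum_infsum[OF ell2_summable])
  then have "((\<lambda>A. (norm f)\<^sup>2 - (\<Sum>x\<in>A. (cmod (Rep_ell2 f x))\<^sup>2)) \<longlongrightarrow> (norm f)\<^sup>2 - (norm f)\<^sup>2)
      (finite_subsets_at_top UNIV)"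
    unfolding has_sum_def by (intro tendsto_intros)
  then have "((\<lambda>A. (norm (f - P A))\<^sup>2) \<longlongrightarrow> 0) (finite_subsets_at_top UNIV)"
    unfolding diff_self
    by (rule Lim_transform_eventually)
      (auto intro!: eventually_finite_subsets_at_top_weakI simp: eq)
  then have "((\<lambda>A. sqrt ((norm (f - P A))\<^sup>2)) \<longlongrightarrow> sqrt 0) (finite_subsets_at_top UNIV)"
    by (rule tendsto_real_sqrt)
  then have "((\<lambda>A. norm (f - P A)) \<longlongrightarrow> 0) (finite_subsets_at_top UNIV)" by simp
  then have "(P \<longlongrightarrow> f) (finite_subsets_at_top UNIV)"
    by (simp add: tendsto_iff dist_norm norm_minus_commute)
  then show ?thesis by (simp add: has_sum_def P_def[abs_def])
qed

lemma scaleC_zero_right [simp]: "c *\<^sub>C 0 = (0::'a::complex_normed_vector)"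
  by (metis add_cancel_right_right scaleC_add_right)

lemma scaleC_minus_right: "c *\<^sub>C (- x) = - (c *\<^sub>C x::'a::complex_normed_vector)"
  by (metis add.right_inverse eq_neg_iff_add_eq_0 scaleC_add_right scaleC_zero_right add.commute)

lemma scaleC_diff_right: "c *\<^sub>C (x - y) = c *\<^sub>C x - (c *\<^sub>C y::'a::complex_normed_vector)"
  by (metis diff_conv_add_uminus scaleC_add_right scaleC_minus_right)

lemma scaleC_scaleR: "c *\<^sub>C r *\<^sub>R x = r *\<^sub>R c *\<^sub>C (x::'a::complex_normed_vector)"
  by (simp add: scaleC_of_real[symmetric] scaleC_scaleC mult.commute)

lemma bounded_linear_scaleC: "bounded_linear (\<lambda>x::'a::complex_normed_vector. c *\<^sub>C x)"
  by (rule bounded_linear_intro[where K = "cmod c"])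
    (auto simp: scaleC_add_right scaleC_scaleR norm_scaleC)

lifting_forget ell2.lifting

typedef 'i bop = "{T :: 'i ell2 \<Rightarrow>\<^sub>L 'i ell2. \<forall>c f. blinfun_apply T (c *\<^sub>C f) = c *\<^sub>C blinfun_apply T f}"
  by (rule exI[of _ 0]) simp

setup_lifting type_definition_bop

lift_definition bop_apply :: "'i bop \<Rightarrow> 'i ell2 \<Rightarrow> 'i ell2" is blinfun_apply .

instantiation bop :: (type) real_vector
begin

lift_definition zero_bop :: "'a bop" is 0 by simp
lift_definition plus_bop :: "'a bop \<Rightarrow> 'a bop \<Rightarrow> 'a bop" is "(+)"
  by (simp add: blinfun.add_left scaleC_add_right)
lift_definition uminus_bop :: "'a bop \<Rightarrow> 'a bop" is uminus
  by (simp add: blinfun.minus_left scaleC_minus_right)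
lift_definition minus_bop :: "'a bop \<Rightarrow> 'a bop \<Rightarrow> 'a bop" is "(-)"
  by (simp add: blinfun.diff_left scaleC_diff_right)
lift_definition scaleR_bop :: "real \<Rightarrow> 'a bop \<Rightarrow> 'a bop" is "(*\<^sub>R)"
  by (simp add: blinfun.scaleR_left scaleC_scaleR)

instance
  by standard (transfer; simp add: algebra_simps)+

end

instantiation bop :: (type) real_normed_algebra_1
begin

lift_definition one_bop :: "'a bop" is id_blinfun by simp
lift_definition times_bop :: "'a bop \<Rightarrow> 'a bop \<Rightarrow> 'a bop" is "(o\<^sub>L)" by simp
lift_definition norm_bop :: "'a bop \<Rightarrow> real" is norm .
definition dist_bop :: "'a bop \<Rightarrow> 'a bop \<Rightarrow> real" where "dist_bop S T = norm (S - T)"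
definition sgn_bop :: "'a bop \<Rightarrow> 'a bop" where "sgn_bop T = T /\<^sub>R norm T"
definition uniformity_bop :: "('a bop \<times> 'a bop) filter"
  where "uniformity_bop = (INF e\<in>{0<..}. principal {(S, T). dist S T < e})"
definition open_bop :: "'a bop set \<Rightarrow> bool"
  where "open_bop U = (\<forall>x\<in>U. eventually (\<lambda>(x', y). x' = x \<longrightarrow> y \<in> U) uniformity)"

instance
proof
  fix R S T :: "'a bop" and r :: real
  show "R * S * T = R * (S * T)" "(R + S) * T = R * T + S * T" "R * (S + T) = R * S + R * T"
    "r *\<^sub>R R * S = r *\<^sub>R (R * S)" "R * r *\<^sub>R S = r *\<^sub>R (R * S)" "1 * R = R" "R * 1 = R"
    by (transfer; auto intro!: blinfun_eqI simp: blinfun.bilinear_simps)+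
  have "norm (blinfun_apply id_blinfun (ket undefined :: 'a ell2))
      \<le> norm (id_blinfun :: 'a ell2 \<Rightarrow>\<^sub>L 'a ell2) * norm (ket undefined :: 'a ell2)"
    by (rule norm_blinfun)
  then have "norm (id_blinfun :: 'a ell2 \<Rightarrow>\<^sub>L 'a ell2) = 1"
    using norm_blinfun_id_le[where 'a = "'a ell2"] by simp
  then show "norm (1 :: 'a bop) = 1" by transfer
  then show "(0 :: 'a bop) \<noteq> 1" by (transfer, auto)
  show "norm (R * S) \<le> norm R * norm S" by transfer (rule norm_blinfun_compose)
  show "norm (R + S) \<le> norm R + norm S" by transfer (rule norm_triangle_ineq)
  show "norm R = 0 \<longleftrightarrow> R = 0" "norm (r *\<^sub>R R) = \<bar>r\<bar> * norm R" by (transfer; simp)+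
qed (auto simp: dist_bop_def sgn_bop_def uniformity_bop_def open_bop_def)

end

instance bop :: (type) banach
proof
  fix F :: "nat \<Rightarrow> 'a bop" assume F: "Cauchy F"
  have "Cauchy (\<lambda>n. Rep_bop (F n))"
    using F by (simp add: Cauchy_def dist_norm norm_bop.rep_eq minus_bop.rep_eq)
  then obtain L where L: "(\<lambda>n. Rep_bop (F n)) \<longlonglongrightarrow> L"
    by (auto dest!: Cauchy_convergent simp: convergent_def)
  have app: "(\<lambda>n. blinfun_apply (Rep_bop (F n)) f) \<longlonglongrightarrow> blinfun_apply L f" for f
    by (intro tendsto_intros L)
  have "blinfun_apply L (c *\<^sub>C f) = c *\<^sub>C blinfun_apply L f" for c f
  proof (rule LIMSEQ_unique[OF app])
    have "(\<lambda>n. c *\<^sub>C blinfun_apply (Rep_bop (F n)) f) \<longlonglongrightarrow> c *\<^sub>C blinfun_apply L f"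
      by (rule bounded_linear.tendsto[OF bounded_linear_scaleC app])
    then show "(\<lambda>n. blinfun_apply (Rep_bop (F n)) (c *\<^sub>C f)) \<longlonglongrightarrow> c *\<^sub>C blinfun_apply L f"
      using Rep_bop[of "F _"] by simp
  qed
  then have "Rep_bop (Abs_bop L) = L" by (simp add: Abs_bop_inverse)
  then have "F \<longlonglongrightarrow> Abs_bop L"
    using L by (simp add: LIMSEQ_def dist_norm norm_bop.rep_eq minus_bop.rep_eq)
  then show "convergent F" by (auto simp: convergent_def)
qed

lemma bounded_linear_bop: "bounded_linear (bop_apply T)"
  by transfer (rule blinfun.bounded_linear_right)

lemma norm_bop_apply: "norm (bop_apply T f) \<le> norm T * norm f"
  by transfer (rule norm_blinfun)

lemma norm_bop_bound: "0 \<le> b \<Longrightarrow> (\<And>f. norm (bop_apply T f) \<le> b * norm f) \<Longrightarrow> norm T \<le> b"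
  by transfer (rule norm_blinfun_bound)

lemma bop_eqI: "(\<And>f. bop_apply S f = bop_apply T f) \<Longrightarrow> S = T"
  by transfer (rule blinfun_eqI)

lemma bop_apply_add: "bop_apply T (f + g) = bop_apply T f + bop_apply T g"
  by transfer (rule blinfun.add_right)

lemma bop_apply_scaleC: "bop_apply T (c *\<^sub>C f) = c *\<^sub>C bop_apply T f"
  by transfer simp

lemma bop_apply_times: "bop_apply (S * T) f = bop_apply S (bop_apply T f)"
  by transfer simp

lemma bop_apply_plus: "bop_apply (S + T) f = bop_apply S f + bop_apply T f"
  by transfer (rule blinfun.add_left)

lemma bop_apply_scaleR_left: "bop_apply (r *\<^sub>R T) f = r *\<^sub>R bop_apply T f"
  by transfer (rule blinfun.scaleR_left)

lemma bop_apply_one: "bop_apply 1 f = f"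
  by transfer simp

lemma bop_exists:
  assumes "\<And>f g. t (f + g) = t f + t g" "\<And>c f. t (c *\<^sub>C f) = c *\<^sub>C t f"
    "\<And>f. norm (t f) \<le> norm f * K"
  shows "\<exists>T. bop_apply T = t"
proof -
  have "bounded_linear t"
    using assms(2)[of "complex_of_real _"] assms(1,3)
    by (intro bounded_linear_intro[where K = K]) (simp_all add: scaleC_of_real)
  then have "blinfun_apply (Blinfun t) = t" by (rule bounded_linear_Blinfun_apply)
  then have "bop_apply (Abs_bop (Blinfun t)) = t"
    using assms(2) by (simp add: bop_apply.rep_eq Abs_bop_inverse)
  then show ?thesis by blast
qed

lemma bop_adjoint_exists: "\<exists>S. \<forall>f g. cinner (bop_apply S f) g = cinner f (bop_apply T g)"
proof -
  define s where "s g x = cinner (bop_apply T (ket x)) g" for g x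
  have bound: "(\<Sum>x\<in>A. (cmod (s g x))\<^sup>2) \<le> (norm T * norm g)\<^sup>2" if "finite A" for g A
  proof -
    define h where "h = (\<Sum>x\<in>A. s g x *\<^sub>C ket x)"
    define N where "N = (\<Sum>x\<in>A. (cmod (s g x))\<^sup>2)"
    have Rep_h: "Rep_ell2 h x = (if x \<in> A then s g x else 0)" for x
      using that by (simp add: h_def Rep_ell2_sum scaleC_ell2.rep_eq ket.rep_eq if_distrib cong: if_cong)
    have "(norm h)\<^sup>2 = (\<Sum>\<^sub>\<infinity>x\<in>A. (cmod (s g x))\<^sup>2)"
      unfolding ell2_norm_power2 by (rule infsum_cong_neutral) (auto simp: Rep_h)
    then have nh: "(norm h)\<^sup>2 = N" using that by (simp add: N_def)
    have "cinner (bop_apply T h) g = complex_of_real N"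
    proof -
      have "cinner (bop_apply T (\<Sum>x\<in>B. s g x *\<^sub>C ket x)) g = (\<Sum>x\<in>B. cnj (s g x) * s g x)"
        if "finite B" for B
        using that
      proof induction
        case empty
        have "bop_apply T 0 = 0" by (rule linear_0) (rule bounded_linear.linear[OF bounded_linear_bop])
        then show ?case by (simp add: cinner_eq complex_eq_iff)
      next
        case (insert x B)
        then show ?case
          by (simp add: bop_apply_add bop_apply_scaleC cinner_add_left cinner_scaleC_left s_def)
      qed
      then show ?thesis
        using that by (simp add: h_def N_def complex_norm_square mult.commute del: of_real_power)
    qed
    moreover have "N \<ge> 0" by (simp add: N_def sum_nonneg)
    ultimately have "N \<le> norm (bop_apply T h) * norm g"
      using norm_cinner_le[of "bop_apply T h" g] by simp
    also have "\<dots> \<le> norm T * norm h * norm g"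
      by (intro mult_right_mono norm_bop_apply) simp
    finally have "norm h * norm h \<le> norm h * (norm T * norm g)"
      using nh by (simp add: power2_eq_square mult_ac)
    then have "h \<noteq> 0 \<Longrightarrow> norm h \<le> norm T * norm g"
      using mult_le_cancel_left_pos[of "norm h"] by simp
    then have "norm h \<le> norm T * norm g" by (cases "h = 0") simp_all
    then show ?thesis using nh power_mono[of "norm h" _ 2] by (simp add: N_def)
  qed
  define S where "S g = Abs_ell2 (s g)" for g
  have Rep_S: "Rep_ell2 (S g) = s g" for g
    unfolding S_def using ell2_bounded_sums(1)[OF bound] by (simp add: Abs_ell2_inverse)
  have "\<exists>R. bop_apply R = S"
  proof (rule bop_exists)
    show "norm (S g) \<le> norm g * norm T" for g
      unfolding S_def using ell2_bounded_sums(2)[OF bound] by (simp add: mult.commute)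
    show "S (f + g) = S f + S g" for f g
      by (metis (no_types, lifting) Rep_ell2_inject Rep_S plus_ell2.rep_eq cinner_add_right s_def ext)
    show "S (c *\<^sub>C f) = c *\<^sub>C S f" for c f
      by (metis (no_types, lifting) Rep_ell2_inject Rep_S scaleC_ell2.rep_eq cinner_scaleC_right s_def ext)
  qed
  then obtain R where R: "bop_apply R = S" by blast
  have adj: "cinner (bop_apply T g) f = cinner g (S f)" for f g
  proof -
    have "bounded_linear (\<lambda>k. cinner k f)"
      using scaleC_of_real norm_cinner_le[of _ f] cinner_scaleC_left[of "complex_of_real _" _ f]
      by (intro bounded_linear_intro[where K = "norm f"])
        (simp_all add: cinner_add_left scaleC_of_real scaleR_conv_of_real)
    from bounded_linear_compose[OF this bounded_linear_bop[of T]]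
    have "((\<lambda>x. cinner (bop_apply T (Rep_ell2 g x *\<^sub>C ket x)) f) has_sum cinner (bop_apply T g) f) UNIV"
      by (rule has_sum_bounded_linear[OF _ has_sum_ket, unfolded o_def])
    then have "((\<lambda>x. cnj (Rep_ell2 g x) * Rep_ell2 (S f) x) has_sum cinner (bop_apply T g) f) UNIV"
      by (simp add: bop_apply_scaleC cinner_scaleC_left Rep_S s_def)
    from infsumI[OF this] show ?thesis by (simp add: cinner.rep_eq)
  qed
  show ?thesis using adj by (metis R cinner_commute)
qed

instantiation bop :: (type) unital_cstar_algebra
begin

lift_definition scaleC_bop :: "complex \<Rightarrow> 'a bop \<Rightarrow> 'a bop"
  is "\<lambda>c T. Blinfun (\<lambda>f. c *\<^sub>C blinfun_apply T f)"
  by (simp add: bounded_linear_Blinfun_apply scaleC_scaleC mult.commute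
      bounded_linear_compose[OF bounded_linear_scaleC blinfun.bounded_linear_right])

definition star_bop :: "'a bop \<Rightarrow> 'a bop"
  where "star_bop T = (THE S. \<forall>f g. cinner (bop_apply S f) g = cinner f (bop_apply T g))"

lemma bop_apply_scaleC_left: "bop_apply (c *\<^sub>C T) f = c *\<^sub>C bop_apply T f"
  by transfer (simp add: bounded_linear_Blinfun_apply
      bounded_linear_compose[OF bounded_linear_scaleC blinfun.bounded_linear_right])

lemma star_bop_unique:
  assumes "\<And>f g. cinner (bop_apply S f) g = cinner f (bop_apply T g)"
  shows "star T = S"
  unfolding star_bop_def
proof (rule the_equality)
  fix R assume R: "\<forall>f g. cinner (bop_apply R f) g = cinner f (bop_apply T g)"
  show "R = S"
    using R assms by (intro bop_eqI cinner_eqI) (metis cinner_commute)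
qed (use assms in blast)

lemma cinner_star: "cinner (bop_apply (star T) f) g = cinner f (bop_apply T g)"
  using bop_adjoint_exists[of T] star_bop_unique[of _ T] by metis

lemma cinner_star': "cinner (bop_apply T f) g = cinner f (bop_apply (star T) g)"
  by (metis cinner_commute cinner_star)

instance
proof
  fix S T :: "'a bop" and c d :: complex and r :: real
  show "c *\<^sub>C (S + T) = c *\<^sub>C S + c *\<^sub>C T" "(c + d) *\<^sub>C T = c *\<^sub>C T + d *\<^sub>C T"
    "c *\<^sub>C d *\<^sub>C T = (c * d) *\<^sub>C T" "(c *\<^sub>C S) * T = c *\<^sub>C (S * T)" "S * (c *\<^sub>C T) = c *\<^sub>C (S * T)"
    by (auto intro!: bop_eqI simp: bop_apply_scaleC_left bop_apply_plus bop_apply_times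
        scaleC_add_right scaleC_add_left scaleC_scaleC bop_apply_scaleC)
  show "complex_of_real r *\<^sub>C T = r *\<^sub>R T"
    by (rule bop_eqI) (simp add: bop_apply_scaleC_left scaleC_of_real bop_apply_scaleR_left)
  have le: "norm (c *\<^sub>C T) \<le> cmod c * norm T" for c and T :: "'a bop"
    by (rule norm_bop_bound)
      (simp_all add: bop_apply_scaleC_left norm_scaleC mult.assoc mult_left_mono norm_bop_apply)
  show "norm (c *\<^sub>C T) = cmod c * norm T"
  proof (cases "c = 0")
    case True
    then show ?thesis using le[of 0 T] by simp
  next
    case False
    have "T = inverse c *\<^sub>C c *\<^sub>C T"
      using False
      by (intro bop_eqI) (simp add: bop_apply_scaleC_left scaleC_scaleC scaleC_of_real[of 1, simplified])
    then have "norm T \<le> norm (c *\<^sub>C T) / cmod c"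
      using le[of "inverse c" "c *\<^sub>C T"] by (simp add: norm_divide divide_inverse norm_inverse mult.commute)
    then show ?thesis using le[of c T] False by (simp add: field_simps)
  qed
  show ss: "star (star T) = T" for T :: "'a bop"
    by (rule star_bop_unique) (simp add: cinner_star')
  show "star (S + T) = star S + star T"
    by (rule star_bop_unique) (simp add: bop_apply_plus cinner_add_left cinner_add_right cinner_star)
  show "star (c *\<^sub>C T) = cnj c *\<^sub>C star T"
    by (rule star_bop_unique)
      (simp add: bop_apply_scaleC_left cinner_scaleC_left cinner_scaleC_right cinner_star)
  show "star (S * T) = star T * star S"
    by (rule star_bop_unique) (simp add: bop_apply_times cinner_star)
  have sq: "(norm T)\<^sup>2 \<le> norm (star T * T)" for T :: "'a bop"
  proof -
    have "norm T \<le> sqrt (norm (star T * T))"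
    proof (rule norm_bop_bound)
      fix f
      have "complex_of_real ((norm (bop_apply T f))\<^sup>2) = cinner (bop_apply (star T * T) f) f"
        by (simp only: cinner_self[symmetric] bop_apply_times cinner_star)
      then have "(norm (bop_apply T f))\<^sup>2 = cmod (cinner (bop_apply (star T * T) f) f)"
        by (metis abs_of_nonneg norm_of_real zero_le_power2)
      also have "\<dots> \<le> norm (bop_apply (star T * T) f) * norm f" by (rule norm_cinner_le)
      also have "\<dots> \<le> (norm (star T * T) * norm f) * norm f"
        by (intro mult_right_mono norm_bop_apply) simp
      also have "\<dots> = (sqrt (norm (star T * T)) * norm f)\<^sup>2"
        by (simp add: power_mult_distrib) (simp add: power2_eq_square)
      finally show "norm (bop_apply T f) \<le> sqrt (norm (star T * T)) * norm f"
        by (rule power2_le_imp_le) simp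
    qed simp
    then have "(norm T)\<^sup>2 \<le> (sqrt (norm (star T * T)))\<^sup>2" by (intro power_mono) simp_all
    then show ?thesis by simp
  qed
  have star_le: "norm T \<le> norm (star T)" for T :: "'a bop"
  proof -
    have "norm T * norm T \<le> norm (star T) * norm T"
      using sq[of T] norm_mult_ineq[of "star T" T] by (simp add: power2_eq_square)
    then have "T \<noteq> 0 \<Longrightarrow> norm T \<le> norm (star T)"
      using mult_le_cancel_right_pos[of "norm T"] by simp
    then show ?thesis by (cases "T = 0") simp_all
  qed
  have "norm (star T) = norm T" using star_le[of T] star_le[of "star T"] ss[of T] by simp
  then show "norm (star T * T) = (norm T)\<^sup>2"
    using sq[of T] norm_mult_ineq[of "star T" T] by (simp add: power2_eq_square)
qed

end

definition compact_operators :: "'i bop set"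
  where "compact_operators = {T. compact (closure (bop_apply T ` ball 0 1))}"

text \<open>A subset \<open>Z\<close> of \<^typ>\<open>F2\<close> is presented as a type together with its inclusion into \<^typ>\<open>F2\<close>,
  so that \<open>\<ell>\<^sup>2(Z)\<close> and \<open>B(\<ell>\<^sup>2(Z))\<close> are the types \<open>Z ell2\<close> and \<open>Z bop\<close>.\<close>

class F2_subset =
  fixes incl :: "'a \<Rightarrow> F2"
  assumes incl_inject: "incl x = incl y \<longleftrightarrow> x = y"

text \<open>The coordinate at \<open>y\<close> of the image of \<open>f\<close> under \<open>\<delta>\<^sub>z \<mapsto> \<delta>\<^bsub>zg\<^esub>\<close> (and \<open>\<delta>\<^sub>z \<mapsto> 0\<close> if
  \<open>zg \<notin> Z\<close>) is the coordinate of \<open>f\<close> at the unique \<open>z \<in> Z\<close> with \<open>zg = y\<close>, or \<open>0\<close> if there is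
  none; see \<open>partial_translation_ket\<close> and \<open>partial_translation_ket_0\<close> below.\<close>

definition partial_translation_fun :: "F2 \<Rightarrow> 'z::F2_subset ell2 \<Rightarrow> 'z ell2"
  where "partial_translation_fun g f = Abs_ell2 (\<lambda>y.
    if \<exists>z::'z. incl z * g = incl y then Rep_ell2 f (THE z::'z. incl z * g = incl y) else 0)"

lemma incl_the: "incl z * g = incl y \<Longrightarrow> (THE z::'z. incl z * g = incl y) = (z::'z::F2_subset)"
proof (rule the_equality)
  fix x :: 'z
  assume "incl z * g = incl y" "incl x * g = incl y"
  then have "incl x * g = incl z * g" by (rule trans[OF _ sym, rotated])
  then show "x = z" by (simp add: F2_right_cancel incl_inject)
qed

lemma partial_translation_fun_aux:
  fixes f :: "'z::F2_subset ell2"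
  shows "(\<lambda>y::'z. (cmod (if \<exists>z::'z. incl z * g = incl y then Rep_ell2 f (THE z::'z. incl z * g = incl y)
      else 0))\<^sup>2) summable_on UNIV" (is "?S")
    and "norm (partial_translation_fun g f) \<le> norm f" (is "?N")
proof -
  define h :: "'z \<Rightarrow> 'z" where "h y = (THE z::'z. incl z * g = incl y)" for y
  define R where "R = {y::'z. \<exists>z::'z. incl z * g = incl y}"
  have h: "incl (h y) * g = incl y" if y: "y \<in> R" for y
  proof -
    from y obtain z :: 'z where z: "incl z * g = incl y" by (auto simp: R_def)
    with incl_the[OF z] show ?thesis by (simp add: h_def)
  qed
  have inj: "inj_on h R"
  proof (rule inj_onI)
    fix x y assume "x \<in> R" "y \<in> R" "h x = h y"
    with h[of x] h[of y] have "incl x = incl y" by simp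
    then show "x = y" by (simp add: incl_inject)
  qed
  have bound: "(\<Sum>y\<in>A. (cmod (if \<exists>z::'z. incl z * g = incl y then Rep_ell2 f (THE z::'z. incl z * g = incl y)
      else 0))\<^sup>2) \<le> (norm f)\<^sup>2" if A: "finite A" for A :: "'z set"
  proof -
    have "(\<Sum>y\<in>A. (cmod (if \<exists>z::'z. incl z * g = incl y then Rep_ell2 f (THE z::'z. incl z * g = incl y)
        else 0))\<^sup>2) = (\<Sum>y\<in>A \<inter> R. (cmod (Rep_ell2 f (h y)))\<^sup>2)"
      using A by (intro sum.mono_neutral_cong_right) (auto simp: R_def h_def)
    also have "\<dots> = (\<Sum>z\<in>h ` (A \<inter> R). (cmod (Rep_ell2 f z))\<^sup>2)"
      by (subst sum.reindex) (auto intro: inj_on_subset[OF inj])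
    also have "\<dots> \<le> (norm f)\<^sup>2" using A by (intro ell2_sum_le) simp
    finally show ?thesis .
  qed
  show ?S by (rule ell2_bounded_sums(1)[OF bound]) simp_all
  show ?N unfolding partial_translation_fun_def by (rule ell2_bounded_sums(2)[OF bound]) simp_all
qed

lemma Rep_partial_translation_fun:
  "Rep_ell2 (partial_translation_fun g f) (y::'z::F2_subset) =
    (if \<exists>z::'z. incl z * g = incl y then Rep_ell2 f (THE z::'z. incl z * g = incl y) else 0)"
  unfolding partial_translation_fun_def
  by (subst Abs_ell2_inverse, rule CollectI, rule partial_translation_fun_aux(1), rule refl)

definition partial_translation :: "F2 \<Rightarrow> 'z::F2_subset bop"
  where "partial_translation g = Abs_bop (Blinfun (partial_translation_fun g))"

lemma bop_apply_partial_translation: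
  "bop_apply (partial_translation g :: 'z::F2_subset bop) = partial_translation_fun g"
proof -
  have if_add: "(if P then a + b else 0) = (if P then a else 0) + (if P then b else (0::complex))" for P a b
    by simp
  have if_mult: "(if P then c * a else 0) = c * (if P then a else (0::complex))" for P a c
    by simp
  have add: "partial_translation_fun g (x + y) = partial_translation_fun g x + partial_translation_fun g y"
    for x y :: "'z ell2"
    by (rule Rep_ell2_inject[THEN iffD1], rule ext)
      (simp only: Rep_partial_translation_fun plus_ell2.rep_eq if_add)
  have scale: "partial_translation_fun g (c *\<^sub>C x) = c *\<^sub>C partial_translation_fun g x"
    for c and x :: "'z ell2"
    by (rule Rep_ell2_inject[THEN iffD1], rule ext)
      (simp only: Rep_partial_translation_fun scaleC_ell2.rep_eq if_mult)
  have "bounded_linear (partial_translation_fun g :: 'z ell2 \<Rightarrow> 'z ell2)"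
    using scale[of "complex_of_real _"] partial_translation_fun_aux(2)[of g]
    by (intro bounded_linear_intro[where K = 1]) (simp_all add: scaleC_of_real add)
  then show ?thesis
    by (simp add: partial_translation_def bop_apply.rep_eq Abs_bop_inverse bounded_linear_Blinfun_apply
        scale)
qed

lemma partial_translation_ket:
  assumes "incl z * g = incl z'"
  shows "bop_apply (partial_translation g) (ket z) = ket (z'::'z::F2_subset)"
  unfolding bop_apply_partial_translation
proof (rule Rep_ell2_inject[THEN iffD1], rule ext)
  fix y :: 'z
  show "Rep_ell2 (partial_translation_fun g (ket z)) y = Rep_ell2 (ket z') y"
  proof (cases "\<exists>x::'z. incl x * g = incl y")
    case True
    then obtain x :: 'z where x: "incl x * g = incl y" by blast
    have "x = z \<longleftrightarrow> y = z'"
      using x assms by (metis F2_right_cancel incl_inject)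
    then show ?thesis
      unfolding Rep_partial_translation_fun incl_the[OF x] ket.rep_eq using x by auto
  next
    case False
    with assms have "y \<noteq> z'" by blast
    with False show ?thesis by (simp add: Rep_partial_translation_fun ket.rep_eq)
  qed
qed

lemma partial_translation_ket_0:
  assumes "\<And>z'::'z. incl z * g \<noteq> incl z'"
  shows "bop_apply (partial_translation g) (ket (z::'z::F2_subset)) = 0"
  unfolding bop_apply_partial_translation
proof (rule Rep_ell2_inject[THEN iffD1], rule ext)
  fix y :: 'z
  show "Rep_ell2 (partial_translation_fun g (ket z)) y = Rep_ell2 0 y"
  proof (cases "\<exists>x::'z. incl x * g = incl y")
    case True
    then obtain x :: 'z where x: "incl x * g = incl y" by blast
    with assms[of y] have "x \<noteq> z" by blast
    then show ?thesis
      unfolding Rep_partial_translation_fun incl_the[OF x] ket.rep_eq zero_ell2.rep_eq by auto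
  next
    case False
    then show ?thesis by (simp add: Rep_partial_translation_fun zero_ell2.rep_eq)
  qed
qed

definition partial_translation_algebra :: "'z::F2_subset bop set"
  where "partial_translation_algebra = cstar_generated (range partial_translation)"

lemma one_in_positive_words: "1 \<in> positive_words"
  unfolding positive_words_def by (auto intro!: exI[of _ "[]"])

typedef X = positive_words
  using one_in_positive_words by blast

typedef Y = Y_set
  unfolding Y_set_def using one_in_positive_words by blast

instantiation X :: F2_subset
begin
definition "incl_X = Rep_X"
instance by standard (simp add: incl_X_def Rep_X_inject)
end

instantiation Y :: F2_subset
begin
definition "incl_Y = Rep_Y"
instance by standard (simp add: incl_Y_def Rep_Y_inject)
end

end

theory Submission
  imports Defs "HOL-Library.Sublist" "HOL-Real_Asymp.Real_Asymp"
begin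

text \<open>For two isometries with orthogonal ranges, the norms of *-polynomials are compared directly,
  without spectral theory. If \<open>p\<close> has level \<open>N\<close>, compressions by projections and by a suitable partial
  isometry show that each homogeneous part satisfies \<open>\<parallel>p\<^sub>d\<parallel> \<le> (2N + 1) \<parallel>p\<parallel>\<close>. The degree-zero
  polynomials of level \<open>N\<close> form a finite-dimensional algebra, whose norms in two representations are
  equivalent. As \<open>\<parallel>x\<parallel>\<^sup>2 = \<parallel>x\<^sup>* x\<parallel>\<close>, a constant that grows only polynomially in the level can be
  removed by passing to the powers \<open>(p\<^sup>* p)\<close> to the \<open>2\<^sup>k\<close> and taking roots; so all norms agree as soon as
  the defect projection \<open>1 - V\<^sub>1V\<^sub>1\<^sup>* - V\<^sub>2V\<^sub>2\<^sup>*\<close> is nonzero in both representations or zero in both.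
  The same argument for the seminorm \<open>inf\<^sub>M \<parallel>x R\<^sub>M\<parallel>\<close>, with \<open>R\<^sub>M\<close> the projection onto words of
  length at least \<open>M\<close>, identifies the kernel of the map onto the Cuntz algebra. Finally, \<open>X\<close> and \<open>Y\<close> are
  subtrees of the Cayley graph, so the partial translations by \<open>a\<close> and \<open>b\<close> generate.\<close>

section \<open>C*-algebra preliminaries\<close>

text \<open>The obstacle is the growth of constants. \<open>star_hom\<close> contains no continuity,
  so maps are built by extending contractions from polynomials, and a bound with a large constant is
  of no use for that. Squaring doubles the level, so taking roots removes a constant that is
  polynomial in the level, but not the one obtained by comparing finite-dimensional norms, which
  grows exponentially. This is why degree zero is treated apart: there products do not raise the
  level, and one constant serves for all powers, whatever its size. Only the passage from degree
  zero to all degrees has to be quantitative. The condition on the defects also comes from degree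
  zero. Level N is built from matrix blocks of size 2^k, k < N, carried by the words of length k,
  and one block of size 2^N carried by the tail; the former are visible exactly when the defect is
  nonzero. In X the identity is the only point without a predecessor, so the defect is a projection
  of rank one; in Y even a^n has the predecessor a^(n-1), so the defect vanishes.\<close>

lemma star_zero [simp]: "star (0::'a::unital_cstar_algebra) = 0"
  using star_add[of "0::'a" 0] by simp

lemma star_one [simp]: "star (1::'a::unital_cstar_algebra) = 1"
  by (metis mult.right_neutral star_mult star_star)

lemma star_uminus: "star (- x) = - star (x::'a::unital_cstar_algebra)"
  using star_add[of x "- x"] by (simp add: eq_neg_iff_add_eq_0 add.commute)

lemma star_diff: "star (x - y) = star x - star (y::'a::unital_cstar_algebra)"
  using star_add[of x "- y"] by (simp add: star_uminus)

lemma norm_star [simp]: "norm (star x) = norm (x::'a::unital_cstar_algebra)"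
proof -
  have le: "norm y \<le> norm (star y)" for y :: 'a
  proof (cases "y = 0")
    case False
    have "norm y * norm y \<le> norm (star y) * norm y"
      using norm_mult_ineq[of "star y" y] cstar_identity[of y] by (simp add: power2_eq_square)
    then show ?thesis using False by simp
  qed simp
  show ?thesis using le[of x] le[of "star x"] by (simp add: star_star)
qed

lemma tendsto_star: "(f \<longlongrightarrow> l) F \<Longrightarrow> ((\<lambda>n. star (f n)) \<longlongrightarrow> star (l::'a::unital_cstar_algebra)) F"
  unfolding tendsto_iff dist_norm star_diff[symmetric] norm_star .

lemma tendsto_scaleC: "(f \<longlongrightarrow> l) F \<Longrightarrow> ((\<lambda>n. c *\<^sub>C f n) \<longlongrightarrow> c *\<^sub>C (l::'a::unital_cstar_algebra)) F"
  by (rule bounded_linear.tendsto[OF bounded_linear_scaleC])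

lemma isometry_norm_le_1:
  assumes "norm (star x * x) \<le> 1" shows "norm (x::'a::unital_cstar_algebra) \<le> 1"
  using assms unfolding cstar_identity by (simp add: power2_eq_square abs_square_le_1[unfolded power2_eq_square])

lemma projection_norm_le_1:
  assumes "star p = p" "p * p = p" shows "norm (p::'a::unital_cstar_algebra) \<le> 1"
proof -
  have "norm p * norm p = norm p * 1"
    using cstar_identity[of p] assms by (simp add: power2_eq_square)
  then show ?thesis by (cases "norm p = 0") auto
qed

lemma scaleC_one_left [simp]: "1 *\<^sub>C (x::'a::unital_cstar_algebra) = x"
  using scaleC_of_real[of 1 x] by simp

lemma scaleC_zero_left [simp]: "0 *\<^sub>C (x::'a::unital_cstar_algebra) = 0"
  using scaleC_of_real[of 0 x] by simp

lemma scaleC_minus_one: "(- 1) *\<^sub>C (x::'a::unital_cstar_algebra) = - x"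
  using scaleC_of_real[of "-1" x] by simp

lemma norm_mult_le_norm:
  assumes "norm s \<le> 1" "norm t \<le> 1" shows "norm (s * x * t) \<le> norm (x::'a::unital_cstar_algebra)"
proof -
  have "norm (s * x * t) \<le> norm s * norm x * norm t"
    by (meson mult_right_mono norm_ge_zero norm_mult_ineq order_trans)
  also have "\<dots> \<le> 1 * norm x * 1" using assms by (intro mult_mono) auto
  finally show ?thesis by simp
qed

text \<open>A bound with a polynomially growing constant improves to a bound with constant \<open>1\<close>: apply it to
  \<open>x\<close>, \<open>x\<^sup>* x\<close>, \<open>(x\<^sup>* x)\<^sup>* (x\<^sup>* x)\<close>, \<open>\<dots>\<close> and take roots.\<close>

lemma cstar_power_trick:
  fixes \<rho> :: "'b::unital_cstar_algebra \<Rightarrow> real" and rel :: "nat \<Rightarrow> 'a::unital_cstar_algebra \<Rightarrow> 'b \<Rightarrow> bool"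
  assumes nonneg: "\<And>y. 0 \<le> \<rho> y"
    and sq: "\<And>y. (\<rho> y)\<^sup>2 \<le> \<rho> (star y * y)"
    and closed: "\<And>N x y. rel N x y \<Longrightarrow> rel (2 * N) (star x * x) (star y * y)"
    and bound: "\<And>N x y. rel N x y \<Longrightarrow> \<rho> y \<le> C * (real N + 1)\<^sup>2 * norm x"
    and rel: "rel N x y"
  shows "\<rho> y \<le> norm x"
proof (rule ccontr)
  assume "\<not> ?thesis"
  then have less: "norm x < \<rho> y" by simp
  have x: "norm x > 0"
  proof (rule ccontr)
    assume "\<not> norm x > 0"
    then have "norm x = 0" by simp
    with bound[OF rel] less show False by simp
  qed
  \<comment> \<open>A ratio above 1 would make \<open>t ^ (2 ^ k)\<close> outgrow every quadratic in
    \<open>2 ^ k\<close>, whereas \<open>bound\<close> at level \<open>2 ^ k * N\<close> keeps it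
    below one.\<close>
  define t where "t = \<rho> y / norm x"
  have t: "t > 1" using less x by (simp add: t_def)
  define s :: "nat \<Rightarrow> 'a" where "s k = ((\<lambda>x. star x * x) ^^ k) x" for k
  define u :: "nat \<Rightarrow> 'b" where "u k = ((\<lambda>x. star x * x) ^^ k) y" for k
  have R: "rel (2 ^ k * N) (s k) (u k)" for k
  proof (induction k)
    case (Suc k)
    from closed[OF this] show ?case by (simp add: s_def u_def mult.assoc)
  qed (simp add: s_def u_def rel)
  have S: "norm (s k) = norm x ^ (2 ^ k)" for k
    by (induction k) (simp_all add: s_def cstar_identity power_mult[symmetric] mult.commute)
  have U: "\<rho> y ^ (2 ^ k) \<le> \<rho> (u k)" for k
  proof (induction k)
    case (Suc k)
    have "\<rho> y ^ (2 ^ Suc k) = (\<rho> y ^ (2 ^ k))\<^sup>2" by (simp add: power_mult[symmetric] mult.commute)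
    also have "\<dots> \<le> (\<rho> (u k))\<^sup>2" using Suc nonneg by (intro power_mono) auto
    also have "\<dots> \<le> \<rho> (u (Suc k))" using sq[of "u k"] by (simp add: u_def)
    finally show ?case .
  qed (simp add: u_def)
  have le: "t ^ (2 ^ k) \<le> C * (real (2 ^ k * N) + 1)\<^sup>2" for k
  proof -
    have "\<rho> y ^ (2 ^ k) \<le> C * (real (2 ^ k * N) + 1)\<^sup>2 * norm x ^ (2 ^ k)"
      using U[of k] bound[OF R[of k]] unfolding S by linarith
    then show ?thesis using x by (simp add: t_def power_divide divide_le_eq)
  qed
  have le': "t ^ (2 ^ k) \<le> \<bar>C\<bar> * (real N + 1)\<^sup>2 * (real (2 ^ k) + 1)\<^sup>2" for k
  proof -
    have "(real (2 ^ k * N) + 1)\<^sup>2 \<le> ((real N + 1) * (real (2 ^ k) + 1))\<^sup>2"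
      by (intro power_mono) (auto simp: algebra_simps)
    then have "C * (real (2 ^ k * N) + 1)\<^sup>2 \<le> \<bar>C\<bar> * ((real N + 1) * (real (2 ^ k) + 1))\<^sup>2"
      by (intro mult_mono) auto
    with le[of k] show ?thesis by (simp add: power_mult_distrib mult.assoc)
  qed
  \<comment> \<open>The limit is taken along all \<open>m\<close> and then restricted to the
    subsequence \<open>m = 2 ^ k\<close>.\<close>
  have "((\<lambda>m::nat. (real m + 1)\<^sup>2 / t ^ m) \<longlongrightarrow> 0) sequentially"
    using t by real_asymp
  moreover have "filterlim (\<lambda>k::nat. 2 ^ k :: nat) sequentially sequentially"
    by real_asymp
  ultimately have "((\<lambda>k. (real (2 ^ k) + 1)\<^sup>2 / t ^ (2 ^ k)) \<longlongrightarrow> 0) sequentially"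
    by (rule filterlim_compose)
  then have "((\<lambda>k. \<bar>C\<bar> * (real N + 1)\<^sup>2 * ((real (2 ^ k) + 1)\<^sup>2 / t ^ (2 ^ k))) \<longlongrightarrow> 0) sequentially"
    by (rule tendsto_mult_right_zero)
  from order_tendstoD(2)[OF this, of 1]
  obtain k where "\<bar>C\<bar> * (real N + 1)\<^sup>2 * ((real (2 ^ k) + 1)\<^sup>2 / t ^ (2 ^ k)) < 1"
    by (auto simp: eventually_sequentially)
  with le'[of k] t show False by (simp add: divide_less_eq)
qed

section \<open>Pairs of isometries with orthogonal ranges\<close>

text \<open>Indexing by \<open>gen\<close> makes a word in the isometries and a positive word of the
  free group the same kind of list.\<close>

definition toeplitz_pair :: "(gen \<Rightarrow> 'a::unital_cstar_algebra) \<Rightarrow> bool"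
  where "toeplitz_pair v \<longleftrightarrow> (\<forall>i j. star (v i) * v j = (if i = j then 1 else 0))"

text \<open>Cuntz's canonical endomorphism. It is multiplicative, and unital exactly when the defect
  vanishes. If the isometries are pictured as prepending letters, it lets \<open>z\<close> act
  behind the first letter of a word.\<close>

definition shift :: "(gen \<Rightarrow> 'a::unital_cstar_algebra) \<Rightarrow> 'a \<Rightarrow> 'a"
  where "shift v z = v Gen_a * z * star (v Gen_a) + v Gen_b * z * star (v Gen_b)"

definition defect :: "(gen \<Rightarrow> 'a::unital_cstar_algebra) \<Rightarrow> 'a"
  where "defect v = 1 - shift v 1"

definition wprod :: "(gen \<Rightarrow> 'a::monoid_mult) \<Rightarrow> gen list \<Rightarrow> 'a"
  where "wprod v w = prod_list (map v w)"

text \<open>Since \<open>star (v i) * v j\<close> is a scalar, every product of generators and their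
  adjoints is zero or of this form.\<close>

definition wmono :: "(gen \<Rightarrow> 'a::unital_cstar_algebra) \<Rightarrow> gen list \<Rightarrow> gen list \<Rightarrow> 'a"
  where "wmono v \<mu> \<nu> = wprod v \<mu> * star (wprod v \<nu>)"

lemma wprod_Nil [simp]: "wprod v [] = 1"
  and wprod_Cons [simp]: "wprod v (i # w) = v i * wprod v w"
  and wprod_append: "wprod v (w @ w') = wprod v w * wprod v w'"
  by (simp_all add: wprod_def)

lemma toeplitz_star_mult: "toeplitz_pair v \<Longrightarrow> star (v i) * v j = (if i = j then 1 else 0)"
  by (simp add: toeplitz_pair_def)

lemma toeplitz_star_mult_left: "toeplitz_pair v \<Longrightarrow> star (v i) * (v j * x) = (if i = j then x else 0)"
  by (simp add: toeplitz_pair_def mult.assoc[symmetric])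

lemma shift_left: "toeplitz_pair v \<Longrightarrow> shift v z * v i = v i * z"
  by (cases i) (simp_all add: shift_def distrib_right mult.assoc toeplitz_star_mult)

lemma shift_right: "toeplitz_pair v \<Longrightarrow> star (v i) * shift v z = z * star (v i)"
  by (cases i) (simp_all add: shift_def distrib_left mult.assoc toeplitz_star_mult_left)

lemma shift_mult: "toeplitz_pair v \<Longrightarrow> shift v x * shift v y = shift v (x * y)"
  by (simp add: shift_def distrib_left distrib_right mult.assoc toeplitz_star_mult_left)

lemma shift_diff: "shift v (x - y) = shift v x - shift v y"
  by (simp add: shift_def algebra_simps)

lemma shift_zero [simp]: "shift v 0 = 0"
  by (simp add: shift_def)

lemma star_shift: "star (shift v x) = shift v (star x)"
  by (simp add: shift_def star_add star_mult star_star mult.assoc)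

abbreviation shiftn :: "(gen \<Rightarrow> 'a::unital_cstar_algebra) \<Rightarrow> nat \<Rightarrow> 'a \<Rightarrow> 'a"
  where "shiftn v k \<equiv> shift v ^^ k"

lemma shiftn_mult: "toeplitz_pair v \<Longrightarrow> shiftn v k x * shiftn v k y = shiftn v k (x * y)"
  by (induction k) (simp_all add: shift_mult)

lemma star_shiftn: "star (shiftn v k x) = shiftn v k (star x)"
  by (induction k) (simp_all add: star_shift)

lemma shiftn_diff: "shiftn v k (x - y) = shiftn v k x - shiftn v k y"
  by (induction k) (simp_all add: shift_diff)

lemma shiftn_zero [simp]: "shiftn v k 0 = 0"
  by (induction k) simp_all

text \<open>Each letter that passes the iterated shift cancels one application of it, by
  \<open>shift_left\<close>; a word longer than \<open>k\<close> would exhaust the shifts.\<close>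

lemma shiftn_wprod:
  assumes "toeplitz_pair v"
  shows "length \<mu> \<le> k \<Longrightarrow> shiftn v k z * wprod v \<mu> = wprod v \<mu> * shiftn v (k - length \<mu>) z"
proof (induction \<mu> arbitrary: k)
  case (Cons i \<mu>)
  then obtain m where m: "k = Suc m" by (cases k) auto
  have "shiftn v k z * wprod v (i # \<mu>) = (shift v (shiftn v m z) * v i) * wprod v \<mu>"
    by (simp add: m mult.assoc)
  also have "\<dots> = v i * (shiftn v m z * wprod v \<mu>)"
    by (simp add: shift_left[OF assms] mult.assoc)
  finally show ?case using Cons m by (simp add: mult.assoc)
qed simp

lemma wprod_shiftn:
  assumes "toeplitz_pair v" "length \<mu> \<le> k"
  shows "star (wprod v \<mu>) * shiftn v k z = shiftn v (k - length \<mu>) z * star (wprod v \<mu>)"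
  using arg_cong[OF shiftn_wprod[OF assms, of "star z"], of star]
  by (simp add: star_mult star_shiftn star_star)

lemma wprod_isometry: "toeplitz_pair v \<Longrightarrow> star (wprod v \<mu>) * wprod v \<mu> = 1"
  by (induction \<mu>) (simp_all add: star_mult mult.assoc toeplitz_star_mult_left)

text \<open>In the Fock representation these are the projections onto the words of length exactly \<open>k\<close> and
  at least \<open>k\<close>.\<close>

definition level :: "(gen \<Rightarrow> 'a::unital_cstar_algebra) \<Rightarrow> nat \<Rightarrow> 'a"
  where "level v k = shiftn v k (defect v)"

definition tailp :: "(gen \<Rightarrow> 'a::unital_cstar_algebra) \<Rightarrow> nat \<Rightarrow> 'a"
  where "tailp v k = shiftn v k 1"

lemma tailp_0 [simp]: "tailp v 0 = 1" by (simp add: tailp_def)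

lemma level_eq: "level v k = tailp v k - tailp v (Suc k)"
  by (simp add: level_def tailp_def defect_def shiftn_diff funpow_Suc_right del: funpow.simps)

lemma sum_level: "(\<Sum>k<N. level v k) + tailp v N = 1"
  by (simp add: level_eq sum_lessThan_telescope')

section \<open>Level and tail projections\<close>

lemma star_defect [simp]: "star (defect v) = defect v"
  by (simp add: defect_def star_diff star_shift)

lemma defect_left [simp]: "toeplitz_pair v \<Longrightarrow> defect v * v i = 0"
  by (simp add: defect_def left_diff_distrib shift_left)

lemma defect_right [simp]: "toeplitz_pair v \<Longrightarrow> star (v i) * defect v = 0"
  by (simp add: defect_def right_diff_distrib shift_right)

lemma defect_idem: "toeplitz_pair v \<Longrightarrow> defect v * defect v = defect v"
  by (simp add: defect_def right_diff_distrib left_diff_distrib shift_mult)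

lemma star_level [simp]: "star (level v k) = level v k"
  by (simp add: level_def star_shiftn)

lemma star_tailp [simp]: "star (tailp v k) = tailp v k"
  by (simp add: tailp_def star_shiftn)

lemma level_idem: "toeplitz_pair v \<Longrightarrow> level v k * level v k = level v k"
  by (simp add: level_def shiftn_mult defect_idem)

lemma tailp_idem: "toeplitz_pair v \<Longrightarrow> tailp v k * tailp v k = tailp v k"
  by (simp add: tailp_def shiftn_mult)

lemma defect_shiftn_Suc: "toeplitz_pair v \<Longrightarrow> defect v * shiftn v (Suc k) z = 0"
  by (simp add: shift_def distrib_left mult.assoc[symmetric])

text \<open>For \<open>j < k\<close> both factors are \<open>j\<close>-fold shifts, of the defect
  and of an element that is itself a shift; the defect kills the latter because it kills both
  generators. The other order is the adjoint.\<close>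

lemma level_orthogonal: 
  assumes "toeplitz_pair v" "j \<noteq> k" shows "level v j * level v k = 0"
proof -
  have *: "level v j * level v k = 0" if "j < k" for j k
  proof -
    have "level v k = shiftn v j (shiftn v (Suc (k - j - 1)) (defect v))"
      using that by (simp only: level_def funpow_add[THEN fun_cong, symmetric, unfolded o_apply]) simp
    then show ?thesis
      using defect_shiftn_Suc[OF assms(1)] by (simp add: level_def shiftn_mult[OF assms(1)] del: funpow.simps)
  qed
  show ?thesis using *[of j k] arg_cong[OF *[of k j], of star] assms(2)
    by (cases "j < k") (auto simp: star_mult)
qed

lemma tailp_mult:
  assumes "toeplitz_pair v" "j \<le> k" shows "tailp v j * tailp v k = tailp v k"
proof -
  have "tailp v k = shiftn v j (tailp v (k - j))"
    using assms(2) by (simp only: tailp_def funpow_add[THEN fun_cong, symmetric, unfolded o_apply]) simp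
  then show ?thesis by (simp add: tailp_def shiftn_mult[OF assms(1)])
qed

text \<open>When the word is longer than \<open>k\<close>, its first \<open>k\<close> letters use up
  the shifts, and the bare defect meets the next generator, which it kills.\<close>

lemma level_wprod:
  assumes "toeplitz_pair v"
  shows "level v k * wprod v \<mu> = (if length \<mu> \<le> k then wprod v \<mu> * level v (k - length \<mu>) else 0)"
proof (cases "length \<mu> \<le> k")
  case False
  define \<mu>1 where "\<mu>1 = take k \<mu>"
  obtain i \<mu>2 where \<mu>: "\<mu> = \<mu>1 @ i # \<mu>2" "length \<mu>1 = k"
    using False id_take_nth_drop[of k \<mu>] by (auto simp: \<mu>1_def)
  have "level v k * wprod v \<mu> = level v k * wprod v \<mu>1 * v i * wprod v \<mu>2"
    by (simp add: \<mu> wprod_append mult.assoc)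
  also have "level v k * wprod v \<mu>1 * v i = 0"
    using shiftn_wprod[OF assms, of \<mu>1 k "defect v"] \<mu>(2) assms by (simp add: level_def mult.assoc)
  finally show ?thesis using False by simp
qed (simp add: level_def shiftn_wprod[OF assms])

lemma norm_gen_le: "toeplitz_pair v \<Longrightarrow> norm (v i) \<le> 1"
  by (rule isometry_norm_le_1) (simp add: toeplitz_star_mult)

lemma norm_wprod_le: "toeplitz_pair v \<Longrightarrow> norm (wprod v \<mu>) \<le> 1"
  by (rule isometry_norm_le_1) (simp add: wprod_isometry)

lemma norm_level_le: "toeplitz_pair v \<Longrightarrow> norm (level v k) \<le> 1"
  by (rule projection_norm_le_1) (simp_all add: level_idem)

lemma norm_tailp_le: "toeplitz_pair v \<Longrightarrow> norm (tailp v k) \<le> 1"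
  by (rule projection_norm_le_1) (simp_all add: tailp_idem)

lemma norm_defect: "toeplitz_pair v \<Longrightarrow> defect v \<noteq> 0 \<Longrightarrow> norm (defect v) = 1"
  using cstar_identity[of "defect v"] by (simp add: defect_idem power2_eq_square)

text \<open>Cuntz's trick: compressing by this partial isometry kills all polynomials of level \<open>N\<close> of nonzero
  degree, because the word \<open>a\<^sup>Nb\<close> has no proper overlap with itself of shift at most \<open>N\<close>.\<close>

definition spread :: "(gen \<Rightarrow> 'a::unital_cstar_algebra) \<Rightarrow> nat \<Rightarrow> 'a"
  where "spread v N = shiftn v N (wprod v (replicate N Gen_a @ [Gen_b]))"

lemma star_spread_spread: "toeplitz_pair v \<Longrightarrow> star (spread v N) * spread v N = tailp v N"
  by (simp add: spread_def star_shiftn shiftn_mult wprod_isometry tailp_def)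

lemma norm_spread_le: "toeplitz_pair v \<Longrightarrow> norm (spread v N) \<le> 1"
  by (rule isometry_norm_le_1) (simp add: star_spread_spread norm_tailp_le)

text \<open>Picture the isometries as prepending letters and count positions from 0. The letter at
  position \<open>N\<close> is b in the range of \<open>g\<close> but a in the range of its
  \<open>j\<close>-fold shift, because \<open>0 < j\<close> and \<open>j \<le> N\<close> place that
  position inside the shifted block a^N.\<close>

lemma spread_aux:
  assumes "toeplitz_pair v" "0 < j" "j \<le> N" and g: "g = wprod v (replicate N Gen_a @ [Gen_b])"
  shows "star g * shiftn v j g = 0"
proof -
  have N: "replicate N Gen_a = replicate j Gen_a @ replicate (N - j) Gen_a"
    using assms(3) by (simp add: replicate_add[symmetric])
  have "star g * shiftn v j g = star (v Gen_b) * star (wprod v (replicate (N - j) Gen_a)) *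
      (star (wprod v (replicate j Gen_a)) * shiftn v j g)"
    by (simp add: g N wprod_append star_mult mult.assoc del: replicate_add)
  also have "\<dots> = star (v Gen_b) * (star (wprod v (replicate (N - j) Gen_a)) * g) * 
      star (wprod v (replicate j Gen_a))"
    by (subst wprod_shiftn) (use assms in \<open>simp_all add: mult.assoc\<close>)
  also have "star (wprod v (replicate (N - j) Gen_a)) * g = wprod v (replicate j Gen_a) * v Gen_b"
  proof -
    have "g = wprod v (replicate (N - j) Gen_a) * (wprod v (replicate j Gen_a) * v Gen_b)"
      using assms(3) by (simp add: g mult.assoc[symmetric] wprod_append[symmetric] replicate_add[symmetric])
        (simp add: wprod_append)
    then show ?thesis
      by (simp add: mult.assoc[symmetric] wprod_isometry[OF assms(1)])
  qed
  also have "star (v Gen_b) * (wprod v (replicate j Gen_a) * v Gen_b) = 0"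
    using assms(2) by (cases j) (simp_all add: mult.assoc toeplitz_star_mult_left[OF assms(1)])
  finally show ?thesis by simp
qed

text \<open>Moving the two words outwards leaves shifts by \<open>N - length \<mu>\<close> and
  \<open>N - length \<nu>\<close>. In degree zero these agree and \<open>g\<close> cancels against
  its adjoint; otherwise they differ by at least 1 and at most \<open>N\<close>, the range of
  \<open>spread_aux\<close>.\<close>

lemma spread_wmono:
  assumes v: "toeplitz_pair v" and len: "length \<mu> \<le> N" "length \<nu> \<le> N"
  shows "star (spread v N) * wmono v \<mu> \<nu> * spread v N =
    (if length \<mu> = length \<nu> then tailp v N * wmono v \<mu> \<nu> else 0)"
proof -
  define g where "g = wprod v (replicate N Gen_a @ [Gen_b])"
  have "star (spread v N) * wmono v \<mu> \<nu> * spread v N =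
      (shiftn v N (star g) * wprod v \<mu>) * (star (wprod v \<nu>) * shiftn v N g)"
    by (simp add: spread_def g_def[symmetric] star_shiftn wmono_def mult.assoc)
  also have "\<dots> = wprod v \<mu> * (shiftn v (N - length \<mu>) (star g) * shiftn v (N - length \<nu>) g) * star (wprod v \<nu>)"
    by (simp add: shiftn_wprod[OF v len(1)] wprod_shiftn[OF v len(2)] mult.assoc)
  finally have eq: "star (spread v N) * wmono v \<mu> \<nu> * spread v N = \<dots>" .
  have z: "shiftn v p (star g) * shiftn v q g = 0" if "p < q" "q \<le> N" for p q
  proof -
    have "shiftn v q g = shiftn v p (shiftn v (q - p) g)"
      using that by (simp add: funpow_add[THEN fun_cong, symmetric, unfolded o_apply])
    then show ?thesis
      using spread_aux[OF v _ _ g_def, of "q - p"] that by (simp add: shiftn_mult[OF v])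
  qed
  consider "length \<mu> = length \<nu>" | "length \<nu> < length \<mu>" | "length \<mu> < length \<nu>" by linarith
  then show ?thesis
  proof cases
    case 1
    have "shiftn v (N - length \<nu>) (star g) * shiftn v (N - length \<nu>) g = tailp v (N - length \<nu>)"
      by (simp add: shiftn_mult[OF v] g_def wprod_isometry[OF v] tailp_def)
    moreover have "tailp v N * wprod v \<mu> = wprod v \<mu> * tailp v (N - length \<mu>)"
      unfolding tailp_def by (rule shiftn_wprod[OF v len(1)])
    ultimately show ?thesis unfolding eq using 1 by (simp add: wmono_def mult.assoc[symmetric])
  next
    case 2
    then show ?thesis unfolding eq using z[of "N - length \<mu>" "N - length \<nu>"] len by simp
  next
    case 3
    have "shiftn v (N - length \<mu>) (star g) * shiftn v (N - length \<nu>) g = 0"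
      using arg_cong[OF z[of "N - length \<nu>" "N - length \<mu>"], of star] 3 len
      by (simp add: star_mult star_shiftn star_star)
    then show ?thesis unfolding eq using 3 by simp
  qed
qed

text \<open>A monomial changes word length by its degree and distinct levels are orthogonal, so the
  compression to one level sees degree zero only.\<close>

lemma level_wmono:
  assumes v: "toeplitz_pair v"
  shows "level v k * wmono v \<mu> \<nu> * level v k =
    (if length \<mu> = length \<nu> then level v k * wmono v \<mu> \<nu> else 0)"
proof -
  have L: "star (wprod v \<nu>) * level v k = (if length \<nu> \<le> k then level v (k - length \<nu>) * star (wprod v \<nu>) else 0)"
    using arg_cong[OF level_wprod[OF v, of k \<nu>], of star] by (simp add: star_mult if_distrib cong: if_cong)
  have "level v k * wmono v \<mu> \<nu> * level v k = (level v k * wprod v \<mu>) * (star (wprod v \<nu>) * level v k)"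
    by (simp add: wmono_def mult.assoc)
  also have "\<dots> = (if length \<mu> \<le> k \<and> length \<nu> \<le> k
      then wprod v \<mu> * (level v (k - length \<mu>) * level v (k - length \<nu>)) * star (wprod v \<nu>) else 0)"
    by (simp add: L level_wprod[OF v] mult.assoc)
  also have "\<dots> = (if length \<mu> = length \<nu> then level v k * wmono v \<mu> \<nu> else 0)"
  proof (cases "length \<mu> = length \<nu>")
    case True
    then show ?thesis
      by (simp add: wmono_def mult.assoc[symmetric] level_wprod[OF v])
        (simp add: mult.assoc level_idem[OF v])
  next
    case False
    then have "length \<mu> \<le> k \<Longrightarrow> length \<nu> \<le> k \<Longrightarrow> level v (k - length \<mu>) * level v (k - length \<nu>) = 0"
      by (intro level_orthogonal[OF v]) auto
    with False show ?thesis by simp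
  qed
  finally show ?thesis .
qed

section \<open>Polynomials in two pairs and their grading\<close>

text \<open>The values of one and the same noncommutative *-polynomial at \<open>v\<close> and at \<open>w\<close>; \<open>D\<close> contains the
  degrees of its monomials, whose two words have length at most \<open>N\<close>.\<close>

inductive poly_rel :: "(gen \<Rightarrow> 'a::unital_cstar_algebra) \<Rightarrow> (gen \<Rightarrow> 'b::unital_cstar_algebra) \<Rightarrow>
    int set \<Rightarrow> nat \<Rightarrow> 'a \<Rightarrow> 'b \<Rightarrow> bool" for v w D N where
  poly_rel_zero: "poly_rel v w D N 0 0"
| poly_rel_add: "length \<mu> \<le> N \<Longrightarrow> length \<nu> \<le> N \<Longrightarrow> int (length \<mu>) - int (length \<nu>) \<in> D \<Longrightarrow>
    poly_rel v w D N x y \<Longrightarrow> poly_rel v w D N (c *\<^sub>C wmono v \<mu> \<nu> + x) (c *\<^sub>C wmono w \<mu> \<nu> + y)"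

lemma poly_rel_wmono:
  "length \<mu> \<le> N \<Longrightarrow> length \<nu> \<le> N \<Longrightarrow> int (length \<mu>) - int (length \<nu>) \<in> D \<Longrightarrow>
    poly_rel v w D N (c *\<^sub>C wmono v \<mu> \<nu>) (c *\<^sub>C wmono w \<mu> \<nu>)"
  using poly_rel_add[OF _ _ _ poly_rel_zero, of \<mu> N \<nu> D v w c] by simp

lemma poly_rel_mono: "poly_rel v w D N x y \<Longrightarrow> D \<subseteq> D' \<Longrightarrow> N \<le> N' \<Longrightarrow> poly_rel v w D' N' x y"
  by (induction rule: poly_rel.induct) (auto intro!: poly_rel.intros)

lemma poly_rel_plus:
  "poly_rel v w D N x y \<Longrightarrow> poly_rel v w D N x' y' \<Longrightarrow> poly_rel v w D N (x + x') (y + y')"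
  by (induction rule: poly_rel.induct) (auto simp: add.assoc intro!: poly_rel.intros)

lemma poly_rel_scaleC: "poly_rel v w D N x y \<Longrightarrow> poly_rel v w D N (c *\<^sub>C x) (c *\<^sub>C y)"
  by (induction rule: poly_rel.induct) (auto simp: scaleC_add_right scaleC_scaleC intro!: poly_rel.intros)

lemma star_wmono: "star (wmono v \<mu> \<nu>) = wmono v \<nu> \<mu>"
  by (simp add: wmono_def star_mult star_star)

lemma poly_rel_star: "poly_rel v w D N x y \<Longrightarrow> poly_rel v w (uminus ` D) N (star x) (star y)"
proof (induction rule: poly_rel.induct)
  case (poly_rel_add \<mu> \<nu> x y c)
  have "int (length \<nu>) - int (length \<mu>) \<in> uminus ` D"
    using imageI[OF poly_rel_add(3), of uminus] by simp
  with poly_rel_add show ?case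
    by (simp add: star_add star_scaleC star_wmono poly_rel.poly_rel_add)
qed (simp add: poly_rel_zero)

lemma poly_rel_flip: "poly_rel v w D N x y \<Longrightarrow> poly_rel w v D N y x"
  by (induction rule: poly_rel.induct) (auto intro!: poly_rel.intros)

text \<open>A derivation of the relation is a record of the polynomial and can be replayed at a
  third pair; this later provides polynomial preimages under the quotient map.\<close>

lemma poly_rel_total: "poly_rel v w D N x y \<Longrightarrow> \<exists>z. poly_rel v u D N x z \<and> poly_rel w u D N y z"
proof (induction rule: poly_rel.induct)
  case (poly_rel_add \<mu> \<nu> x y c)
  then show ?case by (blast intro: poly_rel.poly_rel_add)
qed (blast intro: poly_rel_zero)

lemma poly_rel_times_aux:
  assumes "\<And>\<mu> \<nu> \<sigma> \<tau>. length \<mu> \<le> N \<Longrightarrow> length \<nu> \<le> N \<Longrightarrow> length \<sigma> \<le> M \<Longrightarrow> length \<tau> \<le> M \<Longrightarrow>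
      int (length \<mu>) - int (length \<nu>) \<in> D \<Longrightarrow> int (length \<sigma>) - int (length \<tau>) \<in> D' \<Longrightarrow>
      poly_rel v w E K (wmono v \<mu> \<nu> * wmono v \<sigma> \<tau>) (wmono w \<mu> \<nu> * wmono w \<sigma> \<tau>)"
    and "poly_rel v w D N x y" and "poly_rel v w D' M x' y'"
  shows "poly_rel v w E K (x * x') (y * y')"
  using assms(2)
proof (induction rule: poly_rel.induct)
  case (poly_rel_add \<mu> \<nu> x y c)
  have "poly_rel v w E K (c *\<^sub>C wmono v \<mu> \<nu> * x') (c *\<^sub>C wmono w \<mu> \<nu> * y')"
    using assms(3)
  proof (induction rule: poly_rel.induct)
    case (poly_rel_add \<sigma> \<tau> x' y' d)
    have "poly_rel v w E K ((d * c) *\<^sub>C (wmono v \<mu> \<nu> * wmono v \<sigma> \<tau>) + c *\<^sub>C wmono v \<mu> \<nu> * x')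
       ((d * c) *\<^sub>C (wmono w \<mu> \<nu> * wmono w \<sigma> \<tau>) + c *\<^sub>C wmono w \<mu> \<nu> * y')"
      using poly_rel_add \<open>length \<mu> \<le> N\<close> \<open>length \<nu> \<le> N\<close> \<open>int (length \<mu>) - int (length \<nu>) \<in> D\<close>
      by (intro poly_rel_plus poly_rel_scaleC assms(1)) auto
    then show ?case by (simp add: distrib_left mult_scaleC_left mult_scaleC_right scaleC_scaleC)
  qed (simp add: poly_rel_zero)
  then show ?case using poly_rel_add by (simp add: distrib_right poly_rel_plus)
qed (simp add: poly_rel_zero)

lemma wmono_mult_longer:
  assumes "toeplitz_pair v" shows "wmono v \<mu> (\<sigma> @ \<rho>) * wmono v \<sigma> \<tau> = wmono v \<mu> (\<tau> @ \<rho>)"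
proof -
  have "wmono v \<mu> (\<sigma> @ \<rho>) * wmono v \<sigma> \<tau> = wprod v \<mu> * star (wprod v \<rho>) *
      (star (wprod v \<sigma>) * wprod v \<sigma>) * star (wprod v \<tau>)"
    by (simp add: wmono_def wprod_append star_mult mult.assoc)
  then show ?thesis by (simp add: wprod_isometry[OF assms] wmono_def wprod_append star_mult mult.assoc)
qed

lemma wmono_mult_shorter:
  assumes "toeplitz_pair v" shows "wmono v \<mu> \<nu> * wmono v (\<nu> @ \<rho>) \<tau> = wmono v (\<mu> @ \<rho>) \<tau>"
  using arg_cong[OF wmono_mult_longer[OF assms, of \<tau> \<nu> \<rho> \<mu>], of star] by (simp add: star_mult star_wmono)

lemma wmono_mult_orthogonal:
  assumes "toeplitz_pair v" "i \<noteq> j" shows "wmono v \<mu> (p @ i # \<nu>) * wmono v (p @ j # \<sigma>) \<tau> = 0"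
proof -
  have "wmono v \<mu> (p @ i # \<nu>) * wmono v (p @ j # \<sigma>) \<tau> = wprod v \<mu> * star (wprod v \<nu>) *
      (star (v i) * (star (wprod v p) * wprod v p) * v j) * wprod v \<sigma> * star (wprod v \<tau>)"
    by (simp add: wmono_def wprod_append star_mult mult.assoc)
  then show ?thesis by (simp add: wprod_isometry[OF assms(1)] toeplitz_star_mult[OF assms(1)] assms(2))
qed

text \<open>These are the three outcomes of \<open>star (wprod v \<nu>) * wprod v \<sigma>\<close>:
  the adjoint of a remaining word, a remaining word, or zero at the first differing letter.\<close>

lemma word_cases:
  fixes \<nu> \<sigma> :: "'c list"
  obtains \<rho> where "\<nu> = \<sigma> @ \<rho>" | \<rho> where "\<sigma> = \<nu> @ \<rho>"
    | p i j \<nu>' \<sigma>' where "\<nu> = p @ i # \<nu>'" "\<sigma> = p @ j # \<sigma>'" "i \<noteq> j"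
proof (cases "parallel \<nu> \<sigma>")
  case True
  then obtain p i \<nu>' j \<sigma>' where "i \<noteq> j" "\<nu> = p @ i # \<nu>'" "\<sigma> = p @ j # \<sigma>'"
    by (blast dest: parallel_decomp)
  then show thesis by (intro that(3))
next
  case False
  then consider "prefix \<sigma> \<nu>" | "prefix \<nu> \<sigma>" by (auto simp: parallel_def)
  then show thesis by cases (auto elim: prefixE intro: that)
qed

text \<open>In general levels add. In degree zero the two words of a monomial have equal length, so
  after cancellation the new words are no longer than the longest old one. This second alternative
  for \<open>K\<close> makes degree zero at a fixed level an algebra.\<close>

lemma poly_rel_times:
  assumes v: "toeplitz_pair v" and w: "toeplitz_pair w"
    and x: "poly_rel v w D N x y" "poly_rel v w D' M x' y'"
    and E: "\<And>d e. d \<in> D \<Longrightarrow> e \<in> D' \<Longrightarrow> d + e \<in> E"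
    and K: "N + M \<le> K \<or> (D \<subseteq> {0} \<and> D' \<subseteq> {0} \<and> N \<le> K \<and> M \<le> K)"
  shows "poly_rel v w E K (x * x') (y * y')"
  using _ x
proof (rule poly_rel_times_aux)
  fix \<mu> \<nu> \<sigma> \<tau> :: "gen list"
  assume len: "length \<mu> \<le> N" "length \<nu> \<le> N" "length \<sigma> \<le> M" "length \<tau> \<le> M"
    and d: "int (length \<mu>) - int (length \<nu>) \<in> D" and e: "int (length \<sigma>) - int (length \<tau>) \<in> D'"
  note de = E[OF d e]
  have K': "D \<subseteq> {0} \<Longrightarrow> length \<mu> = length \<nu>" "D' \<subseteq> {0} \<Longrightarrow> length \<sigma> = length \<tau>" using d e by auto
  show "poly_rel v w E K (wmono v \<mu> \<nu> * wmono v \<sigma> \<tau>) (wmono w \<mu> \<nu> * wmono w \<sigma> \<tau>)"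
  proof (cases rule: word_cases[of \<nu> \<sigma>])
    case (1 \<rho>)
    have "poly_rel v w E K (1 *\<^sub>C wmono v \<mu> (\<tau> @ \<rho>)) (1 *\<^sub>C wmono w \<mu> (\<tau> @ \<rho>))"
      using 1 len de K K' by (intro poly_rel_wmono) (auto simp: algebra_simps)
    then show ?thesis by (simp add: 1 wmono_mult_longer v w)
  next
    case (2 \<rho>)
    have "poly_rel v w E K (1 *\<^sub>C wmono v (\<mu> @ \<rho>) \<tau>) (1 *\<^sub>C wmono w (\<mu> @ \<rho>) \<tau>)"
      using 2 len de K K' by (intro poly_rel_wmono) (auto simp: algebra_simps)
    then show ?thesis by (simp add: 2 wmono_mult_shorter v w)
  next
    case 3
    then show ?thesis by (simp add: wmono_mult_orthogonal v w poly_rel_zero)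
  qed
qed

lemma poly_rel_grading:
  assumes "poly_rel v w UNIV N x y"
  shows "\<exists>f g. (\<forall>d. poly_rel v w {d} N (f d) (g d)) \<and>
    x = (\<Sum>d\<in>{- int N..int N}. f d) \<and> y = (\<Sum>d\<in>{- int N..int N}. g d)"
  using assms
proof (induction rule: poly_rel.induct)
  case poly_rel_zero
  show ?case by (intro exI[of _ "\<lambda>_. 0"]) (simp add: poly_rel.poly_rel_zero)
next
  case (poly_rel_add \<mu> \<nu> x y c)
  then obtain f g where fg: "\<And>d. poly_rel v w {d} N (f d) (g d)"
    "x = (\<Sum>d\<in>{- int N..int N}. f d)" "y = (\<Sum>d\<in>{- int N..int N}. g d)" by blast
  define m where "m d = (if d = int (length \<mu>) - int (length \<nu>) then c *\<^sub>C wmono v \<mu> \<nu> else 0)" for d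
  define n where "n d = (if d = int (length \<mu>) - int (length \<nu>) then c *\<^sub>C wmono w \<mu> \<nu> else 0)" for d
  have "poly_rel v w {d} N (m d + f d) (n d + g d)" for d
    using poly_rel_add(1,2) fg(1) by (auto simp: m_def n_def intro!: poly_rel.poly_rel_add)
  moreover have "(\<Sum>d\<in>{- int N..int N}. m d) = c *\<^sub>C wmono v \<mu> \<nu>"
    "(\<Sum>d\<in>{- int N..int N}. n d) = c *\<^sub>C wmono w \<mu> \<nu>"
    using poly_rel_add(1,2) by (simp_all add: m_def n_def)
  ultimately show ?case
    by (intro exI[of _ "\<lambda>d. m d + f d"] exI[of _ "\<lambda>d. n d + g d"]) (simp add: sum.distrib fg(2,3))
qed

lemma level_compress:
  assumes "toeplitz_pair v" "poly_rel v w {d} N x y"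
  shows "level v k * x * level v k = (if d = 0 then level v k * x else 0)"
  using assms(2)
proof (induction rule: poly_rel.induct)
  case (poly_rel_add \<mu> \<nu> x y c)
  then show ?case using level_wmono[OF assms(1), of k \<mu> \<nu>]
    by (auto simp: distrib_left distrib_right mult_scaleC_left mult_scaleC_right)
qed simp

lemma spread_compress:
  assumes "toeplitz_pair v" "poly_rel v w {d} N x y"
  shows "star (spread v N) * x * spread v N = (if d = 0 then tailp v N * x else 0)"
  using assms(2)
proof (induction rule: poly_rel.induct)
  case (poly_rel_add \<mu> \<nu> x y c)
  then show ?case using spread_wmono[OF assms(1), of \<mu> N \<nu>]
    by (auto simp: distrib_left distrib_right mult_scaleC_left mult_scaleC_right)
qed simp

text \<open>\<open>N\<close> level projections and one tail projection add up to 1. Each of the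
  resulting \<open>N + 1\<close> pieces of \<open>f 0\<close> is a compression of the whole sum, by
  a level projection or by the partial isometry \<open>spread v N\<close>, and so is no larger in
  norm than that sum.\<close>

lemma norm_degree_zero_le:
  assumes v: "toeplitz_pair v" and S: "finite S" "0 \<in> S"
    and f: "\<And>d. d \<in> S \<Longrightarrow> poly_rel v w {d} N (f d) (g d)"
  shows "norm (f 0) \<le> (real N + 1) * norm (\<Sum>d\<in>S. f d)"
proof -
  define x where "x = (\<Sum>d\<in>S. f d)"
  have "level v k * x * level v k = (\<Sum>d\<in>S. if d = 0 then level v k * f d else 0)" for k
    unfolding x_def sum_distrib_left sum_distrib_right
    by (intro sum.cong level_compress[OF v f] refl)
  then have L: "level v k * x * level v k = level v k * f 0" for k
    using S by (simp add: if_distrib cong: if_cong)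
  have "star (spread v N) * x * spread v N = (\<Sum>d\<in>S. if d = 0 then tailp v N * f d else 0)"
    unfolding x_def sum_distrib_left sum_distrib_right
    by (intro sum.cong spread_compress[OF v f] refl)
  then have T: "star (spread v N) * x * spread v N = tailp v N * f 0"
    using S by simp
  have "f 0 = ((\<Sum>k<N. level v k) + tailp v N) * f 0" by (simp add: sum_level)
  also have "\<dots> = (\<Sum>k<N. level v k * x * level v k) + star (spread v N) * x * spread v N"
    by (simp only: L T distrib_right sum_distrib_right)
  also have "norm \<dots> \<le> (\<Sum>k<N. norm x) + norm x"
    by (intro norm_triangle_mono norm_triangle_le sum_norm_le norm_mult_le_norm)
      (simp_all add: norm_level_le v norm_spread_le)
  finally show ?thesis by (simp add: x_def algebra_simps)
qed

text \<open>Multiplying by a power of \<open>v Gen_a\<close> or by its adjoint moves degree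
  \<open>d\<close> to degree zero, and the isometry relation undoes this without loss of norm. The
  level may rise to \<open>2 * N\<close>, whence the constant \<open>2 * N + 1\<close>.\<close>

lemma norm_degree_le:
  assumes v: "toeplitz_pair v" and w: "toeplitz_pair w" and S: "finite S" "d \<in> S"
    and f: "\<And>d. d \<in> S \<Longrightarrow> poly_rel v w {d} N (f d) (g d)"
    and d: "\<bar>d\<bar> \<le> int N"
  shows "norm (f d) \<le> (2 * real N + 1) * norm (\<Sum>d\<in>S. f d)"
proof -
  define k where "k = nat \<bar>d\<bar>"
  define t where "t = wprod v (replicate k Gen_a)"
  define u where "u = wprod w (replicate k Gen_a)"
  have t: "star t * t = 1" "norm t \<le> 1"
    by (simp_all add: t_def wprod_isometry norm_wprod_le v)
  have k: "k \<le> N" using d by (simp add: k_def)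
  have T: "poly_rel v w {int k} N t u" 
    using poly_rel_wmono[of "replicate k Gen_a" N "[]" "{int k}" v w 1] k
    by (simp add: wmono_def t_def u_def)
  from poly_rel_star[OF this] have T': "poly_rel v w {- int k} N (star t) (star u)" by simp
  \<comment> \<open>Degrees are relabelled so that the wanted part sits at 0.\<close>
  define S' where "S' = (\<lambda>e. e - d) ` S"
  have S': "finite S'" "0 \<in> S'" using S by (auto simp: S'_def)
  have sum: "(\<Sum>e\<in>S'. f (e + d)) = (\<Sum>d\<in>S. f d)"
    unfolding S'_def by (subst sum.reindex) (auto intro: inj_onI)
  have f': "poly_rel v w {e + d} N (f (e + d)) (g (e + d))" if "e \<in> S'" for e
    using that f by (auto simp: S'_def)
  show ?thesis
  proof (cases "d \<ge> 0")
    case True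
    have "norm (f (0 + d) * star t) \<le> (real (2 * N) + 1) * norm (\<Sum>e\<in>S'. f (e + d) * star t)"
    proof (rule norm_degree_zero_le[OF v S'])
      show "poly_rel v w {e} (2 * N) (f (e + d) * star t) (g (e + d) * star u)" if "e \<in> S'" for e
        by (rule poly_rel_times[OF v w f'[OF that] T']) (use True in \<open>auto simp: k_def\<close>)
    qed
    also have "(\<Sum>e\<in>S'. f (e + d) * star t) = 1 * (\<Sum>d\<in>S. f d) * star t"
      by (simp add: sum_distrib_right[symmetric] sum)
    also have "norm \<dots> \<le> norm (\<Sum>d\<in>S. f d)"
      by (rule norm_mult_le_norm) (use t in auto)
    finally have "norm (f d * star t) \<le> (2 * real N + 1) * norm (\<Sum>d\<in>S. f d)"
      by (simp add: mult_left_mono)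
    moreover have "norm (f d) = norm (1 * (f d * star t) * t)" using t by (simp add: mult.assoc)
    moreover have "\<dots> \<le> norm (f d * star t)" by (rule norm_mult_le_norm) (use t in auto)
    ultimately show ?thesis by linarith
  next
    case False
    have "norm (t * f (0 + d)) \<le> (real (2 * N) + 1) * norm (\<Sum>e\<in>S'. t * f (e + d))"
    proof (rule norm_degree_zero_le[OF v S'])
      show "poly_rel v w {e} (2 * N) (t * f (e + d)) (u * g (e + d))" if "e \<in> S'" for e
        by (rule poly_rel_times[OF v w T f'[OF that]]) (use False in \<open>auto simp: k_def\<close>)
    qed
    also have "(\<Sum>e\<in>S'. t * f (e + d)) = t * (\<Sum>d\<in>S. f d) * 1"
      by (simp add: sum_distrib_left[symmetric] sum)
    also have "norm \<dots> \<le> norm (\<Sum>d\<in>S. f d)"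
      by (rule norm_mult_le_norm) (use t in auto)
    finally have "norm (t * f d) \<le> (2 * real N + 1) * norm (\<Sum>d\<in>S. f d)"
      by (simp add: mult_left_mono)
    moreover have "norm (f d) = norm (star t * (t * f d) * 1)" using t by (simp add: mult.assoc[symmetric])
    moreover have "\<dots> \<le> norm (t * f d)" by (rule norm_mult_le_norm) (use t in auto)
    ultimately show ?thesis by linarith
  qed
qed

text \<open>The power trick is used twice: in degree zero, where the level stays fixed and any
  constant will do, and then in all degrees, where the constant must be polynomial in the level. An
  abstract \<open>\<rho>\<close> lets the norm and the quotient seminorm share the argument.\<close>

lemma poly_rel_norm_le:
  fixes \<rho> :: "'b::unital_cstar_algebra \<Rightarrow> real" and v :: "gen \<Rightarrow> 'a::unital_cstar_algebra"
  assumes v: "toeplitz_pair v" and w: "toeplitz_pair w"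
    and nonneg: "\<And>y. 0 \<le> \<rho> y"
    and sq: "\<And>y. (\<rho> y)\<^sup>2 \<le> \<rho> (star y * y)"
    and tri: "\<And>y z. \<rho> (y + z) \<le> \<rho> y + \<rho> z" and zero: "\<rho> 0 = 0"
    and core: "\<And>N. \<exists>K. \<forall>x y. poly_rel v w {0} N x y \<longrightarrow> \<rho> y \<le> K * norm x"
    and xy: "poly_rel v w UNIV N x y"
  shows "\<rho> y \<le> norm x"
proof -
  have core1: "\<rho> y \<le> norm x" if xy: "poly_rel v w {0} N x y" for N x y
  proof -
    obtain K where K: "\<And>x y. poly_rel v w {0} N x y \<Longrightarrow> \<rho> y \<le> K * norm x" using core by blast
    \<comment> \<open>The level index of the trick is a dummy here: degree zero at level
      \<open>N\<close> is closed under products, so the one constant \<open>K\<close> serves for all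
      powers.\<close>
    show ?thesis
    proof (rule cstar_power_trick[where rel = "\<lambda>_. poly_rel v w {0} N" and N = 0 and C = "\<bar>K\<bar>"])
      fix M :: nat and x :: 'a and y assume xy: "poly_rel v w {0} N x y"
      show "poly_rel v w {0} N (star x * x) (star y * y)"
        using poly_rel_star[OF xy] by (auto intro!: poly_rel_times[OF v w _ xy])
      have "K * norm x \<le> \<bar>K\<bar> * 1 * norm x" by (simp add: mult_right_mono)
      also have "\<dots> \<le> \<bar>K\<bar> * (real M + 1)\<^sup>2 * norm x"
        by (intro mult_right_mono mult_left_mono) auto
      finally show "\<rho> y \<le> \<bar>K\<bar> * (real M + 1)\<^sup>2 * norm x" using K[OF xy] by linarith
    qed (use assms xy in auto)
  qed
  \<comment> \<open>\<open>star x * x\<close> has degree zero, where the contraction is already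
    known.\<close>
  have hom: "\<rho> y \<le> norm x" if xy: "poly_rel v w {d} N x y" for d N x y
  proof -
    have "poly_rel v w {0} (N + N) (star x * x) (star y * y)"
      using poly_rel_star[OF xy] by (auto intro!: poly_rel_times[OF v w _ xy])
    from core1[OF this] have "(\<rho> y)\<^sup>2 \<le> (norm x)\<^sup>2" using sq[of y] by (simp add: cstar_identity)
    then show ?thesis by (rule power2_le_imp_le) simp
  qed
  have sum: "\<rho> (\<Sum>d\<in>S. g d) \<le> (\<Sum>d\<in>S. \<rho> (g d))" if "finite S" for S and g :: "int \<Rightarrow> 'b"
    using that by (induction S) (auto simp: zero intro: order_trans[OF tri])
  show ?thesis
  proof (rule cstar_power_trick[where rel = "poly_rel v w UNIV" and C = 4 and \<rho> = \<rho> and N = N])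
    fix N :: nat and x :: 'a and y assume xy: "poly_rel v w UNIV N x y"
    show "poly_rel v w UNIV (2 * N) (star x * x) (star y * y)"
      by (rule poly_rel_times[OF v w _ xy, where N = N and D = UNIV])
        (use poly_rel_mono[OF poly_rel_star[OF xy], of UNIV N] in auto)
    obtain f g where fg: "\<And>d. poly_rel v w {d} N (f d) (g d)"
      "x = (\<Sum>d\<in>{- int N..int N}. f d)" "y = (\<Sum>d\<in>{- int N..int N}. g d)"
      using poly_rel_grading[OF xy] by blast
    \<comment> \<open>There are \<open>2 * N + 1\<close> degrees, each costing a factor
      \<open>2 * N + 1\<close>; the square is at most \<open>4 * (N + 1)^2\<close>, whence
      \<open>C = 4\<close>.\<close>
    have "\<rho> y \<le> (\<Sum>d\<in>{- int N..int N}. \<rho> (g d))" unfolding fg(3) by (rule sum) simp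
    also have "\<dots> \<le> (\<Sum>d\<in>{- int N..int N}. (2 * real N + 1) * norm x)"
    proof (rule sum_mono)
      fix d assume d: "d \<in> {- int N..int N}"
      have "\<rho> (g d) \<le> norm (f d)" by (rule hom[OF fg(1)])
      also have "\<dots> \<le> (2 * real N + 1) * norm x"
        unfolding fg(2) by (rule norm_degree_le[OF v w _ d fg(1)]) (use d in auto)
      finally show "\<rho> (g d) \<le> (2 * real N + 1) * norm x" .
    qed
    also have "\<dots> = (2 * real N + 1)\<^sup>2 * norm x" by (simp add: power2_eq_square)
    also have "\<dots> \<le> (2 * (real N + 1))\<^sup>2 * norm x" by (intro mult_right_mono power_mono) auto
    finally show "\<rho> y \<le> 4 * (real N + 1)\<^sup>2 * norm x" unfolding power_mult_distrib by simp
  qed (use assms in auto)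
qed

section \<open>Norm estimates for polynomials\<close>

lemma wmono_Nil [simp]: "wmono v [] [] = 1"
  by (simp add: wmono_def)

lemma poly_rel_one: "0 \<in> D \<Longrightarrow> poly_rel v w D N (c *\<^sub>C 1) (c *\<^sub>C 1)"
  using poly_rel_wmono[of "[]" N "[]" D v w c] by simp

lemma wmono_compress:
  assumes "toeplitz_pair v"
  shows "star (v i) * wmono v (k # \<mu>) (l # \<nu>) * v j = (if i = k \<and> j = l then wmono v \<mu> \<nu> else 0)"
proof -
  have "star (v i) * wmono v (k # \<mu>) (l # \<nu>) * v j =
      (star (v i) * v k) * wmono v \<mu> \<nu> * (star (v l) * v j)"
    by (simp add: wmono_def star_mult mult.assoc)
  then show ?thesis by (auto simp: toeplitz_star_mult[OF assms])
qed

lemma wmono_shift_one: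
  assumes "toeplitz_pair v"
  shows "shift v 1 * wmono v (k # \<mu>) (l # \<nu>) * shift v 1 = wmono v (k # \<mu>) (l # \<nu>)"
proof -
  have "shift v 1 * wmono v (k # \<mu>) (l # \<nu>) * shift v 1 =
      (shift v 1 * v k) * wmono v \<mu> \<nu> * (star (v l) * shift v 1)"
    by (simp add: wmono_def star_mult mult.assoc)
  then show ?thesis
    by (simp add: shift_left[OF assms] shift_right[OF assms]) (simp add: wmono_def star_mult mult.assoc)
qed

lemma poly_rel_core_0:
  assumes "poly_rel v w {0} 0 x y" shows "\<exists>c. x = c *\<^sub>C 1 \<and> y = c *\<^sub>C 1"
  using assms
proof (induction rule: poly_rel.induct)
  case (poly_rel_add \<mu> \<nu> x y c)
  then obtain d where "x = d *\<^sub>C 1" "y = d *\<^sub>C 1" by blast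
  then show ?case using poly_rel_add by (intro exI[of _ "c + d"]) (simp add: scaleC_add_left)
qed (auto intro: exI[of _ 0])

text \<open>A degree-zero monomial either is 1 or begins with some \<open>v k\<close> and ends with
  some \<open>star (v l)\<close>. With the first kind collected into \<open>c\<close>, the rest is a
  2 by 2 matrix with entries of level \<open>N\<close>, which drives the inductions on the
  level.\<close>

lemma poly_rel_core_Suc:
  assumes v: "toeplitz_pair v" and w: "toeplitz_pair w" and xy: "poly_rel v w {0} (Suc N) x y"
  shows "\<exists>c x' y'. x = c *\<^sub>C 1 + x' \<and> y = c *\<^sub>C 1 + y' \<and>
    (\<forall>i j. poly_rel v w {0} N (star (v i) * x' * v j) (star (w i) * y' * w j)) \<and>
    shift v 1 * x' * shift v 1 = x' \<and> shift w 1 * y' * shift w 1 = y'"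
  using xy
proof (induction rule: poly_rel.induct)
  case poly_rel_zero
  show ?case by (rule exI[of _ 0], rule exI[of _ 0], rule exI[of _ 0]) (simp add: poly_rel.poly_rel_zero)
next
  case (poly_rel_add \<mu> \<nu> x y c)
  then obtain d x' y' where IH: "x = d *\<^sub>C 1 + x'" "y = d *\<^sub>C 1 + y'"
    "\<And>i j. poly_rel v w {0} N (star (v i) * x' * v j) (star (w i) * y' * w j)"
    "shift v 1 * x' * shift v 1 = x'" "shift w 1 * y' * shift w 1 = y'" by blast
  show ?case
  proof (cases \<mu>)
    case Nil
    with poly_rel_add have "\<nu> = []" by simp
    with Nil show ?thesis
      by (intro exI[of _ "c + d"] exI[of _ x'] exI[of _ y'] conjI allI IH)
        (simp_all add: IH(1,2) scaleC_add_left add.assoc)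
  next
    case (Cons k \<mu>')
    with poly_rel_add obtain l \<nu>' where \<nu>: "\<nu> = l # \<nu>'" by (cases \<nu>) auto
    have len: "length \<mu>' \<le> N" "length \<nu>' \<le> N" "length \<mu>' = length \<nu>'"
      using poly_rel_add(1-3) Cons \<nu> by auto
    have "poly_rel v w {0} N (star (v i) * (c *\<^sub>C wmono v \<mu> \<nu> + x') * v j)
        (star (w i) * (c *\<^sub>C wmono w \<mu> \<nu> + y') * w j)" for i j
    proof -
      have "poly_rel v w {0} N (c *\<^sub>C (star (v i) * wmono v \<mu> \<nu> * v j) + star (v i) * x' * v j)
          (c *\<^sub>C (star (w i) * wmono w \<mu> \<nu> * w j) + star (w i) * y' * w j)"
        using IH(3)[of i j] len unfolding Cons \<nu> wmono_compress[OF v] wmono_compress[OF w]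
        by (auto intro: poly_rel.poly_rel_add)
      then show ?thesis
        by (simp add: distrib_left distrib_right mult_scaleC_left mult_scaleC_right)
    qed
    then show ?thesis
      by (intro exI[of _ d] exI[of _ "c *\<^sub>C wmono v \<mu> \<nu> + x'"] exI[of _ "c *\<^sub>C wmono w \<mu> \<nu> + y'"] conjI allI)
        (simp_all add: IH Cons \<nu> wmono_shift_one v w distrib_left distrib_right mult_scaleC_left
          mult_scaleC_right ac_simps(1-3))
  qed
qed

text \<open>The sandwich is a 2 by 2 matrix whose entries carry \<open>z\<close> on the left; adding
  four entries of norm at most \<open>K\<close> gives the crude factor 4. In the applications
  \<open>z\<close> is 1 or a tail projection.\<close>

lemma norm_shift_sandwich_le:
  assumes v: "toeplitz_pair v" and K: "\<And>i j. norm (z * (star (v i) * x * v j)) \<le> K"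
  shows "norm (shift v z * x * shift v 1) \<le> 4 * K"
proof -
  have "norm (v i * (z * (star (v i) * x * v j)) * star (v j)) \<le> K" for i j
    by (rule order_trans[OF norm_mult_le_norm K]) (simp_all add: norm_gen_le v)
  note this[of Gen_a Gen_a] this[of Gen_a Gen_b] this[of Gen_b Gen_a] this[of Gen_b Gen_b]
  moreover have "norm (a + b + (c + d)) \<le> norm a + norm b + (norm c + norm d)" for a b c d :: 'a
    by (intro norm_triangle_mono) auto
  moreover have "shift v z * x * shift v 1 =
    v Gen_a * (z * (star (v Gen_a) * x * v Gen_a)) * star (v Gen_a) +
    v Gen_a * (z * (star (v Gen_a) * x * v Gen_b)) * star (v Gen_b) +
    (v Gen_b * (z * (star (v Gen_b) * x * v Gen_a)) * star (v Gen_a) +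
    v Gen_b * (z * (star (v Gen_b) * x * v Gen_b)) * star (v Gen_b))"
    by (simp add: shift_def distrib_left distrib_right mult.assoc add_ac)
  ultimately show ?thesis by (smt (verit, best))
qed

text \<open>A nonzero defect has norm 1 and annihilates the matrix part \<open>x'\<close>, so
  multiplying by it reads off the scalar: \<open>cmod c \<le> norm x\<close>. Then
  \<open>norm x' \<le> 2 * norm x\<close>, and the four matrix entries turn \<open>K\<close> into
  \<open>1 + 8 * \<bar>K\<bar>\<close>.\<close>

lemma core_bound_defect:
  fixes v :: "gen \<Rightarrow> 'a::unital_cstar_algebra" and w :: "gen \<Rightarrow> 'b::unital_cstar_algebra"
  assumes v: "toeplitz_pair v" and w: "toeplitz_pair w" and Q: "defect v \<noteq> 0"
  shows "\<exists>K. \<forall>x y. poly_rel v w {0} N x y \<longrightarrow> norm y \<le> K * norm x"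
proof (induction N)
  case 0
  have "norm y \<le> 1 * norm x" if "poly_rel v w {0} 0 x y" for x y
    using poly_rel_core_0[OF that] by (auto simp: norm_scaleC)
  then show ?case by blast
next
  case (Suc N)
  then obtain K where K: "\<And>x y. poly_rel v w {0} N x y \<Longrightarrow> norm y \<le> K * norm x" by blast
  have "norm y \<le> (1 + 8 * \<bar>K\<bar>) * norm x" if xy: "poly_rel v w {0} (Suc N) x y" for x y
  proof -
    obtain c x' y' where d: "x = c *\<^sub>C 1 + x'" "y = c *\<^sub>C 1 + y'"
      "\<And>i j. poly_rel v w {0} N (star (v i) * x' * v j) (star (w i) * y' * w j)"
      "shift v 1 * x' * shift v 1 = x'" "shift w 1 * y' * shift w 1 = y'"
      using poly_rel_core_Suc[OF v w xy] by blast
    have "defect v * shift v 1 = 0" using defect_shiftn_Suc[OF v, of 0 1] by simp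
    then have "defect v * (shift v 1 * x' * shift v 1) = 0" by (simp add: mult.assoc[symmetric])
    then have "defect v * x = c *\<^sub>C defect v"
      by (simp add: d(1) d(4) distrib_left mult_scaleC_right)
    then have "cmod c = norm (defect v * x * 1)"
      using norm_defect[OF v Q] by (simp add: norm_scaleC)
    also have "\<dots> \<le> norm x"
      by (rule norm_mult_le_norm) (use norm_defect[OF v Q] in auto)
    finally have c: "cmod c \<le> norm x" .
    have "norm x' \<le> norm x + norm (c *\<^sub>C (1::'a))"
      using norm_triangle_ineq4[of x "c *\<^sub>C 1"] by (simp add: d(1))
    with c have x': "norm x' \<le> 2 * norm x" by (simp add: norm_scaleC)
    have y': "norm (1 * (star (w i) * y' * w j)) \<le> \<bar>K\<bar> * (2 * norm x)" for i j
    proof -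
      have "norm (star (w i) * y' * w j) \<le> \<bar>K\<bar> * norm (star (v i) * x' * v j)"
        by (rule order_trans[OF K[OF d(3)] mult_right_mono]) auto
      also have "\<dots> \<le> \<bar>K\<bar> * (2 * norm x)"
        by (intro mult_left_mono order_trans[OF norm_mult_le_norm x']) (auto simp: norm_gen_le v)
      finally show ?thesis by simp
    qed
    have "norm y' \<le> 4 * (\<bar>K\<bar> * (2 * norm x))"
      using norm_shift_sandwich_le[OF w y'] d(5) by simp
    moreover have "norm y \<le> cmod c + norm y'"
      using norm_triangle_ineq[of "c *\<^sub>C 1" y'] by (simp add: d(2) norm_scaleC)
    ultimately show ?thesis using c by (simp add: algebra_simps)
  qed
  then show ?case by blast
qed

text \<open>Behind \<open>tailp w N\<close> a polynomial of level \<open>N\<close> acts as a single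
  matrix indexed by words of length \<open>N\<close>. The scalar is therefore not isolated but joins
  the diagonal entries, which again have level \<open>N\<close>; this works whatever the defects
  are.\<close>

lemma core_bound_tailp:
  fixes v :: "gen \<Rightarrow> 'a::unital_cstar_algebra" and w :: "gen \<Rightarrow> 'b::unital_cstar_algebra"
  assumes v: "toeplitz_pair v" and w: "toeplitz_pair w"
  shows "\<exists>K. \<forall>x y. poly_rel v w {0} N x y \<longrightarrow> norm (tailp w N * y) \<le> K * norm x"
proof (induction N)
  case 0
  have "norm (tailp w 0 * y) \<le> 1 * norm x" if "poly_rel v w {0} 0 x y" for x y
    using poly_rel_core_0[OF that] by (auto simp: norm_scaleC)
  then show ?case by blast
next
  case (Suc N)
  then obtain K where K: "\<And>x y. poly_rel v w {0} N x y \<Longrightarrow> norm (tailp w N * y) \<le> K * norm x" by blast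
  have "norm (tailp w (Suc N) * y) \<le> 4 * \<bar>K\<bar> * norm x" if xy: "poly_rel v w {0} (Suc N) x y" for x y
  proof -
    obtain c x' y' where d: "x = c *\<^sub>C 1 + x'" "y = c *\<^sub>C 1 + y'"
      "\<And>i j. poly_rel v w {0} N (star (v i) * x' * v j) (star (w i) * y' * w j)"
      "shift v 1 * x' * shift v 1 = x'" "shift w 1 * y' * shift w 1 = y'"
      using poly_rel_core_Suc[OF v w xy] by blast
    have "poly_rel v w {0} N (star (v i) * x * v j) (star (w i) * y * w j)" for i j
    proof -
      have "star (v i) * x * v j = (if i = j then c else 0) *\<^sub>C 1 + star (v i) * x' * v j"
        "star (w i) * y * w j = (if i = j then c else 0) *\<^sub>C 1 + star (w i) * y' * w j"
        by (simp_all add: d(1,2) distrib_left distrib_right mult_scaleC_left mult_scaleC_right toeplitz_star_mult v w)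
      then show ?thesis using poly_rel_plus[OF poly_rel_one d(3)] by simp
    qed
    note ij = this
    have y: "norm (tailp w N * (star (w i) * y * w j)) \<le> \<bar>K\<bar> * norm x" for i j
    proof -
      have "norm (tailp w N * (star (w i) * y * w j)) \<le> \<bar>K\<bar> * norm (star (v i) * x * v j)"
        by (rule order_trans[OF K[OF ij] mult_right_mono]) auto
      also have "\<dots> \<le> \<bar>K\<bar> * norm x"
        by (intro mult_left_mono norm_mult_le_norm) (auto simp: norm_gen_le v)
      finally show ?thesis .
    qed
    have s1: "shift w 1 * shift w 1 = shift w 1" by (simp add: shift_mult w)
    have z1: "shift w z * shift w 1 = shift w z" for z by (simp add: shift_mult w)
    \<comment> \<open>The sandwich estimate wants \<open>shift w 1\<close> on the right. The matrix
      part \<open>y'\<close> absorbs it, and in the scalar part \<open>shift w (tailp w N)\<close>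
      does.\<close>
    have "y' * shift w 1 = y'" by (metis d(5) mult.assoc s1)
    then have "shift w (tailp w N) * y = shift w (tailp w N) * y * shift w 1"
      by (simp add: d(2) distrib_left distrib_right mult_scaleC_left mult_scaleC_right mult.assoc z1)
    then show ?thesis using norm_shift_sandwich_le[OF w y] by (simp add: tailp_def)
  qed
  then show ?case by blast
qed

text \<open>The two words of each monomial have equal length at most \<open>N\<close> and pass the
  tail projection with the same loss of shifts. This reconciles the left factor in
  \<open>core_bound_tailp\<close> with the right factor in \<open>tail_norm\<close>.\<close>

lemma core_tailp_commute:
  assumes v: "toeplitz_pair v" and w: "toeplitz_pair w" and "poly_rel v w {0} N x y"
  shows "tailp w N * y = y * tailp w N"
  using assms(3)
proof (induction rule: poly_rel.induct)
  case (poly_rel_add \<mu> \<nu> x y c)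
  have "tailp w N * wmono w \<mu> \<nu> = wmono w \<mu> \<nu> * tailp w N"
    using shiftn_wprod[OF w poly_rel_add(1), of 1] wprod_shiftn[OF w poly_rel_add(2), of 1] poly_rel_add(3)
    by (simp add: wmono_def tailp_def mult.assoc[symmetric]) (simp add: mult.assoc)
  with poly_rel_add show ?case
    by (simp add: distrib_left distrib_right mult_scaleC_left mult_scaleC_right)
qed simp

text \<open>This is the quotient seminorm modulo the ideal generated by the defect.\<close>

definition tail_norm :: "(gen \<Rightarrow> 'a::unital_cstar_algebra) \<Rightarrow> 'a \<Rightarrow> real"
  where "tail_norm v x = (INF M. norm (x * tailp v M))"

section \<open>The quotient seminorm and the norm inequalities\<close>

lemma tail_norm_le: "tail_norm v x \<le> norm (x * tailp v M)"
  unfolding tail_norm_def by (rule cINF_lower) (auto intro: bdd_belowI[of _ 0])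

lemma tail_norm_ge: "(\<And>M. c \<le> norm (x * tailp v M)) \<Longrightarrow> c \<le> tail_norm v x"
  unfolding tail_norm_def by (rule cINF_greatest) auto

lemma tail_norm_less: "tail_norm v x < c \<Longrightarrow> \<exists>M. norm (x * tailp v M) < c"
  by (meson tail_norm_ge not_le)

lemma norm_tailp_antimono:
  assumes "toeplitz_pair v" "M \<le> N" shows "norm (x * tailp v N) \<le> norm (x * tailp v M)"
proof -
  have "norm (x * tailp v N) = norm (1 * (x * tailp v M) * tailp v N)"
    using tailp_mult[OF assms] by (simp add: mult.assoc)
  also have "\<dots> \<le> norm (x * tailp v M)" by (rule norm_mult_le_norm) (simp_all add: norm_tailp_le assms)
  finally show ?thesis .
qed

lemma tail_norm_triangle:
  assumes "toeplitz_pair v" shows "tail_norm v (x + y) \<le> tail_norm v x + tail_norm v y"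
proof (rule field_le_epsilon)
  fix e :: real assume "e > 0"
  then obtain M N where MN: "norm (x * tailp v M) < tail_norm v x + e / 2" "norm (y * tailp v N) < tail_norm v y + e / 2"
    using tail_norm_less[of v x "tail_norm v x + e / 2"] tail_norm_less[of v y "tail_norm v y + e / 2"] by auto
  have "tail_norm v (x + y) \<le> norm (x * tailp v (max M N) + y * tailp v (max M N))"
    using tail_norm_le[of v "x + y"] by (simp add: distrib_right)
  also have "\<dots> \<le> norm (x * tailp v M) + norm (y * tailp v N)"
    by (intro norm_triangle_mono norm_tailp_antimono assms) auto
  finally show "tail_norm v (x + y) \<le> tail_norm v x + tail_norm v y + e" using MN by linarith
qed

text \<open>The C*-identity for \<open>x * tailp v M\<close> produces
  \<open>tailp v M * (star x * x * tailp v M)\<close>, whose left factor is a contraction.\<close>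

lemma tail_norm_sq:
  assumes "toeplitz_pair v" shows "(tail_norm v x)\<^sup>2 \<le> tail_norm v (star x * x)"
proof (rule tail_norm_ge)
  fix M
  have "(tail_norm v x)\<^sup>2 \<le> (norm (x * tailp v M))\<^sup>2"
    by (intro power_mono tail_norm_le tail_norm_ge) auto
  also have "\<dots> = norm (tailp v M * (star x * x * tailp v M) * 1)"
    by (simp add: cstar_identity[symmetric] star_mult mult.assoc)
  also have "\<dots> \<le> norm (star x * x * tailp v M)"
    by (rule norm_mult_le_norm) (simp_all add: norm_tailp_le assms)
  finally show "(tail_norm v x)\<^sup>2 \<le> norm (star x * x * tailp v M)" .
qed

theorem norm_poly_le_if_defect:
  assumes "toeplitz_pair v" "toeplitz_pair w" "defect v \<noteq> 0" "poly_rel v w UNIV N x y"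
  shows "norm y \<le> norm x"
  using assms(4)
  by (intro poly_rel_norm_le[where \<rho> = norm, OF assms(1,2)] core_bound_defect assms norm_triangle_ineq)
    (auto simp: cstar_identity)

text \<open>Read from the Cuntz side to the Toeplitz side, this is what bounds lifts along the
  quotient map.\<close>

theorem tail_norm_poly_le:
  fixes v :: "gen \<Rightarrow> 'a::unital_cstar_algebra" and w :: "gen \<Rightarrow> 'b::unital_cstar_algebra"
  assumes v: "toeplitz_pair v" and w: "toeplitz_pair w" and xy: "poly_rel v w UNIV N x y"
  shows "tail_norm w y \<le> norm x"
proof (rule poly_rel_norm_le[where \<rho> = "tail_norm w", OF v w _ tail_norm_sq[OF w] tail_norm_triangle[OF w] _ _ xy])
  show "0 \<le> tail_norm w y" for y by (rule tail_norm_ge) simp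
  then show "tail_norm w 0 = 0" using tail_norm_le[of w 0 0] by (auto intro: antisym)
  fix N
  obtain K where "\<And>x y. poly_rel v w {0} N x y \<Longrightarrow> norm (tailp w N * y) \<le> K * norm x"
    using core_bound_tailp[OF v w, of N] by blast
  then have "tail_norm w y \<le> K * norm x" if "poly_rel v w {0} N x y" for x y
    using core_tailp_commute[OF v w that] that tail_norm_le[of w y N] by (metis order_trans)
  then show "\<exists>K. \<forall>x y. poly_rel v w {0} N x y \<longrightarrow> tail_norm w y \<le> K * norm x" by blast
qed

lemma tailp_eq_one: "defect v = 0 \<Longrightarrow> tailp v k = 1"
proof (induction k)
  case (Suc k)
  then show ?case by (simp add: tailp_def defect_def)
qed simp

text \<open>With zero defect all tail projections are 1, and the quotient seminorm is the
  norm.\<close>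

corollary norm_poly_le_if_no_defect:
  assumes "toeplitz_pair v" "toeplitz_pair w" "defect w = 0" "poly_rel v w UNIV N x y"
  shows "norm y \<le> norm x"
  using tail_norm_poly_le[OF assms(1,2,4)] tail_norm_ge[of "norm y" y w]
  by (simp add: tailp_eq_one[OF assms(3)])

section \<open>Homomorphisms and the Toeplitz extension\<close>

lemma cstar_subalgebra_diff:
  "cstar_subalgebra A \<Longrightarrow> x \<in> A \<Longrightarrow> y \<in> A \<Longrightarrow> x - y \<in> A"
  unfolding cstar_subalgebra_def by (metis scaleC_minus_one diff_conv_add_uminus)

lemma cstar_subalgebra_generated: "cstar_subalgebra (cstar_generated G)"
  unfolding cstar_generated_def cstar_subalgebra_def by (auto intro!: closed_Inter)

lemma generators_in_cstar_generated: "G \<subseteq> cstar_generated G"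
  unfolding cstar_generated_def by blast

lemma cstar_generated_least: "cstar_subalgebra A \<Longrightarrow> G \<subseteq> A \<Longrightarrow> cstar_generated G \<subseteq> A"
  unfolding cstar_generated_def by blast

lemma cstar_subalgebraD:
  assumes "cstar_subalgebra A"
  shows "0 \<in> A" "x \<in> A \<Longrightarrow> y \<in> A \<Longrightarrow> x + y \<in> A" "x \<in> A \<Longrightarrow> y \<in> A \<Longrightarrow> x * y \<in> A"
    "x \<in> A \<Longrightarrow> star x \<in> A" "x \<in> A \<Longrightarrow> c *\<^sub>C x \<in> A" "closed A"
  using assms unfolding cstar_subalgebra_def by auto

lemma closed_idealD:
  assumes "closed_ideal J A"
  shows "J \<subseteq> A" "0 \<in> J" "x \<in> J \<Longrightarrow> y \<in> J \<Longrightarrow> x + y \<in> J" "x \<in> J \<Longrightarrow> c *\<^sub>C x \<in> J"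
    "x \<in> J \<Longrightarrow> y \<in> A \<Longrightarrow> x * y \<in> J" "x \<in> J \<Longrightarrow> y \<in> A \<Longrightarrow> y * x \<in> J" "closed J"
  using assms unfolding closed_ideal_def by auto

lemma closed_ideal_generated:
  assumes "cstar_subalgebra A" "G \<subseteq> A" shows "closed_ideal (ideal_generated A G) A"
proof -
  have "closed_ideal A A" using cstar_subalgebraD[OF assms(1)] by (auto simp: closed_ideal_def)
  then have "ideal_generated A G \<subseteq> A" using assms(2) unfolding ideal_generated_def by blast
  then show ?thesis
    unfolding closed_ideal_def by (auto simp: ideal_generated_def closed_ideal_def intro!: closed_Inter)
qed

lemma ideal_generated_least: "closed_ideal J A \<Longrightarrow> G \<subseteq> J \<Longrightarrow> ideal_generated A G \<subseteq> J"
  unfolding ideal_generated_def by blast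

lemma generators_in_ideal_generated: "G \<subseteq> ideal_generated A G"
  unfolding ideal_generated_def by blast

lemma toeplitz_one_in:
  assumes v: "toeplitz_pair v" and A: "cstar_subalgebra A" "range v \<subseteq> A" shows "1 \<in> A"
proof -
  have "star (v Gen_a) * v Gen_a \<in> A" using A by (intro cstar_subalgebraD[OF A(1)]) auto
  then show ?thesis by (simp add: toeplitz_star_mult[OF v])
qed

lemma wmono_in:
  assumes v: "toeplitz_pair v" and A: "cstar_subalgebra A" "range v \<subseteq> A" shows "wmono v \<mu> \<nu> \<in> A"
proof -
  have "wprod v \<mu> \<in> A" for \<mu>
  proof (induction \<mu>)
    case (Cons i \<mu>)
    then show ?case using A(2) by (auto intro: cstar_subalgebraD(3)[OF A(1)])
  qed (simp add: toeplitz_one_in[OF assms])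
  then show ?thesis unfolding wmono_def by (intro cstar_subalgebraD(3,4)[OF A(1)])
qed

text \<open>The level served for counting in the power trick; from here on only its existence
  matters.\<close>

definition poly_pair ::
  "(gen \<Rightarrow> 'a::unital_cstar_algebra) \<Rightarrow> (gen \<Rightarrow> 'b::unital_cstar_algebra) \<Rightarrow> 'a \<Rightarrow> 'b \<Rightarrow> bool"
  where "poly_pair v w x y \<longleftrightarrow> (\<exists>N. poly_rel v w UNIV N x y)"

lemma poly_pair_in:
  assumes v: "toeplitz_pair v" and A: "cstar_subalgebra A" "range v \<subseteq> A" and xy: "poly_pair v w x y"
  shows "x \<in> A"
proof -
  from xy obtain N where "poly_rel v w UNIV N x y" by (auto simp: poly_pair_def)
  then show ?thesis
    by (induction rule: poly_rel.induct) (auto intro: cstar_subalgebraD[OF A(1)] wmono_in[OF v A])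
qed

lemma poly_pair_flip: "poly_pair v w x y \<Longrightarrow> poly_pair w v y x"
  unfolding poly_pair_def by (blast intro: poly_rel_flip)

lemma poly_pair_zero: "poly_pair v w 0 0"
  unfolding poly_pair_def by (blast intro: poly_rel_zero)

lemma poly_pair_one: "poly_pair v w 1 1"
  using poly_rel_one[of UNIV v w 0 1] unfolding poly_pair_def by (intro exI[of _ 0]) simp

lemma poly_pair_gen: "poly_pair v w (v i) (w i)"
  using poly_rel_wmono[of "[i]" 1 "[]" UNIV v w 1] unfolding poly_pair_def
  by (intro exI[of _ 1]) (simp add: wmono_def)

lemma poly_pair_plus:
  assumes "poly_pair v w x y" "poly_pair v w x' y'" shows "poly_pair v w (x + x') (y + y')"
proof -
  from assms obtain N M where "poly_rel v w UNIV N x y" "poly_rel v w UNIV M x' y'"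
    by (auto simp: poly_pair_def)
  then have "poly_rel v w UNIV (max N M) (x + x') (y + y')"
    by (intro poly_rel_plus) (auto elim!: poly_rel_mono)
  then show ?thesis by (auto simp: poly_pair_def)
qed

lemma poly_pair_scaleC: "poly_pair v w x y \<Longrightarrow> poly_pair v w (c *\<^sub>C x) (c *\<^sub>C y)"
  unfolding poly_pair_def by (blast intro: poly_rel_scaleC)

lemma poly_pair_diff:
  assumes "poly_pair v w x y" "poly_pair v w x' y'" shows "poly_pair v w (x - x') (y - y')"
  using poly_pair_plus[OF assms(1) poly_pair_scaleC[OF assms(2), of "- 1"]] by (simp add: scaleC_minus_one)

lemma poly_pair_star: "poly_pair v w x y \<Longrightarrow> poly_pair v w (star x) (star y)"
  unfolding poly_pair_def by (elim exE, intro exI, erule poly_rel_mono[OF poly_rel_star]) auto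

lemma poly_pair_times:
  assumes "toeplitz_pair v" "toeplitz_pair w" "poly_pair v w x y" "poly_pair v w x' y'"
  shows "poly_pair v w (x * x') (y * y')"
proof -
  from assms(3,4) obtain N M where "poly_rel v w UNIV N x y" "poly_rel v w UNIV M x' y'"
    by (auto simp: poly_pair_def)
  then have "poly_rel v w UNIV (N + M) (x * x') (y * y')"
    by (rule poly_rel_times[OF assms(1,2)]) auto
  then show ?thesis by (auto simp: poly_pair_def)
qed

lemma poly_pair_sum: "(\<And>k. k \<in> S \<Longrightarrow> poly_pair v w (f k) (g k)) \<Longrightarrow> poly_pair v w (sum f S) (sum g S)"
  by (induction S rule: infinite_finite_induct) (auto intro: poly_pair_zero poly_pair_plus)

lemma poly_pair_shiftn:
  assumes "toeplitz_pair v" "toeplitz_pair w" "poly_pair v w x y"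
  shows "poly_pair v w (shiftn v k x) (shiftn w k y)"
proof (induction k)
  case (Suc k)
  then show ?case
    by (auto simp: shift_def intro!: poly_pair_plus poly_pair_times poly_pair_star poly_pair_gen assms)
qed (simp add: assms)

lemma poly_pair_tailp:
  "toeplitz_pair v \<Longrightarrow> toeplitz_pair w \<Longrightarrow> poly_pair v w (tailp v k) (tailp w k)"
  unfolding tailp_def by (intro poly_pair_shiftn poly_pair_one)

text \<open>The closure of the graph given by polynomials, kept as a relation because it is
  symmetric: exchanging \<open>v\<close> and \<open>w\<close> transposes it.\<close>

definition poly_limit ::
  "(gen \<Rightarrow> 'a::unital_cstar_algebra) \<Rightarrow> (gen \<Rightarrow> 'b::unital_cstar_algebra) \<Rightarrow> 'a \<Rightarrow> 'b \<Rightarrow> bool"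
  where "poly_limit v w x y \<longleftrightarrow>
    (\<exists>xs ys. (\<forall>n. poly_pair v w (xs n) (ys n)) \<and> xs \<longlonglongrightarrow> x \<and> ys \<longlonglongrightarrow> y)"

lemma poly_limitI:
  "(\<And>n. poly_pair v w (xs n) (ys n)) \<Longrightarrow> xs \<longlonglongrightarrow> x \<Longrightarrow> ys \<longlonglongrightarrow> y \<Longrightarrow> poly_limit v w x y"
  unfolding poly_limit_def by blast

lemma poly_limit_pair: "poly_pair v w x y \<Longrightarrow> poly_limit v w x y"
  by (rule poly_limitI[of v w "\<lambda>_. x" "\<lambda>_. y"]) simp_all

lemma poly_limit_flip: "poly_limit v w x y \<Longrightarrow> poly_limit w v y x"
  unfolding poly_limit_def by (elim exE conjE, intro exI conjI allI, rule poly_pair_flip) blast+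

lemma poly_limit_plus:
  assumes "poly_limit v w x y" "poly_limit v w x' y'" shows "poly_limit v w (x + x') (y + y')"
proof -
  obtain xs ys where 1: "\<And>n. poly_pair v w (xs n) (ys n)" "xs \<longlonglongrightarrow> x" "ys \<longlonglongrightarrow> y"
    using assms(1) unfolding poly_limit_def by blast
  obtain xs' ys' where 2: "\<And>n. poly_pair v w (xs' n) (ys' n)" "xs' \<longlonglongrightarrow> x'" "ys' \<longlonglongrightarrow> y'"
    using assms(2) unfolding poly_limit_def by blast
  show ?thesis
    by (rule poly_limitI[of v w "\<lambda>n. xs n + xs' n" "\<lambda>n. ys n + ys' n"])
      (intro poly_pair_plus 1 2 tendsto_add)+
qed

lemma poly_limit_scaleC:
  assumes "poly_limit v w x y" shows "poly_limit v w (c *\<^sub>C x) (c *\<^sub>C y)"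
proof -
  obtain xs ys where 1: "\<And>n. poly_pair v w (xs n) (ys n)" "xs \<longlonglongrightarrow> x" "ys \<longlonglongrightarrow> y"
    using assms unfolding poly_limit_def by blast
  show ?thesis
    by (rule poly_limitI[of v w "\<lambda>n. c *\<^sub>C xs n" "\<lambda>n. c *\<^sub>C ys n"])
      (intro poly_pair_scaleC 1 tendsto_scaleC)+
qed

lemma poly_limit_star:
  assumes "poly_limit v w x y" shows "poly_limit v w (star x) (star y)"
proof -
  obtain xs ys where 1: "\<And>n. poly_pair v w (xs n) (ys n)" "xs \<longlonglongrightarrow> x" "ys \<longlonglongrightarrow> y"
    using assms unfolding poly_limit_def by blast
  show ?thesis
    by (rule poly_limitI[of v w "\<lambda>n. star (xs n)" "\<lambda>n. star (ys n)"])
      (intro poly_pair_star 1 tendsto_star)+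
qed

lemma poly_limit_times:
  assumes v: "toeplitz_pair v" and w: "toeplitz_pair w"
    and "poly_limit v w x y" "poly_limit v w x' y'"
  shows "poly_limit v w (x * x') (y * y')"
proof -
  obtain xs ys where 1: "\<And>n. poly_pair v w (xs n) (ys n)" "xs \<longlonglongrightarrow> x" "ys \<longlonglongrightarrow> y"
    using assms(3) unfolding poly_limit_def by blast
  obtain xs' ys' where 2: "\<And>n. poly_pair v w (xs' n) (ys' n)" "xs' \<longlonglongrightarrow> x'" "ys' \<longlonglongrightarrow> y'"
    using assms(4) unfolding poly_limit_def by blast
  show ?thesis
    by (rule poly_limitI[of v w "\<lambda>n. xs n * xs' n" "\<lambda>n. ys n * ys' n"])
      (intro poly_pair_times v w 1 2 tendsto_mult)+
qed

lemma poly_limit_in: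
  assumes v: "toeplitz_pair v" and A: "cstar_subalgebra A" "range v \<subseteq> A" and xy: "poly_limit v w x y"
  shows "x \<in> A"
proof -
  obtain xs ys where 1: "\<And>n. poly_pair v w (xs n) (ys n)" "xs \<longlonglongrightarrow> x"
    using xy unfolding poly_limit_def by blast
  show ?thesis
    by (rule closed_sequentially[OF cstar_subalgebraD(6)[OF A(1)] _ 1(2)])
      (use poly_pair_in[OF v A 1(1)] in simp)
qed

lemma poly_limit_norm:
  assumes "\<And>x y. poly_pair v w x y \<Longrightarrow> norm y \<le> norm x" "poly_limit v w x y"
  shows "norm y \<le> norm x"
proof -
  obtain xs ys where 1: "\<And>n. poly_pair v w (xs n) (ys n)" "xs \<longlonglongrightarrow> x" "ys \<longlonglongrightarrow> y"
    using assms(2) unfolding poly_limit_def by blast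
  show ?thesis
    by (rule LIMSEQ_le[OF tendsto_norm[OF 1(3)] tendsto_norm[OF 1(2)]]) (use assms(1) 1(1) in blast)
qed

text \<open>The contraction turns approximants of \<open>x\<close> into a Cauchy sequence of
  values.\<close>

lemma poly_limit_exists:
  fixes v :: "gen \<Rightarrow> 'a::unital_cstar_algebra" and w :: "gen \<Rightarrow> 'b::unital_cstar_algebra"
  assumes contr: "\<And>x y. poly_pair v w x y \<Longrightarrow> norm y \<le> norm x"
    and approx: "\<And>e. e > 0 \<Longrightarrow> \<exists>x' y'. poly_pair v w x' y' \<and> norm (x' - x) < e"
  shows "\<exists>y. poly_limit v w x y"
proof -
  have "\<forall>n. \<exists>p. poly_pair v w (fst p) (snd p) \<and> norm (fst p - x) < 1 / real (Suc n)"
    using approx by fastforce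
  then obtain p where p: "\<And>n. poly_pair v w (fst (p n)) (snd (p n))" "\<And>n. norm (fst (p n) - x) < 1 / real (Suc n)"
    by metis
  define xs where "xs n = fst (p n)" for n
  define ys where "ys n = snd (p n)" for n
  have xs: "xs \<longlonglongrightarrow> x"
  proof -
    have "(\<lambda>n. norm (xs n - x)) \<longlonglongrightarrow> 0"
      by (rule tendsto_sandwich[OF _ _ tendsto_const LIMSEQ_inverse_real_of_nat])
        (use p(2) in \<open>auto simp: xs_def inverse_eq_divide intro!: always_eventually less_imp_le\<close>)
    then show ?thesis by (simp add: tendsto_norm_zero_iff LIM_zero_iff)
  qed
  have "Cauchy ys"
  proof (rule CauchyI)
    fix e :: real assume "e > 0"
    then obtain M where M: "\<forall>m\<ge>M. \<forall>n\<ge>M. norm (xs m - xs n) < e"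
      using CauchyD[OF LIMSEQ_imp_Cauchy[OF xs]] by blast
    have "norm (ys m - ys n) \<le> norm (xs m - xs n)" for m n
      unfolding xs_def ys_def by (intro contr poly_pair_diff p)
    with M show "\<exists>M. \<forall>m\<ge>M. \<forall>n\<ge>M. norm (ys m - ys n) < e" by (meson le_less_trans)
  qed
  then have "convergent ys" by (rule Cauchy_convergent)
  then obtain y where "ys \<longlonglongrightarrow> y" unfolding convergent_def by blast
  with xs p(1) show ?thesis by (intro exI[of _ y] poly_limitI[of v w xs ys]) (auto simp: xs_def ys_def)
qed

text \<open>The domain of the relation is a closed subalgebra containing the generators; a limit of
  limits of polynomials is itself approximable by polynomials, which is all that
  \<open>poly_limit_exists\<close> asks.\<close>

lemma poly_limit_total:
  fixes v :: "gen \<Rightarrow> 'a::unital_cstar_algebra" and w :: "gen \<Rightarrow> 'b::unital_cstar_algebra"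
  assumes v: "toeplitz_pair v" and w: "toeplitz_pair w"
    and contr: "\<And>x y. poly_pair v w x y \<Longrightarrow> norm y \<le> norm x"
    and x: "x \<in> cstar_generated (range v)"
  shows "\<exists>y. poly_limit v w x y"
proof -
  define A where "A = {x. \<exists>y. poly_limit v w x y}"
  have "closed A"
    unfolding closed_sequential_limits
  proof (intro allI impI, elim conjE)
    fix xs x assume xs: "\<forall>n. xs n \<in> A" "xs \<longlonglongrightarrow> x"
    show "x \<in> A"
      unfolding A_def mem_Collect_eq
    proof (rule poly_limit_exists[OF contr])
      fix e :: real assume e: "e > 0"
      then obtain n where n: "norm (xs n - x) < e / 2"
        using LIMSEQ_D[OF xs(2), of "e / 2"] by auto
      obtain xs' ys' y where 1: "\<And>m. poly_pair v w (xs' m) (ys' m)" "xs' \<longlonglongrightarrow> xs n" "ys' \<longlonglongrightarrow> y"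
        using xs(1) unfolding A_def poly_limit_def by blast
      obtain m where m: "norm (xs' m - xs n) < e / 2"
        using LIMSEQ_D[OF 1(2), of "e / 2"] e by auto
      have "norm (xs' m - x) < e"
        using norm_triangle_ineq[of "xs' m - xs n" "xs n - x"] n m by simp
      with 1(1) show "\<exists>x' y'. poly_pair v w x' y' \<and> norm (x' - x) < e" by blast
    qed
  qed
  then have "cstar_subalgebra A"
    unfolding cstar_subalgebra_def A_def
    by (auto intro: poly_limit_plus poly_limit_times v w poly_limit_star poly_limit_scaleC
        poly_limit_pair[OF poly_pair_zero])
  moreover have "range v \<subseteq> A"
    by (auto simp: A_def intro: poly_limit_pair[OF poly_pair_gen])
  ultimately show ?thesis using cstar_generated_least x unfolding A_def by blast
qed

text \<open>Contraction makes the limit relation single-valued. The last conclusion exposes the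
  graph, from which inverses, kernels and ranges are computed.\<close>

theorem toeplitz_hom:
  fixes v :: "gen \<Rightarrow> 'a::unital_cstar_algebra" and w :: "gen \<Rightarrow> 'b::unital_cstar_algebra"
  assumes v: "toeplitz_pair v" and w: "toeplitz_pair w"
    and contr: "\<And>x y. poly_pair v w x y \<Longrightarrow> norm y \<le> norm x"
  obtains f where "star_hom (cstar_generated (range v)) (cstar_generated (range w)) f"
    "\<And>i. f (v i) = w i"
    "\<And>x. x \<in> cstar_generated (range v) \<Longrightarrow> norm (f x) \<le> norm x"
    "\<And>x y. x \<in> cstar_generated (range v) \<Longrightarrow> poly_limit v w x y \<longleftrightarrow> f x = y"
proof -
  define f where "f x = (THE y. poly_limit v w x y)" for x
  note A = cstar_subalgebra_generated generators_in_cstar_generated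
  have unique: "y = z" if "poly_limit v w x y" "poly_limit v w x z" for x y z
  proof -
    have "poly_limit v w (x - x) (y - z)"
      using poly_limit_plus[OF that(1) poly_limit_scaleC[OF that(2), of "-1"]] by (simp add: scaleC_minus_one)
    from poly_limit_norm[OF contr this] show ?thesis by simp
  qed
  have lim: "poly_limit v w x y \<longleftrightarrow> f x = y" if x: "x \<in> cstar_generated (range v)" for x y
  proof -
    obtain z where z: "poly_limit v w x z" using poly_limit_total[OF v w contr x] by blast
    have "f x = z" unfolding f_def by (rule the_equality) (use z unique in blast)+
    with z unique show ?thesis by blast
  qed
  have val: "f x = y" if "poly_limit v w x y" for x y
    using lim[OF poly_limit_in[OF v A that]] that by blast
  have graph: "poly_limit v w x (f x)" if "x \<in> cstar_generated (range v)" for x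
    using lim[OF that] by blast
  show thesis
  proof (rule that)
    show "star_hom (cstar_generated (range v)) (cstar_generated (range w)) f"
      unfolding star_hom_def
      by (intro conjI ballI allI)
        (auto intro!: val poly_limit_plus poly_limit_times v w poly_limit_star poly_limit_scaleC graph
          intro: poly_limit_in[OF w A poly_limit_flip])
    show "f (v i) = w i" for i by (intro val poly_limit_pair poly_pair_gen)
    show "norm (f x) \<le> norm x" if "x \<in> cstar_generated (range v)" for x
      by (rule poly_limit_norm[OF contr graph[OF that]])
  qed (rule lim)
qed

text \<open>The maps in the two directions have transposed graphs and are therefore inverse to each
  other.\<close>

theorem toeplitz_iso:
  fixes v :: "gen \<Rightarrow> 'a::unital_cstar_algebra" and w :: "gen \<Rightarrow> 'b::unital_cstar_algebra"
  assumes v: "toeplitz_pair v" and w: "toeplitz_pair w"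
    and le: "\<And>x y. poly_pair v w x y \<Longrightarrow> norm y \<le> norm x"
    and ge: "\<And>x y. poly_pair v w x y \<Longrightarrow> norm x \<le> norm y"
  obtains f where "star_iso (cstar_generated (range v)) (cstar_generated (range w)) f"
    "\<And>i. f (v i) = w i"
    "\<And>x. x \<in> cstar_generated (range v) \<Longrightarrow> norm (f x) \<le> norm x"
proof -
  have ge': "\<And>x y. poly_pair w v x y \<Longrightarrow> norm y \<le> norm x" using ge poly_pair_flip by blast
  obtain f where f: "star_hom (cstar_generated (range v)) (cstar_generated (range w)) f"
    "\<And>i. f (v i) = w i"
    "\<And>x. x \<in> cstar_generated (range v) \<Longrightarrow> norm (f x) \<le> norm x"
    "\<And>x y. x \<in> cstar_generated (range v) \<Longrightarrow> poly_limit v w x y \<longleftrightarrow> f x = y"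
    using toeplitz_hom[OF v w le] by blast
  obtain g where g: "star_hom (cstar_generated (range w)) (cstar_generated (range v)) g"
    "\<And>i. g (w i) = v i"
    "\<And>x. x \<in> cstar_generated (range w) \<Longrightarrow> norm (g x) \<le> norm x"
    "\<And>x y. x \<in> cstar_generated (range w) \<Longrightarrow> poly_limit w v x y \<longleftrightarrow> g x = y"
    using toeplitz_hom[OF w v ge'] by blast
  have fA: "f x \<in> cstar_generated (range w)" if "x \<in> cstar_generated (range v)" for x
    using f(1) that by (auto simp: star_hom_def)
  have gA: "g x \<in> cstar_generated (range v)" if "x \<in> cstar_generated (range w)" for x
    using g(1) that by (auto simp: star_hom_def)
  have "bij_betw f (cstar_generated (range v)) (cstar_generated (range w))"
  proof (rule bij_betw_byWitness[of _ g])
    have "g (f x) = x" if "x \<in> cstar_generated (range v)" for x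
    proof -
      have "poly_limit v w x (f x)" using f(4)[OF that] by blast
      then show ?thesis using g(4)[OF fA[OF that]] poly_limit_flip by blast
    qed
    then show "\<forall>x\<in>cstar_generated (range v). g (f x) = x" by blast
    have "f (g y) = y" if "y \<in> cstar_generated (range w)" for y
    proof -
      have "poly_limit w v y (g y)" using g(4)[OF that] by blast
      then show ?thesis using f(4)[OF gA[OF that]] poly_limit_flip by blast
    qed
    then show "\<forall>y\<in>cstar_generated (range w). f (g y) = y" by blast
  qed (use fA gA in auto)
  then show thesis using f by (intro that) (auto simp: star_iso_def)
qed

text \<open>Closedness of the kernel comes from contractivity, since \<open>star_hom\<close> does
  not include continuity.\<close>

lemma closed_ideal_kernel:
  assumes A: "cstar_subalgebra A" and f: "star_hom A B f"
    and le: "\<And>x. x \<in> A \<Longrightarrow> norm (f x) \<le> norm x"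
  shows "closed_ideal {x \<in> A. f x = 0} A"
proof -
  have hom: "f (x + y) = f x + f y" "f (x * y) = f x * f y" "f (c *\<^sub>C x) = c *\<^sub>C f x"
    if "x \<in> A" "y \<in> A" for x y c using f that by (auto simp: star_hom_def)
  have "closed {x \<in> A. f x = 0}"
    unfolding closed_sequential_limits
  proof (intro allI impI, elim conjE)
    fix xs x assume xs: "\<forall>n. xs n \<in> {x \<in> A. f x = 0}" "xs \<longlonglongrightarrow> x"
    have x: "x \<in> A" by (rule closed_sequentially[OF cstar_subalgebraD(6)[OF A] _ xs(2)]) (use xs(1) in auto)
    have "norm (f x) \<le> norm (x - xs n)" for n
    proof -
      have xn: "xs n \<in> A" "f (xs n) = 0" using xs by auto
      have "f (x - xs n) = f x"
        using hom(1)[OF x cstar_subalgebraD(5)[OF A xn(1), of "- 1"]] hom(3)[OF xn(1) xn(1), of "- 1"] xn(2)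
        by (simp add: scaleC_minus_one)
      then show ?thesis using le[OF cstar_subalgebra_diff[OF A x xn(1)]] by simp
    qed
    moreover have "(\<lambda>n. norm (x - xs n)) \<longlonglongrightarrow> 0"
      using tendsto_norm[OF tendsto_diff[OF tendsto_const xs(2)], of x] by simp
    ultimately have "norm (f x) \<le> 0" by (intro LIMSEQ_le_const) auto
    with x show "x \<in> {x \<in> A. f x = 0}" by simp
  qed
  moreover have "f 0 = 0" using hom(1)[of 0 0] cstar_subalgebraD(1)[OF A] by simp
  ultimately show ?thesis
    unfolding closed_ideal_def using cstar_subalgebraD[OF A] hom by auto
qed

text \<open>Multiplying \<open>x\<close> by a tail projection leaves its image alone, because that
  projection maps to 1, and brings its norm close to \<open>tail_norm v x\<close>, which is at most
  \<open>norm y\<close>.\<close>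

lemma poly_pair_lift:
  fixes v :: "gen \<Rightarrow> 'a::unital_cstar_algebra" and w :: "gen \<Rightarrow> 'b::unital_cstar_algebra"
  assumes v: "toeplitz_pair v" and w: "toeplitz_pair w" "defect w = 0"
    and xy: "poly_pair v w x y" and c: "norm y < c"
  obtains M where "poly_pair v w (x * tailp v M) y" "norm (x * tailp v M) < c"
proof -
  obtain N where "poly_rel w v UNIV N y x" using poly_pair_flip[OF xy] by (auto simp: poly_pair_def)
  then have "tail_norm v x < c" using tail_norm_poly_le[OF w(1) v] c by (meson le_less_trans)
  then obtain M where M: "norm (x * tailp v M) < c" using tail_norm_less by blast
  have "poly_pair v w (x * tailp v M) (y * tailp w M)"
    by (intro poly_pair_times poly_pair_tailp v w xy)
  with M show thesis by (intro that) (simp_all add: tailp_eq_one[OF w(2)])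
qed

text \<open>As in the open mapping theorem, \<open>y\<close> is written as a telescoping series of
  polynomials with geometrically small terms; lifts of controlled norm can then be summed.\<close>

lemma poly_limit_surj:
  fixes v :: "gen \<Rightarrow> 'a::unital_cstar_algebra" and w :: "gen \<Rightarrow> 'b::unital_cstar_algebra"
  assumes v: "toeplitz_pair v" and w: "toeplitz_pair w" "defect w = 0"
    and y: "y \<in> cstar_generated (range w)"
  shows "\<exists>x. poly_limit v w x y"
proof -
  \<comment> \<open>Relating \<open>w\<close> to itself only extracts polynomials converging to
    \<open>y\<close>.\<close>
  have contr: "norm x \<le> norm x'" if "poly_pair w w x' x" for x x' :: 'b
    using that norm_poly_le_if_no_defect[OF w(1) w(1,2)] by (auto simp: poly_pair_def)
  obtain y' where "poly_limit w w y y'" using poly_limit_total[OF w(1) w(1) contr y] by blast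
  then obtain zs ys where "\<And>n. poly_pair w w (zs n) (ys n)" and zs: "zs \<longlonglongrightarrow> y"
    by (auto simp: poly_limit_def)
  then have zpair: "\<exists>x. poly_pair v w x (zs n)" for n
    unfolding poly_pair_def using poly_rel_total by (metis poly_rel_flip)
  have "\<forall>n. \<exists>m. norm (zs m - y) < (1/2) ^ n" 
    using LIMSEQ_D[OF zs] by (metis half_gt_zero_iff order_refl zero_less_one zero_less_power)
  then obtain m where m: "\<And>n. norm (zs (m n) - y) < (1/2) ^ n" by metis
  define t where "t n = (case n of 0 \<Rightarrow> zs (m 0) | Suc k \<Rightarrow> zs (m (Suc k)) - zs (m k))" for n
  have sum_t: "(\<Sum>k<Suc n. t k) = zs (m n)" for n
    by (induction n) (simp_all add: t_def)
  \<comment> \<open>The term \<open>t 0\<close> need not be small and is lifted without a bound. For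
    \<open>n = Suc k\<close> the two errors sum to less than \<open>3 * (1/2) ^ n\<close>.\<close>
  have "\<exists>x. poly_pair v w x (t n) \<and> (n > 0 \<longrightarrow> norm x < 4 * (1/2) ^ n)" for n
  proof -
    obtain x where x: "poly_pair v w x (t n)"
      using zpair poly_pair_diff unfolding t_def by (cases n) (simp, blast)+
    show ?thesis
    proof (cases n)
      case (Suc k)
      have "norm (t n) \<le> norm (zs (m (Suc k)) - y) + norm (zs (m k) - y)"
        using norm_triangle_ineq4[of "zs (m (Suc k)) - y" "zs (m k) - y"] by (simp add: t_def Suc)
      also have "\<dots> < (1/2) ^ Suc k + (1/2) ^ k" by (intro add_strict_mono m)
      also have "\<dots> \<le> 4 * (1/2) ^ n" by (simp add: Suc)
      finally show ?thesis using poly_pair_lift[OF v w x] by blast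
    qed (use x in auto)
  qed
  then obtain x where x: "\<And>n. poly_pair v w (x n) (t n)" "\<And>n. n > 0 \<Longrightarrow> norm (x n) < 4 * (1/2) ^ n"
    by metis
  have "summable x"
  proof (rule summable_comparison_test)
    show "\<exists>N. \<forall>n\<ge>N. norm (x n) \<le> 4 * (1/2) ^ n" using x(2) by (intro exI[of _ 1]) (auto intro: less_imp_le)
    show "summable (\<lambda>n. 4 * (1/2 :: real) ^ n)" by (intro summable_mult summable_geometric) auto
  qed
  then have "(\<lambda>n. \<Sum>k<n. x k) \<longlonglongrightarrow> suminf x" by (rule summable_LIMSEQ)
  then have X: "(\<lambda>n. \<Sum>k<Suc n. x k) \<longlonglongrightarrow> suminf x" by (rule LIMSEQ_Suc)
  have "(\<lambda>n. zs (m n)) \<longlonglongrightarrow> y"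
  proof -
    have "(\<lambda>n. norm (zs (m n) - y)) \<longlonglongrightarrow> 0"
      by (rule tendsto_sandwich[OF _ _ tendsto_const LIMSEQ_realpow_zero[of "1/2"]])
        (use m in \<open>auto intro!: always_eventually less_imp_le\<close>)
    then show ?thesis by (simp add: tendsto_norm_zero_iff LIM_zero_iff)
  qed
  then have "poly_limit v w (suminf x) y"
    using X unfolding sum_t[symmetric]
    by (intro poly_limitI[of v w "\<lambda>n. \<Sum>k<Suc n. x k" "\<lambda>n. \<Sum>k<Suc n. t k"] poly_pair_sum x(1))
  then show ?thesis by blast
qed

text \<open>The complement of a tail projection is a finite sum of levels, and each level arises
  from the defect by multiplying with generators and adjoints inside \<open>J\<close>.\<close>

lemma one_minus_tailp_in:
  assumes v: "toeplitz_pair v" and A: "range v \<subseteq> A" "cstar_subalgebra A"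
    and J: "closed_ideal J A" "defect v \<in> J"
  shows "1 - tailp v M \<in> J"
proof -
  have "level v k \<in> J" for k
  proof (induction k)
    case (Suc k)
    have "v i * level v k * star (v i) \<in> J" for i
      using A(1) by (intro closed_idealD(5,6)[OF J(1)] Suc cstar_subalgebraD(4)[OF A(2)]) auto
    then show ?case by (auto simp: level_def shift_def intro: closed_idealD(3)[OF J(1)])
  qed (simp add: level_def J)
  then have "(\<Sum>k<M. level v k) \<in> J"
    by (induction M) (auto intro: closed_idealD(2,3)[OF J(1)])
  then show ?thesis using sum_level[of v M] by (metis add_diff_cancel_right')
qed

text \<open>The images of the approximants tend to 0, so suitable tails
  \<open>xs n * tailp v (M n)\<close> do as well, and what remains of \<open>xs n\<close> lies in
  the ideal.\<close>

lemma poly_limit_zero_in: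
  fixes v :: "gen \<Rightarrow> 'a::unital_cstar_algebra" and w :: "gen \<Rightarrow> 'b::unital_cstar_algebra"
  assumes v: "toeplitz_pair v" and w: "toeplitz_pair w" "defect w = 0"
    and A: "range v \<subseteq> A" "cstar_subalgebra A"
    and J: "closed_ideal J A" "defect v \<in> J" and x: "poly_limit v w x 0"
  shows "x \<in> J"
proof -
  obtain xs ys where 1: "\<And>n. poly_pair v w (xs n) (ys n)" "xs \<longlonglongrightarrow> x" "ys \<longlonglongrightarrow> 0"
    using x unfolding poly_limit_def by blast
  \<comment> \<open>The term \<open>(1/2) ^ n\<close> supplies the strict inequality that
    \<open>poly_pair_lift\<close> asks for.\<close>
  have "\<exists>M. norm (xs n * tailp v M) < norm (ys n) + (1/2) ^ n" for n
    by (rule poly_pair_lift[OF v w 1(1)[of n], of "norm (ys n) + (1/2) ^ n"]) auto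
  then obtain M where M: "\<And>n. norm (xs n * tailp v (M n)) < norm (ys n) + (1/2) ^ n" by metis
  have lim: "(\<lambda>n. norm (ys n) + (1/2) ^ n) \<longlonglongrightarrow> 0 + 0"
    using tendsto_norm[OF 1(3)] by (intro tendsto_add LIMSEQ_realpow_zero) auto
  have "(\<lambda>n. norm (xs n * tailp v (M n))) \<longlonglongrightarrow> 0"
    by (rule tendsto_sandwich[OF _ _ tendsto_const lim[simplified]])
      (use M in \<open>auto intro!: always_eventually less_imp_le\<close>)
  then have "(\<lambda>n. xs n - xs n * tailp v (M n)) \<longlonglongrightarrow> x - 0"
    by (intro tendsto_diff 1(2)) (simp add: tendsto_norm_zero_iff)
  moreover have "xs n - xs n * tailp v (M n) \<in> J" for n
  proof -
    have "xs n * (1 - tailp v (M n)) \<in> J"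
      by (intro closed_idealD(6)[OF J(1)] one_minus_tailp_in[OF v A J] poly_pair_in[OF v A(2,1) 1(1)])
    then show ?thesis by (simp add: right_diff_distrib)
  qed
  ultimately show ?thesis
    using closed_sequentially[OF closed_idealD(7)[OF J(1)], of "\<lambda>n. xs n - xs n * tailp v (M n)" "x - 0"] by simp
qed

text \<open>Both rows of the diagram are instances: the Cuntz isometries on one side, the
  translations on X and on Y on the other.\<close>

theorem toeplitz_extension:
  fixes v :: "gen \<Rightarrow> 'a::unital_cstar_algebra" and w :: "gen \<Rightarrow> 'b::unital_cstar_algebra"
  assumes v: "toeplitz_pair v" and w: "toeplitz_pair w" "defect w = 0"
  obtains f where
    "cstar_extension (ideal_generated (cstar_generated (range v)) {defect v})
      (cstar_generated (range v)) (cstar_generated (range w)) f"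
    "\<And>i. f (v i) = w i"
    "\<And>x. x \<in> cstar_generated (range v) \<Longrightarrow> norm (f x) \<le> norm x"
proof -
  let ?A = "cstar_generated (range v)" and ?B = "cstar_generated (range w)"
  let ?J = "ideal_generated ?A {defect v}"
  note A = generators_in_cstar_generated[of "range v"] cstar_subalgebra_generated[of "range v"]
  have contr: "norm y \<le> norm x" if "poly_pair v w x y" for x y
    using that norm_poly_le_if_no_defect[OF v w] by (auto simp: poly_pair_def)
  obtain f where f: "star_hom ?A ?B f" "\<And>i. f (v i) = w i" "\<And>x. x \<in> ?A \<Longrightarrow> norm (f x) \<le> norm x"
    "\<And>x y. x \<in> ?A \<Longrightarrow> poly_limit v w x y \<longleftrightarrow> f x = y"
    using toeplitz_hom[OF v w(1) contr] by blast
  have val: "x \<in> ?A" "f x = y" if "poly_limit v w x y" for x y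
    using f(4) poly_limit_in[OF v A(2,1) that] that by auto
  have defect: "poly_pair v w (defect v) (defect w)"
    using poly_pair_diff[OF poly_pair_one poly_pair_tailp[OF v w(1), of 1]]
    by (simp add: defect_def tailp_def)
  then have Q: "defect v \<in> ?A" "f (defect v) = 0"
    using val[OF poly_limit_pair] w(2) by auto
  have J: "closed_ideal ?J ?A" "defect v \<in> ?J"
    using closed_ideal_generated[OF A(2)] generators_in_ideal_generated[of "{defect v}"] Q(1) by auto
  have "?J \<subseteq> {x \<in> ?A. f x = 0}"
    by (rule ideal_generated_least[OF closed_ideal_kernel[OF A(2) f(1,3)]]) (use Q in auto)
  moreover have "{x \<in> ?A. f x = 0} \<subseteq> ?J"
    using poly_limit_zero_in[OF v w A J] f(4) by blast
  moreover have "f ` ?A = ?B"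
  proof
    show "f ` ?A \<subseteq> ?B" using f(1) by (auto simp: star_hom_def)
    show "?B \<subseteq> f ` ?A" using poly_limit_surj[OF v w] val by blast
  qed
  ultimately have "cstar_extension ?J ?A ?B f"
    unfolding cstar_extension_def by (intro conjI f(1) J(1) cstar_subalgebra_generated antisym) simp_all
  with f(2,3) show thesis by (intro that)
qed

section \<open>Partial translations on subsets of the free group\<close>

definition gen_of :: "gen \<Rightarrow> F2"
  where "gen_of i = (case i of Gen_a \<Rightarrow> gen_a | Gen_b \<Rightarrow> gen_b)"

abbreviation pos :: "gen \<Rightarrow> letter" where "pos i \<equiv> (i, True)"

lemma Rep_gen_of [simp]: "Rep_F2 (gen_of i) = [pos i]"
  by (cases i) (simp_all add: gen_of_def gen_a.rep_eq gen_b.rep_eq)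

lemma Rep_letter [simp]: "Rep_F2 (Abs_F2 [l]) = [l]"
  by (simp add: Abs_F2_inverse)

lemma reduced_Rep [simp]: "reduced (Rep_F2 x)"
  using Rep_F2[of x] by simp

lemma Rep_times_append:
  assumes "reduced (Rep_F2 x @ Rep_F2 y)" shows "Rep_F2 (x * y) = Rep_F2 x @ Rep_F2 y"
  using foldr_lmult_Nil[OF assms] foldr_lmult_Nil[of "Rep_F2 y"] by (simp add: times_F2.rep_eq)

lemma Rep_times_letter:
  "Rep_F2 (x * Abs_F2 [l]) =
    (if Rep_F2 x \<noteq> [] \<and> last (Rep_F2 x) = inv_letter l then butlast (Rep_F2 x) else Rep_F2 x @ [l])"
proof (cases "Rep_F2 x \<noteq> [] \<and> last (Rep_F2 x) = inv_letter l")
  case True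
  then have u: "Rep_F2 x = butlast (Rep_F2 x) @ [inv_letter l]" by (metis append_butlast_last_id)
  then have "reduced (butlast (Rep_F2 x))" by (metis reduced_Rep reduced_snoc)
  moreover have "Rep_F2 (x * Abs_F2 [l]) = foldr lmult (butlast (Rep_F2 x)) (lmult (inv_letter l) [l])"
    by (subst times_F2.rep_eq, subst u) simp
  ultimately show ?thesis using True by (simp add: lmult_def foldr_lmult_Nil)
next
  case False
  then have "reduced (Rep_F2 x @ [l])" by (auto simp: reduced_snoc)
  with False show ?thesis using Rep_times_append[of x "Abs_F2 [l]"] by auto
qed

lemma gen_of_eq: "gen_of i = Abs_F2 [pos i]"
  by (metis Rep_F2_inverse Rep_gen_of)

lemma inverse_gen_of: "inverse (gen_of i) = Abs_F2 [(i, False)]"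
  by (rule Rep_F2_inject[THEN iffD1]) (simp add: inverse_F2.rep_eq inv_letter_def)

lemma reduced_append_letter: "reduced (u @ [l]) \<Longrightarrow> reduced (l # w) \<Longrightarrow> reduced (u @ l # w)"
proof (induction u)
  case (Cons x u)
  then show ?case by (cases u) auto
qed simp

lemma word_value: "x = prod_list (map (\<lambda>l. Abs_F2 [l]) (Rep_F2 x))"
proof -
  have "Rep_F2 (prod_list (map (\<lambda>l. Abs_F2 [l]) w)) = foldr lmult w []" for w
    by (induction w) (simp_all add: one_F2.rep_eq times_F2.rep_eq)
  then show ?thesis by (metis Rep_F2_inject foldr_lmult_Nil reduced_Rep)
qed

lemma reduced_map_pos: "reduced (map pos gs)"
proof (induction gs)
  case (Cons i gs)
  then show ?case by (cases gs) (auto simp: inv_letter_def)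
qed simp

lemma Rep_wprod: "Rep_F2 (wprod gen_of gs) = map pos gs"
proof (induction gs)
  case (Cons i gs)
  then show ?case using Rep_times_append[of "gen_of i" "wprod gen_of gs"] reduced_map_pos[of "i # gs"] by simp
qed (simp add: one_F2.rep_eq)

lemma positive_words_eq: "positive_words = range (wprod gen_of)"
proof -
  have "\<exists>gs. ws = map gen_of gs" if "set ws \<subseteq> {gen_a, gen_b}" for ws
    using that
  proof (induction ws)
    case (Cons w ws)
    then obtain gs where "ws = map gen_of gs" by auto
    moreover have "w = gen_of Gen_a \<or> w = gen_of Gen_b" using Cons.prems by (auto simp: gen_of_def)
    ultimately show ?case by (metis list.simps(9))
  qed simp
  moreover have "set (map gen_of gs) \<subseteq> {gen_a, gen_b}" for gs
    by (auto simp: gen_of_def split: gen.splits)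
  ultimately show ?thesis unfolding positive_words_def wprod_def by blast
qed

lemma mem_positive_words: "x \<in> positive_words \<longleftrightarrow> (\<exists>gs. Rep_F2 x = map pos gs)"
proof -
  have "x = wprod gen_of gs \<longleftrightarrow> Rep_F2 x = map pos gs" for gs
    unfolding Rep_wprod[symmetric] Rep_F2_inject by (rule refl)
  then show ?thesis unfolding positive_words_eq image_iff by blast
qed

abbreviation neg_a :: letter where "neg_a \<equiv> (Gen_a, False)"

text \<open>Nonnegative powers of a are absorbed into the positive word. Negative ones are applied a
  letter at a time: the inverse of a either cancels a leading a or lengthens the initial run of
  inverses.\<close>

lemma mem_Y_set: "x \<in> Y_set \<longleftrightarrow> (\<exists>k gs. Rep_F2 x = replicate k neg_a @ map pos gs)"
proof
  define form where "form x \<longleftrightarrow> (\<exists>k gs. Rep_F2 x = replicate k neg_a @ map pos gs)" for x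
  have step: "form (inverse gen_a * x)" if "form x" for x
  proof -
    from that obtain k gs where kgs: "Rep_F2 x = replicate k neg_a @ map pos gs" by (auto simp: form_def)
    have R: "Rep_F2 (inverse gen_a * x) = lmult neg_a (Rep_F2 x)"
      using inverse_gen_of[of Gen_a] by (simp add: times_F2.rep_eq gen_of_def)
    show ?thesis
    proof (cases "k = 0 \<and> gs \<noteq> [] \<and> hd gs = Gen_a")
      case True
      then have "Rep_F2 (inverse gen_a * x) = replicate 0 neg_a @ map pos (tl gs)"
        by (cases gs) (simp_all add: R kgs lmult_def inv_letter_def)
      then show ?thesis unfolding form_def by blast
    next
      case False
      then have "Rep_F2 (inverse gen_a * x) = replicate (Suc k) neg_a @ map pos gs"
        by (cases k; cases gs) (auto simp: R kgs lmult_def inv_letter_def)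
      then show ?thesis unfolding form_def by blast
    qed
  qed
  have powers: "form (inverse gen_a ^ k * x)" if "form x" for k x
    by (induction k) (simp_all add: that step mult.assoc)
  assume "x \<in> Y_set"
  then obtain n w where x: "x = gen_a powi n * w" and w: "w \<in> positive_words" by (auto simp: Y_set_def)
  obtain gs where gs: "w = wprod gen_of gs" using w by (auto simp: positive_words_eq)
  show "\<exists>k gs. Rep_F2 x = replicate k neg_a @ map pos gs"
  proof (cases "n \<ge> 0")
    case True
    have "gen_a ^ k * w = wprod gen_of (replicate k Gen_a @ gs)" for k
      by (induction k) (simp_all add: gs mult.assoc gen_of_def[of Gen_a])
    from this[of "nat n"] have "x = wprod gen_of (replicate (nat n) Gen_a @ gs)"
      using True by (simp add: x power_int_def)
    then have "Rep_F2 x = replicate 0 neg_a @ map pos (replicate (nat n) Gen_a @ gs)"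
      unfolding Rep_wprod[symmetric] by simp
    then show ?thesis by blast
  next
    case False
    have "Rep_F2 w = replicate 0 neg_a @ map pos gs" by (simp add: gs Rep_wprod)
    then have "form w" unfolding form_def by blast
    from powers[OF this, of "nat (- n)"] False show ?thesis by (simp add: x power_int_def form_def)
  qed
next
  assume "\<exists>k gs. Rep_F2 x = replicate k neg_a @ map pos gs"
  then obtain k gs where "Rep_F2 x = replicate k neg_a @ map pos gs" by blast
  then have x: "x = Abs_F2 [neg_a] ^ k * wprod gen_of gs"
    by (subst word_value) (simp add: wprod_def gen_of_eq[symmetric] o_def prod_list_replicate)
  have "Abs_F2 [neg_a] = inverse gen_a"
    using inverse_gen_of[of Gen_a] by (simp add: gen_of_def)
  then have "Abs_F2 [neg_a] ^ k = gen_a powi (- int k)" by (cases "k = 0") (simp_all add: power_int_def)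
  with x show "x \<in> Y_set" unfolding Y_set_def positive_words_eq by auto
qed

lemma positive_words_subset_Y_set: "positive_words \<subseteq> Y_set"
proof
  fix x assume "x \<in> positive_words"
  then obtain gs where "Rep_F2 x = replicate 0 neg_a @ map pos gs" by (auto simp: mem_positive_words)
  then show "x \<in> Y_set" unfolding mem_Y_set by blast
qed

section \<open>Prefixes, successors and predecessors in X and Y\<close>

lemma positive_words_prefix:
  assumes "x \<in> positive_words" "Rep_F2 x = p @ s"
  shows "\<exists>y\<in>positive_words. Rep_F2 y = p"
proof -
  obtain gs where "p @ s = map pos gs" using assms by (auto simp: mem_positive_words)
  then have "Rep_F2 (wprod gen_of (take (length p) gs)) = p"
    by (metis Rep_wprod append_eq_conv_conj take_map)
  then show ?thesis unfolding positive_words_eq by blast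
qed

lemma Y_set_prefix:
  assumes "x \<in> Y_set" "Rep_F2 x = p @ s"
  shows "\<exists>y\<in>Y_set. Rep_F2 y = p"
proof -
  obtain k gs where kgs: "Rep_F2 x = replicate k neg_a @ map pos gs" using assms by (auto simp: mem_Y_set)
  have "reduced p" if "reduced (p @ s)" for p s
    using that by (induction p rule: reduced.induct) auto
  then have p: "Rep_F2 (Abs_F2 p) = p" using assms(2) by (metis Abs_F2_inverse mem_Collect_eq reduced_Rep)
  have "take n (replicate k neg_a @ map pos gs) = replicate (min n k) neg_a @ map pos (take (n - k) gs)" for n
    by (simp add: take_map)
  moreover have "p = take (length p) (replicate k neg_a @ map pos gs)"
    unfolding kgs[symmetric] assms(2) by simp
  ultimately have "Rep_F2 (Abs_F2 p) = replicate (min (length p) k) neg_a @ map pos (take (length p - k) gs)"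
    unfolding p by (rule trans[rotated])
  then have "Abs_F2 p \<in> Y_set" unfolding mem_Y_set by blast
  with p show ?thesis by blast
qed

text \<open>A positive letter cancels only against a final inverse, and an element of Y ends in an
  inverse only when it is a pure negative power of a.\<close>

lemma Y_set_times_gen:
  assumes "x \<in> Y_set"
  shows "Rep_F2 (x * gen_of i) = Rep_F2 x @ [pos i] \<or> i = Gen_a \<and> (\<exists>k. Rep_F2 (x * gen_of i) = replicate k neg_a)"
proof (cases "Rep_F2 x \<noteq> [] \<and> last (Rep_F2 x) = inv_letter (pos i)")
  case True
  obtain k gs where kgs: "Rep_F2 x = replicate k neg_a @ map pos gs" using assms by (auto simp: mem_Y_set)
  have "gs = []"
  proof (rule ccontr)
    assume "gs \<noteq> []"
    then show False using True by (simp add: kgs last_map inv_letter_def)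
  qed
  moreover have "butlast (replicate k neg_a) = replicate (k - 1) neg_a"
    by (simp add: butlast_conv_take)
  ultimately have "Rep_F2 (x * gen_of i) = replicate (k - 1) neg_a"
    using True kgs by (simp add: gen_of_eq Rep_times_letter)
  moreover have "i = Gen_a"
    using True kgs \<open>gs = []\<close> by (cases "k = 0") (simp_all add: inv_letter_def)
  ultimately show ?thesis by blast
next
  case False
  then have "Rep_F2 (x * gen_of i) = Rep_F2 x @ [pos i]" unfolding gen_of_eq Rep_times_letter by (rule if_not_P)
  then show ?thesis by (rule disjI1)
qed

text \<open>A product ending in a positive letter reveals its last factor; otherwise it is a power
  of the inverse of a, and only a can have led there. For the translations this means orthogonal
  ranges.\<close>

lemma Y_set_times_gen_inject:
  assumes "x \<in> Y_set" "y \<in> Y_set" "x * gen_of i = y * gen_of j" shows "i = j"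
proof -
  have "replicate k neg_a \<noteq> u @ [pos i]" for k u i
  proof
    assume "replicate k neg_a = u @ [pos i]"
    then have "pos i \<in> set (replicate k neg_a)" by simp
    then show False by simp
  qed
  then show ?thesis
    using Y_set_times_gen[OF assms(1), of i] Y_set_times_gen[OF assms(2), of j] unfolding assms(3)
    by (elim disjE conjE exE) auto
qed

lemma positive_words_times_gen: "x \<in> positive_words \<Longrightarrow> x * gen_of i \<in> positive_words"
proof -
  assume "x \<in> positive_words"
  then obtain gs where "x = wprod gen_of gs" by (auto simp: positive_words_eq)
  then have "x * gen_of i = wprod gen_of (gs @ [i])" by (simp add: wprod_append)
  then show ?thesis by (simp add: positive_words_eq)
qed

lemma positive_words_cases:
  assumes "x \<in> positive_words" obtains "x = 1" | y i where "y \<in> positive_words" "x = y * gen_of i"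
proof -
  obtain gs where gs: "x = wprod gen_of gs" using assms by (auto simp: positive_words_eq)
  show thesis
  proof (cases gs rule: rev_cases)
    case (snoc hs i)
    then have "x = wprod gen_of hs * gen_of i" by (simp add: gs wprod_append)
    then show thesis by (intro that(2)[of "wprod gen_of hs" i]) (auto simp: positive_words_eq)
  qed (use gs in \<open>auto intro: that(1)\<close>)
qed

lemma positive_times_gen_neq_1: "x \<in> positive_words \<Longrightarrow> x * gen_of i \<noteq> 1"
proof
  assume "x \<in> positive_words" "x * gen_of i = 1"
  then obtain gs where gs: "x = wprod gen_of gs" by (auto simp: positive_words_eq)
  have "Rep_F2 (x * gen_of i) = map pos (gs @ [i])"
    unfolding Rep_wprod[symmetric] by (simp add: gs wprod_append)
  with \<open>x * gen_of i = 1\<close> show False by (simp add: one_F2.rep_eq)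
qed

lemma Y_set_times_gen_mem: "x \<in> Y_set \<Longrightarrow> x * gen_of i \<in> Y_set"
proof -
  assume "x \<in> Y_set"
  then obtain n w where x: "x = gen_a powi n * w" "w \<in> positive_words" by (auto simp: Y_set_def)
  then have "x * gen_of i = gen_a powi n * (w * gen_of i)" by (simp add: mult.assoc)
  with positive_words_times_gen[OF x(2)] show ?thesis unfolding Y_set_def by blast
qed

text \<open>This separates Y from X: even a power of a, the identity included, has a predecessor, so
  no basis vector is left for the defect.\<close>

lemma Y_set_cases:
  assumes "x \<in> Y_set" obtains y i where "y \<in> Y_set" "x = y * gen_of i"
proof -
  obtain n w where x: "x = gen_a powi n * w" and w: "w \<in> positive_words" using assms by (auto simp: Y_set_def)
  from w show thesis
  proof (cases rule: positive_words_cases)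
    case 1
    have "gen_a powi n = gen_a powi (n - 1) * gen_a"
    proof (cases "n > 0")
      case True
      then have "nat n = Suc (nat (n - 1))" by simp
      with True show ?thesis by (simp add: power_int_def power_Suc2 del: power_Suc)
    next
      case False
      then have "nat (- (n - 1)) = Suc (nat (- n))" by simp
      then have "gen_a powi (n - 1) * gen_a = inverse gen_a ^ nat (- n) * (inverse gen_a * gen_a)"
        using False by (simp add: power_int_def power_Suc2 mult.assoc del: power_Suc)
      also have "\<dots> = gen_a powi n" using False by (cases "n = 0") (auto simp: F2_left_inverse power_int_def)
      finally show ?thesis by simp
    qed
    moreover have "gen_a powi (n - 1) * 1 \<in> Y_set" using one_in_positive_words unfolding Y_set_def by blast
    ultimately show thesis using x 1 by (intro that[of "gen_a powi (n - 1)" Gen_a]) (simp_all add: gen_of_def)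
  next
    case (2 y i)
    then have "gen_a powi n * y \<in> Y_set" by (auto simp: Y_set_def)
    then show thesis using x 2 by (intro that[of "gen_a powi n * y" i]) (simp_all add: mult.assoc)
  qed
qed

section \<open>Partial translations as operators\<close>

lemma bop_eqI_ket:
  assumes "\<And>z. bop_apply S (ket z) = bop_apply T (ket z)" shows "S = T"
proof (rule bop_eqI)
  fix f
  have "((\<lambda>x. bop_apply R (Rep_ell2 f x *\<^sub>C ket x)) has_sum bop_apply R f) UNIV" for R :: "'a bop"
    by (rule has_sum_bounded_linear[OF bounded_linear_bop has_sum_ket, unfolded o_def])
  then have sum: "((\<lambda>x. Rep_ell2 f x *\<^sub>C bop_apply R (ket x)) has_sum bop_apply R f) UNIV" for R
    by (simp only: bop_apply_scaleC)
  from sum[of S] sum[of T] show "bop_apply S f = bop_apply T f"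
    unfolding assms by (rule has_sum_unique)
qed

lemma ell2_eqI: "(\<And>y. Rep_ell2 f y = Rep_ell2 g y) \<Longrightarrow> f = g"
  by (rule Rep_ell2_inject[THEN iffD1], rule ext)

lemma Rep_partial_translation_ket:
  "Rep_ell2 (bop_apply (partial_translation g) (ket z)) y = (if incl z * g = incl y then 1 else 0)"
  for z y :: "'z::F2_subset"
proof (cases "\<exists>z'::'z. incl z * g = incl z'")
  case True
  then obtain z' :: 'z where z': "incl z * g = incl z'" by blast
  then show ?thesis by (auto simp: partial_translation_ket[OF z'] ket.rep_eq incl_inject)
next
  case False
  then show ?thesis by (subst partial_translation_ket_0) (auto simp: zero_ell2.rep_eq)
qed

lemma Rep_star_ket: "Rep_ell2 (bop_apply (star T) (ket y)) x = cnj (Rep_ell2 (bop_apply T (ket x)) y)"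
  by (metis cinner_commute cinner_ket_left cinner_star)

lemma star_partial_translation:
  "star (partial_translation g :: 'z::F2_subset bop) = partial_translation (inverse g)"
proof (intro bop_eqI_ket ell2_eqI)
  fix z y :: 'z
  have "incl y * g = incl z \<longleftrightarrow> incl z * inverse g = incl y"
    by (metis F2_left_inverse F2_right_inverse mult.assoc mult.right_neutral)
  then show "Rep_ell2 (bop_apply (star (partial_translation g)) (ket z)) y =
      Rep_ell2 (bop_apply (partial_translation (inverse g)) (ket z)) y"
    by (simp add: Rep_star_ket Rep_partial_translation_ket)
qed

lemma partial_translation_one: "partial_translation 1 = 1"
  by (intro bop_eqI_ket) (simp add: partial_translation_ket bop_apply_one)

lemma bop_diff_apply: "bop_apply (S - T) f = bop_apply S f - bop_apply T f"
  by transfer (rule blinfun.diff_left)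

lemma bop_zero_apply: "bop_apply 0 f = 0"
  by transfer simp

lemma bop_apply_zero_right: "bop_apply T 0 = 0"
  by (rule linear_0) (rule bounded_linear.linear[OF bounded_linear_bop])

text \<open>Translations act on the right, so factors appear in reverse order. The hypothesis
  excludes paths that leave the set midway, where the product would vanish although the translation
  does not.\<close>

lemma partial_translation_mult:
  assumes "\<And>(z::'z) (z'::'z). incl z * g * h = incl z' \<Longrightarrow> \<exists>z''::'z. incl z * g = incl z''"
  shows "partial_translation h * partial_translation g = (partial_translation (g * h) :: 'z::F2_subset bop)"
proof (intro bop_eqI_ket ell2_eqI)
  fix z y :: 'z
  show "Rep_ell2 (bop_apply (partial_translation h * partial_translation g) (ket z)) y =
      Rep_ell2 (bop_apply (partial_translation (g * h)) (ket z)) y"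
  proof (cases "\<exists>z'::'z. incl z * g = incl z'")
    case True
    then obtain z' :: 'z where z': "incl z * g = incl z'" by blast
    then show ?thesis
      by (simp add: bop_apply_times partial_translation_ket[OF z'] Rep_partial_translation_ket mult.assoc[symmetric])
  next
    case False
    then have "incl z * (g * h) \<noteq> incl y" using assms[of z y] by (auto simp: mult.assoc)
    moreover have "bop_apply (partial_translation g) (ket z) = 0"
      by (rule partial_translation_ket_0) (use False in blast)
    ultimately show ?thesis
      by (simp add: bop_apply_times Rep_partial_translation_ket bop_apply_zero_right zero_ell2.rep_eq)
  qed
qed

definition pt_gen :: "gen \<Rightarrow> 'z::F2_subset bop"
  where "pt_gen i = partial_translation (gen_of i)"

text \<open>\<open>mem\<close> keeps every step inside the set, which gives isometries;
  \<open>inj\<close> lets at most one generator lead into a point, which gives orthogonal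
  ranges.\<close>

lemma toeplitz_pt_gen:
  assumes mem: "\<And>(z::'z) i. \<exists>z'::'z. incl z * gen_of i = incl z'"
    and inj: "\<And>(z::'z) (z'::'z) i j. incl z * gen_of i = incl z' * gen_of j \<Longrightarrow> i = j"
  shows "toeplitz_pair (pt_gen :: gen \<Rightarrow> 'z::F2_subset bop)"
  unfolding toeplitz_pair_def
proof (intro allI)
  fix i j
  have m: "star (pt_gen i) * pt_gen j = (partial_translation (gen_of j * inverse (gen_of i)) :: 'z bop)"
    unfolding pt_gen_def star_partial_translation by (rule partial_translation_mult) (use mem in blast)
  show "star (pt_gen i) * pt_gen j = (if i = j then 1 else (0 :: 'z bop))"
  proof (cases "i = j")
    case True
    with m show ?thesis by (simp add: F2_right_inverse partial_translation_one)
  next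
    case False
    have "bop_apply (partial_translation (gen_of j * inverse (gen_of i))) (ket z) = 0" for z :: 'z
    proof (rule partial_translation_ket_0)
      fix z' :: 'z
      show "incl z * (gen_of j * inverse (gen_of i)) \<noteq> incl z'"
      proof
        assume "incl z * (gen_of j * inverse (gen_of i)) = incl z'"
        then have "incl z * gen_of j = incl z' * gen_of i"
          by (metis F2_left_inverse mult.assoc mult.right_neutral)
        with inj False show False by blast
      qed
    qed
    then have "partial_translation (gen_of j * inverse (gen_of i)) = (0 :: 'z bop)"
      by (intro bop_eqI_ket) (simp add: bop_zero_apply)
    with False m show ?thesis by simp
  qed
qed

text \<open>\<open>pt_gen i * star (pt_gen i)\<close> projects onto the points reached by the
  generator \<open>i\<close>, and \<open>inj\<close> keeps these two sets disjoint.\<close>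

lemma defect_pt_gen_ket:
  assumes inj: "\<And>(z::'z) (z'::'z) i j. incl z * gen_of i = incl z' * gen_of j \<Longrightarrow> i = j"
  shows "bop_apply (defect pt_gen) (ket z) =
    (if \<exists>(z'::'z) i. incl z = incl z' * gen_of i then 0 else ket (z::'z::F2_subset))"
proof -
  have *: "bop_apply (pt_gen i * star (pt_gen i)) (ket z) =
      (if \<exists>z'::'z. incl z = incl z' * gen_of i then ket z else 0)" for i
  proof (cases "\<exists>z'::'z. incl z = incl z' * gen_of i")
    case True
    then obtain z' :: 'z where z': "incl z = incl z' * gen_of i" by blast
    then have "incl z * inverse (gen_of i) = incl z'"
      by (simp add: mult.assoc F2_right_inverse)
    from partial_translation_ket[OF this] partial_translation_ket[OF z'[symmetric]] True show ?thesis
      by (simp add: pt_gen_def star_partial_translation bop_apply_times)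
  next
    case False
    have "incl z * inverse (gen_of i) \<noteq> incl z'" for z' :: 'z
    proof
      assume "incl z * inverse (gen_of i) = incl z'"
      then have "incl z = incl z' * gen_of i" by (metis F2_left_inverse mult.assoc mult.right_neutral)
      with False show False by blast
    qed
    from partial_translation_ket_0[OF this] False show ?thesis
      by (simp add: pt_gen_def star_partial_translation bop_apply_times bop_apply_zero_right)
  qed
  consider (none) "\<nexists>(z'::'z) i. incl z = incl z' * gen_of i"
    | (a) "\<exists>z'::'z. incl z = incl z' * gen_of Gen_a" "\<nexists>z'::'z. incl z = incl z' * gen_of Gen_b"
    | (b) "\<exists>z'::'z. incl z = incl z' * gen_of Gen_b" "\<nexists>z'::'z. incl z = incl z' * gen_of Gen_a"
    using inj by (metis gen.exhaust gen.distinct(1))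
  then show ?thesis
    unfolding defect_def shift_def by cases (auto simp: bop_diff_apply bop_apply_plus bop_apply_one *)
qed

text \<open>A prefix-closed set is a subtree of the Cayley graph, so that the geodesic from \<open>z\<close> to \<open>zg\<close>
  stays in it and the partial translation by \<open>g\<close> factors along the letters of \<open>g\<close>.\<close>

lemma partial_translation_in:
  assumes prefix: "\<And>(z::'z) p s. Rep_F2 (incl z) = p @ s \<Longrightarrow> \<exists>z'::'z. Rep_F2 (incl z') = p"
    and A: "cstar_subalgebra A" "1 \<in> A" "range pt_gen \<subseteq> A"
  shows "(partial_translation g :: 'z::F2_subset bop) \<in> A"
proof -
  have letter: "(partial_translation (Abs_F2 [l]) :: 'z bop) \<in> A" for l
  proof (cases l)
    case (Pair i b)
    have "(partial_translation (gen_of i) :: 'z bop) \<in> A" using A(3) by (auto simp: pt_gen_def)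
    then show ?thesis
      using cstar_subalgebraD(4)[OF A(1)] Pair
      by (cases b) (auto simp: gen_of_eq inverse_gen_of[symmetric] star_partial_translation[symmetric])
  qed
  have "(partial_translation (Abs_F2 w) :: 'z bop) \<in> A" if "reduced w" for w
    using that
  proof (induction w)
    case Nil
    then show ?case using A(2) by (simp add: one_F2_def[symmetric] partial_translation_one)
  next
    case (Cons l w)
    have w: "reduced w" using Cons.prems by (rule reduced_ConsD)
    then have Rw: "Rep_F2 (Abs_F2 w) = w" by (simp add: Abs_F2_inverse)
    have lw: "Abs_F2 (l # w) = Abs_F2 [l] * Abs_F2 w"
      using Rep_times_append[of "Abs_F2 [l]" "Abs_F2 w"] Cons.prems by (metis Rep_F2_inverse Rep_letter Rw append_Cons append_Nil)
    have "partial_translation (Abs_F2 w) * partial_translation (Abs_F2 [l]) =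
        (partial_translation (Abs_F2 [l] * Abs_F2 w) :: 'z bop)"
    proof (rule partial_translation_mult)
      fix z z' :: 'z assume eq: "incl z * Abs_F2 [l] * Abs_F2 w = incl z'"
      \<comment> \<open>Either \<open>l\<close> cancels and the next point is a prefix of
        \<open>z\<close>, or nothing cancels from here on because \<open>l # w\<close> is reduced,
        and the next point is a prefix of \<open>z'\<close>.\<close>
      have "\<exists>z''::'z. Rep_F2 (incl z'') = Rep_F2 (incl z * Abs_F2 [l])"
      proof (cases "Rep_F2 (incl z) \<noteq> [] \<and> last (Rep_F2 (incl z)) = inv_letter l")
        case True
        then have "Rep_F2 (incl z) = butlast (Rep_F2 (incl z)) @ [last (Rep_F2 (incl z))]"
          by (intro append_butlast_last_id[symmetric]) blast
        from prefix[OF this] True show ?thesis by (simp add: Rep_times_letter)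
      next
        case False
        then have R: "Rep_F2 (incl z * Abs_F2 [l]) = Rep_F2 (incl z) @ [l]" by (auto simp: Rep_times_letter)
        then have "reduced (Rep_F2 (incl z) @ [l])" by (metis reduced_Rep)
        from reduced_append_letter[OF this Cons.prems]
        have "Rep_F2 (incl z') = (Rep_F2 (incl z) @ [l]) @ w"
          unfolding eq[symmetric] using Rep_times_append[of "incl z * Abs_F2 [l]" "Abs_F2 w"] by (simp add: R Rw)
        from prefix[OF this] show ?thesis by (simp add: R)
      qed
      then show "\<exists>z''::'z. incl z * Abs_F2 [l] = incl z''" by (metis Rep_F2_inject)
    qed
    then show ?case unfolding lw using cstar_subalgebraD(3)[OF A(1) Cons.IH[OF w] letter[of l]] by simp
  qed
  then show ?thesis by (metis Rep_F2_inverse reduced_Rep)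
qed

lemma partial_translation_algebra_eq:
  assumes prefix: "\<And>(z::'z) p s. Rep_F2 (incl z) = p @ s \<Longrightarrow> \<exists>z'::'z. Rep_F2 (incl z') = p"
    and "toeplitz_pair (pt_gen :: gen \<Rightarrow> 'z::F2_subset bop)"
  shows "(partial_translation_algebra :: 'z bop set) = cstar_generated (range pt_gen)"
proof
  note A = cstar_subalgebra_generated[of "range pt_gen"] generators_in_cstar_generated[of "range pt_gen"]
  show "(partial_translation_algebra :: 'z bop set) \<subseteq> cstar_generated (range pt_gen)"
    unfolding partial_translation_algebra_def
    using partial_translation_in[OF prefix A(1) toeplitz_one_in[OF assms(2) A] A(2)]
    by (intro cstar_generated_least A) auto
  show "cstar_generated (range pt_gen) \<subseteq> (partial_translation_algebra :: 'z bop set)"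
    unfolding partial_translation_algebra_def
    using generators_in_cstar_generated[of "range partial_translation"]
    by (intro cstar_generated_least cstar_subalgebra_generated) (auto simp: pt_gen_def)
qed

section \<open>The translation algebras of X and Y\<close>

lemma incl_X: "range (incl :: X \<Rightarrow> F2) = positive_words"
  using type_definition.Rep_range[OF type_definition_X] by (simp add: incl_X_def[abs_def])

lemma incl_Y: "range (incl :: Y \<Rightarrow> F2) = Y_set"
  using type_definition.Rep_range[OF type_definition_Y] by (simp add: incl_Y_def[abs_def])

lemma incl_X_mem: "incl (z::X) \<in> positive_words" and incl_Y_mem: "incl (y::Y) \<in> Y_set"
  using incl_X incl_Y by blast+

lemma X_inject: "incl (z::X) * gen_of i = incl (z'::X) * gen_of j \<Longrightarrow> i = j"
  using Y_set_times_gen_inject positive_words_subset_Y_set incl_X_mem by blast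

lemma Y_inject: "incl (z::Y) * gen_of i = incl (z'::Y) * gen_of j \<Longrightarrow> i = j"
  using Y_set_times_gen_inject incl_Y_mem by blast

lemma toeplitz_X: "toeplitz_pair (pt_gen :: gen \<Rightarrow> X bop)"
proof (rule toeplitz_pt_gen[OF _ X_inject])
  show "\<exists>z'::X. incl z * gen_of i = incl z'" for z :: X and i
    using positive_words_times_gen[OF incl_X_mem[of z], of i] unfolding incl_X[symmetric] by blast
qed

lemma toeplitz_Y: "toeplitz_pair (pt_gen :: gen \<Rightarrow> Y bop)"
proof (rule toeplitz_pt_gen[OF _ Y_inject])
  show "\<exists>z'::Y. incl z * gen_of i = incl z'" for z :: Y and i
    using Y_set_times_gen_mem[OF incl_Y_mem[of z], of i] unfolding incl_Y[symmetric] by blast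
qed

lemma partial_translation_algebra_X:
  "(partial_translation_algebra :: X bop set) = cstar_generated (range pt_gen)"
proof (rule partial_translation_algebra_eq[OF _ toeplitz_X])
  show "\<exists>z'::X. Rep_F2 (incl z') = p" if "Rep_F2 (incl z) = p @ s" for z :: X and p s
    using positive_words_prefix[OF incl_X_mem that] unfolding incl_X[symmetric] by blast
qed

lemma partial_translation_algebra_Y:
  "(partial_translation_algebra :: Y bop set) = cstar_generated (range pt_gen)"
proof (rule partial_translation_algebra_eq[OF _ toeplitz_Y])
  show "\<exists>z'::Y. Rep_F2 (incl z') = p" if "Rep_F2 (incl z) = p @ s" for z :: Y and p s
    using Y_set_prefix[OF incl_Y_mem that] unfolding incl_Y[symmetric] by blast
qed

lemma defect_Y: "defect (pt_gen :: gen \<Rightarrow> Y bop) = 0"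
proof (rule bop_eqI_ket)
  fix z :: Y
  obtain y i where "y \<in> Y_set" "incl z = y * gen_of i" using Y_set_cases[OF incl_Y_mem] by blast
  then have "\<exists>(z'::Y) i. incl z = incl z' * gen_of i" unfolding incl_Y[symmetric] by blast
  then show "bop_apply (defect pt_gen) (ket z) = bop_apply 0 (ket z)"
    by (simp add: defect_pt_gen_ket[OF Y_inject] bop_zero_apply)
qed

lemma defect_X_ket: "bop_apply (defect pt_gen) (ket z) = (if incl z = 1 then ket z else 0)" for z :: X
proof -
  have "(\<exists>(z'::X) i. incl z = incl z' * gen_of i) \<longleftrightarrow> incl z \<noteq> 1"
  proof
    assume "\<exists>(z'::X) i. incl z = incl z' * gen_of i"
    then show "incl z \<noteq> 1" using positive_times_gen_neq_1[OF incl_X_mem] by auto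
  next
    assume "incl z \<noteq> 1"
    with incl_X_mem[of z] obtain y i where "y \<in> positive_words" "incl z = y * gen_of i"
      by (cases rule: positive_words_cases) auto
    then show "\<exists>(z'::X) i. incl z = incl z' * gen_of i" unfolding incl_X[symmetric] by blast
  qed
  then show ?thesis using defect_pt_gen_ket[OF X_inject, where z = z] by simp
qed

section \<open>Compact operators and the comparison of extensions\<close>

text \<open>Finite nets behave well under sums, products and norm limits by plain epsilon estimates,
  since their centres may lie anywhere in the space.\<close>

lemma compact_operators_iff:
  "T \<in> compact_operators \<longleftrightarrow>
    (\<forall>e>0. \<exists>k. finite k \<and> (\<forall>f. norm f < 1 \<longrightarrow> (\<exists>x\<in>k. norm (bop_apply T f - x) < e)))"
proof
  assume "T \<in> compact_operators"
  then have c: "compact (closure (bop_apply T ` ball 0 1))" by (simp add: compact_operators_def)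
  show "\<forall>e>0. \<exists>k. finite k \<and> (\<forall>f. norm f < 1 \<longrightarrow> (\<exists>x\<in>k. norm (bop_apply T f - x) < e))"
  proof (intro allI impI)
    fix e :: real assume "e > 0"
    with c obtain k where k: "finite k" "closure (bop_apply T ` ball 0 1) \<subseteq> (\<Union>x\<in>k. ball x e)"
      unfolding compact_eq_totally_bounded by blast
    have "\<exists>x\<in>k. norm (bop_apply T f - x) < e" if "norm f < 1" for f
    proof -
      have "bop_apply T f \<in> bop_apply T ` ball 0 1" using that by (intro imageI) simp
      then have "bop_apply T f \<in> (\<Union>x\<in>k. ball x e)" 
        by (rule subsetD[OF k(2) subsetD[OF closure_subset]])
      then show ?thesis by (auto simp: dist_norm norm_minus_commute)
    qed
    with k(1) show "\<exists>k. finite k \<and> (\<forall>f. norm f < 1 \<longrightarrow> (\<exists>x\<in>k. norm (bop_apply T f - x) < e))" by blast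
  qed
next
  assume R: "\<forall>e>0. \<exists>k. finite k \<and> (\<forall>f. norm f < 1 \<longrightarrow> (\<exists>x\<in>k. norm (bop_apply T f - x) < e))"
  have "compact (closure (bop_apply T ` ball 0 1))"
    unfolding compact_eq_totally_bounded
  proof (intro conjI allI impI)
    show "complete (closure (bop_apply T ` ball 0 1))" by (simp add: complete_eq_closed)
    fix e :: real assume "e > 0"
    then obtain k where k: "finite k" "\<And>f. norm f < 1 \<Longrightarrow> \<exists>x\<in>k. norm (bop_apply T f - x) < e / 2"
      using R half_gt_zero by blast
    \<comment> \<open>Closed balls of half the radius are used because their finite union is closed
      and so contains the closure of the image.\<close>
    have "bop_apply T ` ball 0 1 \<subseteq> (\<Union>x\<in>k. cball x (e / 2))"
    proof (rule image_subsetI)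
      fix f :: "'a ell2" assume "f \<in> ball 0 1"
      then obtain x where "x \<in> k" "norm (bop_apply T f - x) < e / 2" using k(2)[of f] by auto
      then show "bop_apply T f \<in> (\<Union>x\<in>k. cball x (e / 2))"
        by (intro UN_I[of x]) (simp_all add: dist_norm norm_minus_commute)
    qed
    moreover have "closed (\<Union>x\<in>k. cball x (e / 2))" using k(1) by (intro closed_UN) auto
    ultimately have "closure (bop_apply T ` ball 0 1) \<subseteq> (\<Union>x\<in>k. cball x (e / 2))" by (rule closure_minimal)
    also have "\<dots> \<subseteq> (\<Union>x\<in>k. ball x e)" using \<open>e > 0\<close> by auto
    finally show "\<exists>k. finite k \<and> closure (bop_apply T ` ball 0 1) \<subseteq> (\<Union>x\<in>k. ball x e)" using k(1) by blast
  qed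
  then show "T \<in> compact_operators" by (simp add: compact_operators_def)
qed

section \<open>The compact operators as a closed ideal\<close>

lemma bop_apply_diff: "bop_apply T (f - g) = bop_apply T f - bop_apply T g"
  by (rule linear_diff) (rule bounded_linear.linear[OF bounded_linear_bop])

lemma bop_apply_scaleR: "bop_apply T (r *\<^sub>R f) = r *\<^sub>R bop_apply T f"
  by (simp add: scaleC_of_real[symmetric] bop_apply_scaleC)

lemma compact_operators_zero: "0 \<in> compact_operators"
  unfolding compact_operators_iff by (auto simp: bop_zero_apply intro!: exI[of _ "{0}"])

lemma compact_operators_plus:
  assumes "S \<in> compact_operators" "T \<in> compact_operators" shows "S + T \<in> compact_operators"
  unfolding compact_operators_iff
proof (intro allI impI)
  fix e :: real assume "e > 0"
  then have "e / 2 > 0" by simp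
  with assms obtain k l where
    k: "finite k" "\<And>f. norm f < 1 \<Longrightarrow> \<exists>x\<in>k. norm (bop_apply S f - x) < e / 2" and
    l: "finite l" "\<And>f. norm f < 1 \<Longrightarrow> \<exists>x\<in>l. norm (bop_apply T f - x) < e / 2"
    unfolding compact_operators_iff by metis
  have near: "\<exists>z\<in>(\<lambda>(x, y). x + y) ` (k \<times> l). norm (bop_apply (S + T) f - z) < e" if "norm f < 1" for f
  proof -
    obtain x y where "x \<in> k" "norm (bop_apply S f - x) < e / 2" "y \<in> l" "norm (bop_apply T f - y) < e / 2"
      using k(2) l(2) \<open>norm f < 1\<close> by blast
    moreover have "norm (bop_apply (S + T) f - (x + y)) \<le> norm (bop_apply S f - x) + norm (bop_apply T f - y)"
      unfolding bop_apply_plus add_diff_add by (rule norm_triangle_ineq)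
    ultimately have "norm (bop_apply (S + T) f - (x + y)) < e" "(x, y) \<in> k \<times> l" by simp_all
    then show ?thesis by (intro bexI[of _ "x + y"] image_eqI[of _ _ "(x, y)"]) simp_all
  qed
  from k(1) l(1) show "\<exists>k. finite k \<and> (\<forall>f. norm f < 1 \<longrightarrow> (\<exists>x\<in>k. norm (bop_apply (S + T) f - x) < e))"
    by (intro exI[of _ "(\<lambda>(x, y). x + y) ` (k \<times> l)"] conjI allI impI near finite_imageI finite_cartesian_product)
qed

lemma compact_operators_times_left:
  assumes "T \<in> compact_operators" shows "S * T \<in> compact_operators"
  unfolding compact_operators_iff
proof (intro allI impI)
  fix e :: real assume e: "e > 0"
  have n: "norm S + 1 > 0" using norm_ge_zero[of S] by linarith
  with e have "e / (norm S + 1) > 0" by simp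
  with assms obtain k where
    k: "finite k" "\<And>f. norm f < 1 \<Longrightarrow> \<exists>x\<in>k. norm (bop_apply T f - x) < e / (norm S + 1)"
    unfolding compact_operators_iff by metis
  have near: "\<exists>z\<in>bop_apply S ` k. norm (bop_apply (S * T) f - z) < e" if f: "norm f < 1" for f
  proof -
    obtain x where x: "x \<in> k" "norm (bop_apply T f - x) < e / (norm S + 1)" using k(2)[OF f] by blast
    have "norm (bop_apply (S * T) f - bop_apply S x) \<le> norm S * norm (bop_apply T f - x)"
      unfolding bop_apply_times bop_apply_diff[symmetric] by (rule norm_bop_apply)
    also have "\<dots> \<le> (norm S + 1) * norm (bop_apply T f - x)" by (intro mult_right_mono) auto
    also have "\<dots> < e" using x(2) n by (simp add: pos_less_divide_eq mult.commute)
    finally show ?thesis using x(1) by blast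
  qed
  from k(1) show "\<exists>k. finite k \<and> (\<forall>f. norm f < 1 \<longrightarrow> (\<exists>x\<in>k. norm (bop_apply (S * T) f - x) < e))"
    by (intro exI[of _ "bop_apply S ` k"] conjI allI impI near finite_imageI)
qed

lemma compact_operators_times_right:
  assumes "T \<in> compact_operators" shows "T * S \<in> compact_operators"
  unfolding compact_operators_iff
proof (intro allI impI)
  fix e :: real assume e: "e > 0"
  \<comment> \<open>Dividing by \<open>r\<close> moves the image of the unit ball under
    \<open>S\<close> inside the open unit ball, where the net for \<open>T\<close> is
    available.\<close>
  define r where "r = norm S + 1"
  have r: "r > 0" using norm_ge_zero[of S] unfolding r_def by linarith
  with e have "e / r > 0" by simp
  with assms obtain k where
    k: "finite k" "\<And>f. norm f < 1 \<Longrightarrow> \<exists>x\<in>k. norm (bop_apply T f - x) < e / r"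
    unfolding compact_operators_iff by metis
  have near: "\<exists>z\<in>(*\<^sub>R) r ` k. norm (bop_apply (T * S) f - z) < e" if f: "norm f < 1" for f
  proof -
    have "norm (bop_apply S f) \<le> norm S * norm f" by (rule norm_bop_apply)
    also have "\<dots> \<le> norm S * 1" using f by (intro mult_left_mono) auto
    finally have "norm (bop_apply S f /\<^sub>R r) < 1" using r by (simp add: r_def divide_less_eq field_simps)
    then obtain x where x: "x \<in> k" "norm (bop_apply T (bop_apply S f /\<^sub>R r) - x) < e / r" using k(2) by blast
    have "bop_apply (T * S) f - r *\<^sub>R x = r *\<^sub>R (bop_apply T (bop_apply S f /\<^sub>R r) - x)"
      using r by (simp add: bop_apply_times bop_apply_scaleR scaleR_diff_right)
    then have "norm (bop_apply (T * S) f - r *\<^sub>R x) = r * norm (bop_apply T (bop_apply S f /\<^sub>R r) - x)"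
      using r by simp
    then have "norm (bop_apply (T * S) f - r *\<^sub>R x) < e"
      using x(2) r by (simp add: pos_less_divide_eq mult.commute)
    with x(1) show ?thesis by blast
  qed
  from k(1) show "\<exists>k. finite k \<and> (\<forall>f. norm f < 1 \<longrightarrow> (\<exists>x\<in>k. norm (bop_apply (T * S) f - x) < e))"
    by (intro exI[of _ "(*\<^sub>R) r ` k"] conjI allI impI near finite_imageI)
qed

lemma closed_compact_operators: "closed compact_operators"
  unfolding closed_sequential_limits
proof (intro allI impI, elim conjE)
  fix Ts T assume Ts: "\<forall>n. Ts n \<in> compact_operators" "Ts \<longlonglongrightarrow> T"
  show "T \<in> compact_operators"
    unfolding compact_operators_iff
  proof (intro allI impI)
    fix e :: real assume e: "e > 0"
    then obtain n where n: "norm (Ts n - T) < e / 2" using LIMSEQ_D[OF Ts(2), of "e / 2"] by auto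
    obtain k where k: "finite k" "\<And>f. norm f < 1 \<Longrightarrow> \<exists>x\<in>k. norm (bop_apply (Ts n) f - x) < e / 2"
      using Ts(1) e half_gt_zero unfolding compact_operators_iff by metis
    have "\<exists>x\<in>k. norm (bop_apply T f - x) < e" if f: "norm f < 1" for f
    proof -
      obtain x where x: "x \<in> k" "norm (bop_apply (Ts n) f - x) < e / 2" using k(2)[OF f] by blast
      have "norm (bop_apply (Ts n) f - bop_apply T f) \<le> norm (Ts n - T) * norm f"
        unfolding bop_diff_apply[symmetric] by (rule norm_bop_apply)
      also have "\<dots> \<le> norm (Ts n - T) * 1" using f by (intro mult_left_mono) auto
      finally have "norm (bop_apply T f - bop_apply (Ts n) f) < e / 2" using n by (simp add: norm_minus_commute)
      then have "norm (bop_apply T f - x) < e"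
        using norm_triangle_ineq[of "bop_apply T f - bop_apply (Ts n) f" "bop_apply (Ts n) f - x"] x(2) by simp
      with x(1) show ?thesis by blast
    qed
    with k(1) show "\<exists>k. finite k \<and> (\<forall>f. norm f < 1 \<longrightarrow> (\<exists>x\<in>k. norm (bop_apply T f - x) < e))" by blast
  qed
qed

lemma scaleC_eq_times: "c *\<^sub>C x = x * (c *\<^sub>C (1::'a::unital_cstar_algebra))"
  by (simp add: mult_scaleC_right)

lemma closed_ideal_compact:
  assumes "cstar_subalgebra A" shows "closed_ideal (compact_operators \<inter> A) A"
  unfolding closed_ideal_def
proof (intro conjI ballI allI)
  show "closed (compact_operators \<inter> A)"
    using closed_compact_operators cstar_subalgebraD(6)[OF assms] by (rule closed_Int)
  show "c *\<^sub>C x \<in> compact_operators \<inter> A" if "x \<in> compact_operators \<inter> A" for c x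
    using that compact_operators_times_right[of x "c *\<^sub>C 1"] cstar_subalgebraD(5)[OF assms]
    by (simp add: scaleC_eq_times[symmetric])
qed (use cstar_subalgebraD[OF assms] in
    \<open>auto intro: compact_operators_zero compact_operators_plus compact_operators_times_left compact_operators_times_right\<close>)

section \<open>The Fock representation on X\<close>

abbreviation vX :: "gen \<Rightarrow> X bop" where "vX \<equiv> pt_gen"

definition origin :: X where "origin = Abs_X 1"

lemma incl_eq_1: "incl z = 1 \<longleftrightarrow> z = origin"
proof -
  have "incl origin = 1" by (simp add: incl_X_def origin_def Abs_X_inverse one_in_positive_words)
  then show ?thesis by (metis incl_inject)
qed

lemma defect_X_apply: "bop_apply (defect vX) f = Rep_ell2 f origin *\<^sub>C ket origin"
proof (rule ell2_eqI)
  fix y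
  have zero: "cinner 0 f = 0" by (simp add: cinner_eq complex_eq_iff)
  \<comment> \<open>The defect is known on basis vectors only; self-adjointness carries this over to
    the coordinates of its value at any \<open>f\<close>.\<close>
  have "Rep_ell2 (bop_apply (defect vX) f) y = cinner (bop_apply (defect vX) (ket y)) f"
    using cinner_star[of "defect vX" "ket y" f] by (simp add: cinner_ket_left)
  also have "\<dots> = (if y = origin then Rep_ell2 f y else 0)"
    by (simp add: defect_X_ket incl_eq_1 cinner_ket_left zero)
  finally show "Rep_ell2 (bop_apply (defect vX) f) y = Rep_ell2 (Rep_ell2 f origin *\<^sub>C ket origin) y"
    by (simp add: scaleC_ell2.rep_eq ket.rep_eq)
qed

lemma defect_X_nonzero: "defect vX \<noteq> 0"
proof
  assume "defect vX = 0"
  then have "ket origin = 0" using defect_X_ket[of origin] by (simp add: bop_zero_apply incl_eq_1)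
  then show False using norm_ket[of origin] by simp
qed

lemma defect_X_compact: "defect vX \<in> compact_operators"
proof -
  let ?K = "(\<lambda>c. c *\<^sub>C ket origin) ` cball 0 1"
  have "bounded_linear (\<lambda>c. c *\<^sub>C (ket origin :: X ell2))"
    by (rule bounded_linear_intro[where K = 1])
      (simp_all add: scaleC_add_left norm_scaleC scaleC_of_real[symmetric] scaleC_scaleC scaleR_conv_of_real)
  then have K: "compact ?K"
    by (intro compact_continuous_image linear_continuous_on) auto
  have "bop_apply (defect vX) ` ball 0 1 \<subseteq> ?K"
  proof (rule image_subsetI)
    fix f :: "X ell2" assume "f \<in> ball 0 1"
    then have "cmod (Rep_ell2 f origin) \<le> 1" using ell2_coord_le[of f origin] by simp
    then show "bop_apply (defect vX) f \<in> ?K" unfolding defect_X_apply by (intro imageI) simp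
  qed
  then have "closure (bop_apply (defect vX) ` ball 0 1) \<subseteq> ?K"
    using compact_imp_closed[OF K] by (rule closure_minimal)
  then have "compact (?K \<inter> closure (bop_apply (defect vX) ` ball 0 1))"
    using K by (intro compact_Int_closed) auto
  moreover have "?K \<inter> closure (bop_apply (defect vX) ` ball 0 1) = closure (bop_apply (defect vX) ` ball 0 1)"
    using \<open>closure _ \<subseteq> ?K\<close> by blast
  ultimately show ?thesis by (simp add: compact_operators_def)
qed

text \<open>Each step of the iterated shift strips the last letter of the word, so a word with fewer
  than \<open>M\<close> letters runs out.\<close>

lemma tailp_X_ket: "incl z = wprod gen_of gs \<Longrightarrow> length gs < M \<Longrightarrow> bop_apply (tailp vX M) (ket z) = 0"
proof (induction M arbitrary: gs z)
  case (Suc M)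
  have "bop_apply (vX i * tailp vX M * star (vX i)) (ket z) = 0" for i
  proof (cases "\<exists>z'::X. incl z * inverse (gen_of i) = incl z'")
    case True
    then obtain z' :: X where z': "incl z * inverse (gen_of i) = incl z'" by blast
    obtain hs where hs: "incl z' = wprod gen_of hs"
      using incl_X_mem[of z'] by (auto simp: positive_words_eq)
    have "incl z = incl z' * gen_of i" by (metis z' F2_left_inverse mult.assoc mult.right_neutral)
    then have "Rep_F2 (wprod gen_of gs) = Rep_F2 (wprod gen_of (hs @ [i]))"
      using Suc.prems(1) by (simp add: hs wprod_append)
    then have "length gs = Suc (length hs)" unfolding Rep_wprod by (metis length_append_singleton length_map)
    then have "bop_apply (tailp vX M) (ket z') = 0" using Suc.prems(2) by (intro Suc.IH[OF hs]) simp
    then show ?thesis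
      by (simp add: pt_gen_def star_partial_translation bop_apply_times partial_translation_ket[OF z']
          bop_apply_zero_right)
  next
    case False
    then have "bop_apply (star (vX i)) (ket z) = 0"
      unfolding pt_gen_def star_partial_translation by (intro partial_translation_ket_0) blast
    then show ?thesis by (simp add: bop_apply_times bop_apply_zero_right)
  qed
  then show ?case by (simp add: tailp_def shift_def bop_apply_plus)
qed simp

text \<open>A finite partial sum of \<open>f\<close> is killed once \<open>N\<close> exceeds the
  lengths of its words, and the remainder is controlled by \<open>norm_tailp_le\<close>.\<close>

lemma tailp_X_strong:
  assumes "e > 0" shows "\<exists>M. \<forall>N\<ge>M. norm (bop_apply (tailp vX N) f) < e"
proof -
  have "\<forall>\<^sub>F F in finite_subsets_at_top UNIV. dist (\<Sum>x\<in>F. Rep_ell2 f x *\<^sub>C ket x) f < e"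
    using has_sum_ket[of f] assms unfolding has_sum_def by (rule tendstoD)
  then obtain F where F: "finite F" "dist (\<Sum>x\<in>F. Rep_ell2 f x *\<^sub>C ket x) f < e"
    unfolding eventually_finite_subsets_at_top by blast
  define g where "g = (\<Sum>x\<in>F. Rep_ell2 f x *\<^sub>C ket x)"
  have "\<forall>z::X. \<exists>gs. incl z = wprod gen_of gs" using incl_X_mem by (auto simp: positive_words_eq)
  then obtain w where w: "\<And>z::X. incl z = wprod gen_of (w z)" by metis
  define M where "M = Suc (Max (insert 0 ((\<lambda>z. length (w z)) ` F)))"
  have "norm (bop_apply (tailp vX N) f) < e" if N: "N \<ge> M" for N
  proof -
    have "bop_apply (tailp vX N) (ket z) = 0" if "z \<in> F" for z
    proof (rule tailp_X_ket[OF w])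
      have "length (w z) \<le> Max (insert 0 ((\<lambda>z. length (w z)) ` F))" using F(1) that by (intro Max_ge) auto
      then show "length (w z) < N" using N by (simp add: M_def)
    qed
    then have "bop_apply (tailp vX N) g = 0"
      unfolding g_def linear_sum[OF bounded_linear.linear[OF bounded_linear_bop]]
      by (intro sum.neutral ballI) (simp add: bop_apply_scaleC)
    then have "bop_apply (tailp vX N) f = bop_apply (tailp vX N) (f - g)"
      by (simp add: bop_apply_diff)
    also have "norm \<dots> \<le> norm (tailp vX N) * norm (f - g)" by (rule norm_bop_apply)
    also have "\<dots> \<le> 1 * norm (f - g)" by (intro mult_right_mono norm_tailp_le toeplitz_X) simp
    also have "\<dots> < e" using F(2) by (simp add: g_def dist_norm norm_minus_commute)
    finally show ?thesis .
  qed
  then show ?thesis by blast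
qed

context
  fixes J :: "X bop set"
  assumes J: "closed_ideal J (cstar_generated (range vX))" and Q: "defect vX \<in> J"
begin

lemma vX_in: "vX i \<in> cstar_generated (range vX)"
  using generators_in_cstar_generated[of "range vX"] by blast

lemma star_vX_in: "star (vX i) \<in> cstar_generated (range vX)"
  by (rule cstar_subalgebraD(4)[OF cstar_subalgebra_generated vX_in])

text \<open>\<open>S\<close> is an arbitrary bounded operator. Rank one makes
  \<open>defect vX * S * defect vX\<close> a scalar multiple of the defect, and higher levels are
  reached through adjoint generators on the right.\<close>

lemma defect_times_level_in: "defect vX * S * level vX k \<in> J"
proof (induction k arbitrary: S)
  case 0
  have "defect vX * S * level vX 0 = Rep_ell2 (bop_apply S (ket origin)) origin *\<^sub>C defect vX"
    by (intro bop_eqI)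
      (simp add: level_def bop_apply_times defect_X_apply bop_apply_scaleC bop_apply_scaleC_left
        scaleC_ell2.rep_eq scaleC_scaleC mult.commute)
  then show ?case using closed_idealD(4)[OF J Q] by simp
next
  case (Suc k)
  have "defect vX * S * level vX (Suc k) =
      (defect vX * (S * vX Gen_a) * level vX k) * star (vX Gen_a) +
      (defect vX * (S * vX Gen_b) * level vX k) * star (vX Gen_b)"
    by (simp add: level_def shift_def distrib_left mult.assoc)
  also have "\<dots> \<in> J" by (intro closed_idealD(3,5)[OF J] Suc star_vX_in)
  finally show ?case .
qed

text \<open>The adjoint of \<open>defect vX * S\<close> takes values in the multiples of
  \<open>star S\<close> applied to \<open>ket origin\<close>. Strong convergence of the tails at
  that single vector therefore becomes norm convergence.\<close>

lemma defect_times_in: "defect vX * S \<in> J"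
proof -
  have "(\<lambda>M. defect vX * S * tailp vX M) \<longlonglongrightarrow> 0"
  proof (rule LIMSEQ_I)
    fix e :: real assume "e > 0"
    then obtain M where M: "\<And>N. N \<ge> M \<Longrightarrow> norm (bop_apply (tailp vX N) (bop_apply (star S) (ket origin))) < e / 2"
      using tailp_X_strong[of "e / 2"] half_gt_zero by metis
    have "norm (defect vX * S * tailp vX N) < e" if N: "N \<ge> M" for N
    proof -
      have "norm (bop_apply (tailp vX N * star S * defect vX) f) \<le> e / 2 * norm f" for f
      proof -
        have "norm (bop_apply (tailp vX N * star S * defect vX) f) =
            cmod (Rep_ell2 f origin) * norm (bop_apply (tailp vX N) (bop_apply (star S) (ket origin)))"
          by (simp add: bop_apply_times defect_X_apply bop_apply_scaleC norm_scaleC)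
        also have "\<dots> \<le> norm f * (e / 2)"
          using M[OF N] by (intro mult_mono ell2_coord_le) auto
        finally show ?thesis by (simp add: mult.commute)
      qed
      then have "norm (tailp vX N * star S * defect vX) \<le> e / 2"
        using \<open>e > 0\<close> by (intro norm_bop_bound) auto
      moreover have "tailp vX N * star S * defect vX = star (defect vX * S * tailp vX N)"
        by (simp add: star_mult mult.assoc)
      ultimately show ?thesis using \<open>e > 0\<close> by simp
    qed
    then show "\<exists>M. \<forall>N\<ge>M. norm (defect vX * S * tailp vX N - 0) < e" by auto
  qed
  then have lim: "(\<lambda>M. defect vX * S - defect vX * S * tailp vX M) \<longlonglongrightarrow> defect vX * S - 0"
    by (intro tendsto_diff tendsto_const)
  have mem: "defect vX * S - defect vX * S * tailp vX M \<in> J" for M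
  proof -
    have "(\<Sum>k<M. defect vX * S * level vX k) \<in> J"
      by (induction M) (auto intro: closed_idealD(2,3)[OF J] defect_times_level_in)
    moreover have "(\<Sum>k<M. defect vX * S * level vX k) + defect vX * S * tailp vX M = defect vX * S"
      using arg_cong[OF sum_level[of vX M], of "\<lambda>x. defect vX * S * x"]
      by (simp add: distrib_left sum_distrib_left)
    ultimately show ?thesis by (metis add_diff_cancel_right')
  qed
  show ?thesis using closed_sequentially[OF closed_idealD(7)[OF J] mem lim] by simp
qed

lemma level_times_in: "level vX k * S \<in> J"
proof (induction k arbitrary: S)
  case 0
  then show ?case using defect_times_in by (simp add: level_def)
next
  case (Suc k)
  have "level vX (Suc k) * S =
      vX Gen_a * (level vX k * (star (vX Gen_a) * S)) + vX Gen_b * (level vX k * (star (vX Gen_b) * S))"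
    by (simp add: level_def shift_def distrib_right mult.assoc)
  also have "\<dots> \<in> J" by (intro closed_idealD(3,6)[OF J] Suc vX_in)
  finally show ?case .
qed

text \<open>Compactness upgrades strong convergence of the tails to norm convergence of
  \<open>tailp vX M * T\<close>, as only a finite net of vectors must be made small. The rest of
  \<open>T\<close> is a finite sum of terms covered by \<open>level_times_in\<close>.\<close>

lemma compact_in_ideal:
  assumes T: "T \<in> compact_operators" shows "T \<in> J"
proof -
  have "(\<lambda>M. tailp vX M * T) \<longlonglongrightarrow> 0"
  proof (rule LIMSEQ_I)
    fix e :: real assume "e > 0"
    then have e: "e / 4 > 0" by simp
    with T obtain k where
      k: "finite k" "\<And>f. norm f < 1 \<Longrightarrow> \<exists>x\<in>k. norm (bop_apply T f - x) < e / 4"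
      unfolding compact_operators_iff by metis
    obtain m where m: "\<And>x N. N \<ge> m x \<Longrightarrow> norm (bop_apply (tailp vX N) x) < e / 4"
      using tailp_X_strong[OF e] by metis
    define M where "M = Max (insert 0 (m ` k))"
    have "norm (tailp vX N * T) < e" if N: "N \<ge> M" for N
    proof -
      have small: "norm (bop_apply (tailp vX N * T) f) \<le> e / 2" if f: "norm f < 1" for f
      proof -
        obtain x where x: "x \<in> k" "norm (bop_apply T f - x) < e / 4" using k(2)[OF f] by blast
        have "m x \<le> M" unfolding M_def using k(1) x(1) by (intro Max_ge) auto
        then have 1: "norm (bop_apply (tailp vX N) x) < e / 4" using m N by simp
        have "norm (bop_apply (tailp vX N) (bop_apply T f - x)) \<le> norm (tailp vX N) * norm (bop_apply T f - x)"
          by (rule norm_bop_apply)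
        also have "\<dots> \<le> 1 * norm (bop_apply T f - x)" by (intro mult_right_mono norm_tailp_le toeplitz_X) simp
        finally have 2: "norm (bop_apply (tailp vX N) (bop_apply T f - x)) < e / 4" using x(2) by simp
        have "bop_apply (tailp vX N * T) f = bop_apply (tailp vX N) (bop_apply T f - x) + bop_apply (tailp vX N) x"
          by (simp add: bop_apply_times bop_apply_diff)
        then show ?thesis using 1 2 norm_triangle_ineq[of "bop_apply (tailp vX N) (bop_apply T f - x)" "bop_apply (tailp vX N) x"]
          by simp
      qed
      have "norm (bop_apply (tailp vX N * T) f) \<le> 3 / 4 * e * norm f" for f
      proof (cases "f = 0")
        case False
        \<comment> \<open>A vector of norm 2/3 lies in the open unit ball; undoing the scaling turns
          \<open>e / 2\<close> into \<open>3 / 4 * e\<close>, still below \<open>e\<close>.\<close>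
        define g where "g = (2 / 3 / norm f) *\<^sub>R f"
        have "norm g < 1" using False by (simp add: g_def)
        from small[OF this] have "(2 / 3 / norm f) * norm (bop_apply (tailp vX N * T) f) \<le> e / 2"
          by (simp add: g_def bop_apply_scaleR)
        then show ?thesis using False by (simp add: field_simps)
      qed (simp add: bop_apply_zero_right)
      then have "norm (tailp vX N * T) \<le> 3 / 4 * e" using \<open>e > 0\<close> by (intro norm_bop_bound) auto
      then show ?thesis using \<open>e > 0\<close> by simp
    qed
    then show "\<exists>M. \<forall>N\<ge>M. norm (tailp vX N * T - 0) < e" by auto
  qed
  then have lim: "(\<lambda>M. T - tailp vX M * T) \<longlonglongrightarrow> T - 0"
    by (intro tendsto_diff tendsto_const)
  have mem: "T - tailp vX M * T \<in> J" for M
  proof -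
    have "(\<Sum>k<M. level vX k * T) \<in> J"
      by (induction M) (auto intro: closed_idealD(2,3)[OF J] level_times_in)
    moreover have "(\<Sum>k<M. level vX k * T) + tailp vX M * T = T"
      using arg_cong[OF sum_level[of vX M], of "\<lambda>x. x * T"]
      by (simp add: distrib_right sum_distrib_right)
    ultimately show ?thesis by (metis add_diff_cancel_right')
  qed
  show ?thesis using closed_sequentially[OF closed_idealD(7)[OF J] mem lim] by simp
qed

end

lemma compact_operators_eq_ideal:
  "compact_operators = ideal_generated (cstar_generated (range vX)) {defect vX}"
proof
  let ?A = "cstar_generated (range vX)"
  have "tailp vX 1 \<in> ?A"
    using poly_pair_in[OF toeplitz_X cstar_subalgebra_generated generators_in_cstar_generated
        poly_pair_tailp[OF toeplitz_X toeplitz_X]] .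
  then have Q: "defect vX \<in> ?A"
    using cstar_subalgebra_diff[OF cstar_subalgebra_generated
        toeplitz_one_in[OF toeplitz_X cstar_subalgebra_generated generators_in_cstar_generated]]
    by (simp add: defect_def tailp_def)
  show "ideal_generated ?A {defect vX} \<subseteq> compact_operators"
    using ideal_generated_least[OF closed_ideal_compact[OF cstar_subalgebra_generated], of "{defect vX}"]
      defect_X_compact Q by blast
  have "closed_ideal (ideal_generated ?A {defect vX}) ?A"
    using Q by (intro closed_ideal_generated cstar_subalgebra_generated) auto
  moreover have "defect vX \<in> ideal_generated ?A {defect vX}"
    using generators_in_ideal_generated[of "{defect vX}"] by simp
  ultimately show "compact_operators \<subseteq> ideal_generated ?A {defect vX}"
    using compact_in_ideal by blast
qed

section \<open>From Cuntz isometries to Toeplitz pairs\<close>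

lemma cuntz_orthogonal:
  fixes p q r :: "'a::real_algebra_1"
  assumes "p + q + r = 1" "p * p = p" "q * q = q" "r * r = r"
  shows "p * q = 0"
proof -
  \<comment> \<open>That \<open>1 - r\<close> is idempotent forces \<open>p\<close> and
    \<open>q\<close> to anticommute; moving \<open>p\<close> across twice shows that they also
    commute, so their product is zero.\<close>
  have "(p + q) * (p + q) = p + q"
  proof -
    have "p + q = 1 - r" using assms(1) by (simp add: algebra_simps)
    then show ?thesis using assms(4) by (simp add: left_diff_distrib right_diff_distrib)
  qed
  then have s: "p * q + q * p = 0" using assms(2,3) by (simp add: algebra_simps)
  from s have qp: "q * p = - (p * q)" by (simp add: eq_neg_iff_add_eq_0 add.commute)
  have "p * q = p * (p * q)" using assms(2) by (simp add: mult.assoc[symmetric])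
  also have "\<dots> = - (p * (q * p))" by (simp add: qp)
  also have "\<dots> = - ((p * q) * p)" by (simp add: mult.assoc)
  also have "\<dots> = (q * p) * p" by (simp add: qp)
  also have "\<dots> = q * p" by (simp add: mult.assoc assms(2))
  finally have "p * q = - (p * q)" using qp by simp
  then have "2 *\<^sub>R (p * q) = 0" by (simp add: scaleR_2 eq_neg_iff_add_eq_0)
  then show ?thesis by simp
qed

lemma orthogonal_isometries:
  fixes s t :: "'a::unital_cstar_algebra"
  assumes "star s * s = 1" "star t * t = 1" "(s * star s) * (t * star t) = 0"
  shows "star s * t = 0"
proof -
  have "star s * t = star s * ((s * star s) * (t * star t)) * t"
    by (metis assms(1,2) mult.assoc mult.left_neutral mult.right_neutral)
  then show ?thesis by (simp add: assms(3))
qed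

definition gen_fun :: "(nat \<Rightarrow> 'a) \<Rightarrow> gen \<Rightarrow> 'a"
  where "gen_fun V i = (case i of Gen_a \<Rightarrow> V 1 | Gen_b \<Rightarrow> V 2)"

lemma range_gen_fun: "range (gen_fun V) = {V 1, V 2}"
proof -
  have U: "(UNIV :: gen set) = {Gen_a, Gen_b}" by (auto intro: gen.exhaust)
  show ?thesis unfolding U by (simp add: gen_fun_def)
qed

lemma defect_gen_fun: "defect (gen_fun V) = 1 - V 1 * star (V 1) - V 2 * star (V 2)"
  by (simp add: defect_def shift_def gen_fun_def)

lemma toeplitz_pair_gen_fun:
  assumes "star (V 1) * V 1 = 1" "star (V 2) * V 2 = 1" "star (V 1) * V 2 = 0"
  shows "toeplitz_pair (gen_fun V)"
proof -
  have "star (V 2) * V 1 = 0" using arg_cong[OF assms(3), of star] by (simp add: star_mult star_star)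
  with assms show ?thesis unfolding toeplitz_pair_def by (auto simp: gen_fun_def split: gen.splits)
qed

lemma isometry_range_idem:
  "star s * s = 1 \<Longrightarrow> (s * star s) * (s * star s) = s * star (s::'a::unital_cstar_algebra)"
  by (metis mult.assoc mult.left_neutral)

text \<open>The defect of the first two isometries is \<open>V 3 * star (V 3)\<close>, which cannot
  vanish because \<open>V 3\<close> is an isometry and \<open>1 \<noteq> 0\<close>.\<close>

lemma cuntz_3:
  assumes "cuntz_isometries 3 V" shows "toeplitz_pair (gen_fun V)" "defect (gen_fun V) \<noteq> 0"
proof -
  have i: "star (V 1) * V 1 = 1" "star (V 2) * V 2 = 1" "star (V 3) * V 3 = 1"
    using assms by (auto simp: cuntz_isometries_def)
  have "(\<Sum>i=1..3. V i * star (V i)) = 1" using assms by (auto simp: cuntz_isometries_def)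
  then have s: "V 1 * star (V 1) + V 2 * star (V 2) + V 3 * star (V 3) = 1"
    by (simp add: numeral_3_eq_3 numeral_2_eq_2)
  show "toeplitz_pair (gen_fun V)"
    by (intro toeplitz_pair_gen_fun orthogonal_isometries i cuntz_orthogonal[OF s] isometry_range_idem)
  show "defect (gen_fun V) \<noteq> 0"
  proof
    assume "defect (gen_fun V) = 0"
    then have "V 3 * star (V 3) = 0" using s by (simp add: defect_gen_fun algebra_simps)
    then have "star (V 3) * (V 3 * star (V 3)) * V 3 = 0" by simp
    then show False by (metis i(3) mult.assoc mult.left_neutral zero_neq_one)
  qed
qed

lemma cuntz_2:
  assumes "cuntz_isometries 2 W" shows "toeplitz_pair (gen_fun W)" "defect (gen_fun W) = 0"
proof -
  have i: "star (W 1) * W 1 = 1" "star (W 2) * W 2 = 1"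
    using assms by (auto simp: cuntz_isometries_def)
  have "(\<Sum>i=1..2. W i * star (W i)) = 1" using assms by (auto simp: cuntz_isometries_def)
  then have s: "W 1 * star (W 1) + W 2 * star (W 2) = 1" by (simp add: numeral_2_eq_2)
  then have s': "W 1 * star (W 1) + W 2 * star (W 2) + 0 = 1" by simp
  show "toeplitz_pair (gen_fun W)"
    by (intro toeplitz_pair_gen_fun orthogonal_isometries i cuntz_orthogonal[OF s'] isometry_range_idem) simp
  show "defect (gen_fun W) = 0" using s by (simp add: defect_gen_fun algebra_simps)
qed

text \<open>Contractivity makes the set of agreement closed, hence a subalgebra containing the
  generators. The commuting square is obtained this way by evaluating both composites on
  generators.\<close>

lemma star_hom_unique:
  fixes f g :: "'a::unital_cstar_algebra \<Rightarrow> 'b::unital_cstar_algebra"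
  assumes f: "star_hom (cstar_generated G) B f" "\<And>x. x \<in> cstar_generated G \<Longrightarrow> norm (f x) \<le> norm x"
    and g: "star_hom (cstar_generated G) B g" "\<And>x. x \<in> cstar_generated G \<Longrightarrow> norm (g x) \<le> norm x"
    and eq: "\<And>x. x \<in> G \<Longrightarrow> f x = g x" and x: "x \<in> cstar_generated G"
  shows "f x = g x"
proof -
  let ?A = "cstar_generated G"
  note A = cstar_subalgebraD[OF cstar_subalgebra_generated[of G]]
  have cont: "(\<lambda>n. h (xs n)) \<longlonglongrightarrow> h x"
    if h: "star_hom ?A B h" "\<And>x. x \<in> ?A \<Longrightarrow> norm (h x) \<le> norm x" and xs: "\<And>n. xs n \<in> ?A" "x \<in> ?A" "xs \<longlonglongrightarrow> x"
    for h :: "'a \<Rightarrow> 'b" and xs x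
  proof -
    have "norm (h (xs n) - h x) \<le> norm (xs n - x)" for n
    proof -
      have "h (xs n + (- 1) *\<^sub>C x) = h (xs n) + (- 1) *\<^sub>C h x"
        using h(1) xs(1,2) A(5) unfolding star_hom_def by metis
      then show ?thesis
        using h(2)[OF cstar_subalgebra_diff[OF cstar_subalgebra_generated xs(1)[of n] xs(2)]]
        by (simp add: scaleC_minus_one)
    qed
    then have "(\<lambda>n. norm (h (xs n) - h x)) \<longlonglongrightarrow> 0"
      using LIM_zero[OF xs(3)]
      by (intro tendsto_sandwich[OF _ _ tendsto_const tendsto_norm_zero]) (auto intro!: always_eventually)
    then show ?thesis by (simp add: tendsto_norm_zero_iff LIM_zero_iff)
  qed
  have "closed {x \<in> ?A. f x = g x}"
    unfolding closed_sequential_limits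
  proof (intro allI impI, elim conjE)
    fix xs x assume xs: "\<forall>n. xs n \<in> {x \<in> ?A. f x = g x}" "xs \<longlonglongrightarrow> x"
    have xsA: "xs n \<in> ?A" and e: "f (xs n) = g (xs n)" for n using xs(1) by auto
    have xA: "x \<in> ?A" by (rule closed_sequentially[OF A(6) xsA xs(2)])
    have "(\<lambda>n. f (xs n)) \<longlonglongrightarrow> f x" by (rule cont[OF f xsA xA xs(2)])
    moreover have "(\<lambda>n. f (xs n)) \<longlonglongrightarrow> g x" unfolding e by (rule cont[OF g xsA xA xs(2)])
    ultimately have "f x = g x" by (rule LIMSEQ_unique)
    with xA show "x \<in> {x \<in> ?A. f x = g x}" by simp
  qed
  moreover have "f 0 = g 0"
    using f(2)[OF A(1)] g(2)[OF A(1)] by simp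
  ultimately have "cstar_subalgebra {x \<in> ?A. f x = g x}"
    unfolding cstar_subalgebra_def using f(1) g(1) A(1-5) by (auto simp: star_hom_def)
  then have "?A \<subseteq> {x \<in> ?A. f x = g x}"
    using eq generators_in_cstar_generated[of G] by (intro cstar_generated_least) auto
  with x show ?thesis by blast
qed

lemma star_hom_comp: "star_hom A B f \<Longrightarrow> star_hom B C g \<Longrightarrow> star_hom A C (\<lambda>x. g (f x))"
  by (simp add: star_hom_def)

theorem theorem4:
  fixes V :: "nat \<Rightarrow> 'a::unital_cstar_algebra"
    and W :: "nat \<Rightarrow> 'b::unital_cstar_algebra"
  assumes "cuntz_isometries 3 V"
    and "cuntz_isometries 2 W"
  shows "\<exists>(\<pi> :: 'a \<Rightarrow> 'b) (q :: X bop \<Rightarrow> Y bop)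
      (\<phi>\<^sub>K :: X bop \<Rightarrow> 'a) (\<phi>\<^sub>X :: X bop \<Rightarrow> 'a) (\<phi>\<^sub>Y :: Y bop \<Rightarrow> 'b).
    cstar_extension (cuntz_J2 V) (cuntz_E2 V) (cuntz_algebra 2 W) \<pi> \<and>
    \<pi> (V 1) = W 1 \<and> \<pi> (V 2) = W 2 \<and>
    cstar_extension (compact_operators :: X bop set)
      (partial_translation_algebra :: X bop set) (partial_translation_algebra :: Y bop set) q \<and>
    q (partial_translation gen_a) = partial_translation gen_a \<and>
    q (partial_translation gen_b) = partial_translation gen_b \<and>
    star_iso (compact_operators :: X bop set) (cuntz_J2 V) \<phi>\<^sub>K \<and>
    star_iso (partial_translation_algebra :: X bop set) (cuntz_E2 V) \<phi>\<^sub>X \<and>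
    star_iso (partial_translation_algebra :: Y bop set) (cuntz_algebra 2 W) \<phi>\<^sub>Y \<and>
    \<phi>\<^sub>X (partial_translation gen_a) = V 1 \<and> \<phi>\<^sub>X (partial_translation gen_b) = V 2 \<and>
    \<phi>\<^sub>Y (partial_translation gen_a) = W 1 \<and> \<phi>\<^sub>Y (partial_translation gen_b) = W 2 \<and>
    (\<forall>T\<in>(compact_operators :: X bop set). \<phi>\<^sub>X T = \<phi>\<^sub>K T) \<and>
    (\<forall>T\<in>(partial_translation_algebra :: X bop set). \<phi>\<^sub>Y (q T) = \<pi> (\<phi>\<^sub>X T))"
proof -
  define v where "v = gen_fun V"
  define w where "w = gen_fun W"
  note v = cuntz_3[OF assms(1), folded v_def] and w = cuntz_2[OF assms(2), folded w_def]
  let ?A = "partial_translation_algebra :: X bop set" and ?B = "partial_translation_algebra :: Y bop set"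
  let ?vY = "pt_gen :: gen \<Rightarrow> Y bop"
  have E2: "cuntz_E2 V = cstar_generated (range v)"
    by (simp add: cuntz_E2_def v_def range_gen_fun)
  have J2: "cuntz_J2 V = ideal_generated (cstar_generated (range v)) {defect v}"
    by (simp add: cuntz_J2_def E2 v_def defect_gen_fun)
  have "{1..2} = {1, 2::nat}" by auto
  then have O2: "cuntz_algebra 2 W = cstar_generated (range w)"
    by (simp add: cuntz_algebra_def w_def range_gen_fun)
  have gens: "v Gen_a = V 1" "v Gen_b = V 2" "w Gen_a = W 1" "w Gen_b = W 2"
    "partial_translation gen_a = (pt_gen Gen_a :: X bop)" "partial_translation gen_b = (pt_gen Gen_b :: X bop)"
    "partial_translation gen_a = ?vY Gen_a" "partial_translation gen_b = ?vY Gen_b"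
    by (simp_all add: v_def w_def gen_fun_def pt_gen_def gen_of_def)
  obtain \<pi> where \<pi>: "cstar_extension (cuntz_J2 V) (cuntz_E2 V) (cuntz_algebra 2 W) \<pi>"
    "\<And>i. \<pi> (v i) = w i" "\<And>x. x \<in> cuntz_E2 V \<Longrightarrow> norm (\<pi> x) \<le> norm x"
    using toeplitz_extension[OF v(1) w] unfolding E2 J2 O2 by blast
  obtain q where q: "cstar_extension compact_operators ?A ?B q"
    "\<And>i. q (vX i) = ?vY i" "\<And>x. x \<in> ?A \<Longrightarrow> norm (q x) \<le> norm x"
    using toeplitz_extension[OF toeplitz_X toeplitz_Y defect_Y, folded compact_operators_eq_ideal,
          folded partial_translation_algebra_X partial_translation_algebra_Y] by blast
  \<comment> \<open>Both defects are nonzero, so norms compare in both directions.\<close>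
  have le_X: "norm y \<le> norm x" if "poly_pair vX v x y" for x y
    using that norm_poly_le_if_defect[OF toeplitz_X v(1) defect_X_nonzero] by (auto simp: poly_pair_def)
  have ge_X: "norm x \<le> norm y" if "poly_pair vX v x y" for x y
    using poly_pair_flip[OF that] norm_poly_le_if_defect[OF v(1) toeplitz_X v(2)] by (auto simp: poly_pair_def)
  obtain \<phi> where \<phi>: "star_iso ?A (cuntz_E2 V) \<phi>" "\<And>i. \<phi> (vX i) = v i"
    "\<And>x. x \<in> ?A \<Longrightarrow> norm (\<phi> x) \<le> norm x"
    using toeplitz_iso[OF toeplitz_X v(1) le_X ge_X]
    unfolding partial_translation_algebra_X[symmetric] E2[symmetric] by blast
  \<comment> \<open>Here both defects vanish, which again gives both directions.\<close>
  have le_Y: "norm y \<le> norm x" if "poly_pair ?vY w x y" for x y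
    using that norm_poly_le_if_no_defect[OF toeplitz_Y w] by (auto simp: poly_pair_def)
  have ge_Y: "norm x \<le> norm y" if "poly_pair ?vY w x y" for x y
    using poly_pair_flip[OF that] norm_poly_le_if_no_defect[OF w(1) toeplitz_Y defect_Y] by (auto simp: poly_pair_def)
  obtain \<psi> where \<psi>: "star_iso ?B (cuntz_algebra 2 W) \<psi>" "\<And>i. \<psi> (?vY i) = w i"
    "\<And>x. x \<in> ?B \<Longrightarrow> norm (\<psi> x) \<le> norm x"
    using toeplitz_iso[OF toeplitz_Y w(1) le_Y ge_Y]
    unfolding partial_translation_algebra_Y[symmetric] O2[symmetric] by blast
  have \<phi>hom: "star_hom ?A (cuntz_E2 V) \<phi>" and \<phi>bij: "bij_betw \<phi> ?A (cuntz_E2 V)"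
    using \<phi>(1) by (auto simp: star_iso_def)
  have \<psi>hom: "star_hom ?B (cuntz_algebra 2 W) \<psi>" and \<psi>bij: "bij_betw \<psi> ?B (cuntz_algebra 2 W)"
    using \<psi>(1) by (auto simp: star_iso_def)
  have qhom: "star_hom ?A ?B q" and qker: "{x \<in> ?A. q x = 0} = compact_operators"
    using q(1) by (auto simp: cstar_extension_def)
  have \<pi>hom: "star_hom (cuntz_E2 V) (cuntz_algebra 2 W) \<pi>" and \<pi>ker: "{x \<in> cuntz_E2 V. \<pi> x = 0} = cuntz_J2 V"
    using \<pi>(1) by (auto simp: cstar_extension_def)
  have qB: "q T \<in> ?B" and \<phi>E: "\<phi> T \<in> cuntz_E2 V" if "T \<in> ?A" for T
    using that qhom \<phi>hom by (auto simp: star_hom_def)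
  have comm: "\<psi> (q T) = \<pi> (\<phi> T)" if "T \<in> ?A" for T
  proof (rule star_hom_unique[OF star_hom_comp[OF qhom \<psi>hom, unfolded partial_translation_algebra_X] _
        star_hom_comp[OF \<phi>hom \<pi>hom, unfolded partial_translation_algebra_X]],
      unfold partial_translation_algebra_X[symmetric])
    show "norm (\<psi> (q x)) \<le> norm x" "norm (\<pi> (\<phi> x)) \<le> norm x" if "x \<in> ?A" for x
      using order_trans[OF \<psi>(3)[OF qB] q(3)] order_trans[OF \<pi>(3)[OF \<phi>E] \<phi>(3)] that by blast+
    show "\<psi> (q x) = \<pi> (\<phi> x)" if "x \<in> range vX" for x
      using that by (auto simp: q(2) \<phi>(2) \<psi>(2) \<pi>(2))
  qed (rule that)
  have B: "cstar_subalgebra ?B" unfolding partial_translation_algebra_Y by (rule cstar_subalgebra_generated)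
  have "\<psi> 0 = 0" using \<psi>(3)[OF cstar_subalgebraD(1)[OF B]] by simp
  then have \<psi>0: "\<psi> y = 0 \<longleftrightarrow> y = 0" if "y \<in> ?B" for y
    using that \<psi>bij cstar_subalgebraD(1)[OF B] by (metis bij_betw_imp_inj_on inj_onD)
  \<comment> \<open>The map on ideals is the restriction of \<open>\<phi>\<close>: the commuting
    square and injectivity of \<open>\<psi>\<close> match the kernels of the two quotient
    maps.\<close>
  have "\<phi> ` compact_operators = cuntz_J2 V"
  proof -
    have "\<phi> ` {x \<in> ?A. q x = 0} = \<phi> ` {x \<in> ?A. \<pi> (\<phi> x) = 0}"
      using comm \<psi>0[OF qB] by (metis (mono_tags, lifting))
    also have "\<dots> = {y \<in> \<phi> ` ?A. \<pi> y = 0}" by blast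
    also have "\<phi> ` ?A = cuntz_E2 V" using \<phi>bij by (simp add: bij_betw_def)
    finally show ?thesis by (simp add: qker \<pi>ker)
  qed
  moreover have KA: "compact_operators \<subseteq> ?A" using qker by blast
  ultimately have K: "star_iso compact_operators (cuntz_J2 V) \<phi>"
    using \<phi>hom inj_on_subset[OF bij_betw_imp_inj_on[OF \<phi>bij]]
    unfolding star_iso_def star_hom_def bij_betw_def by blast
  show ?thesis
    by (rule exI[of _ \<pi>], rule exI[of _ q], rule exI[of _ \<phi>], rule exI[of _ \<phi>], rule exI[of _ \<psi>])
      (use \<pi>(1) q(1) K \<phi>(1) \<psi>(1) comm \<pi>(2)[of Gen_a] \<pi>(2)[of Gen_b] q(2)[of Gen_a] q(2)[of Gen_b]
        \<phi>(2)[of Gen_a] \<phi>(2)[of Gen_b] \<psi>(2)[of Gen_a] \<psi>(2)[of Gen_b] in \<open>simp add: gens\<close>)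
qed

end
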